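(* Let $(X,\mu,(T_n)_{n\in\mathbb Z})$ be the infinite Chacon system, where $T_1$ is the infinite Chacon transformation. Then $T_1$ has Radon MSJ.
   Context: **The infinite Chacon system.** Put $h_0:=1$, $h_{n+1}:=6h_n+1$ for $n\ge 0$, and for $n\ge 0$ $$F_n:=\left\{-\tfrac{h_n-1}2,-\tfrac{h_n-3}2,\dots,\tfrac{h_n-1}2\right\}\subset\mathbb Z,\qquad C_{n+1}:=\{-h_n,0,h_n+1\}.$$ Let $X_n:=F_n\times C_{n+1}\times C_{n+2}\times\cdots$ with the product topology. The map $(f_n,c_{n+1},c_{n+2},\dots)\mapsto(f_n+c_{n+1},c_{n+2},\dots)$ is a topological embedding $X_n\to X_{n+1}$, by which $X_n$ is regarded as a (compact open) subset of $X_{n+1}$; $X=\bigcup_n X_n$ is the inductive limit, a locally compact non-compact Cantor space. For $A\subset F_n$ let $[A]_n:=\{(f_n,c_{n+1},\dots)\in X_n: f_n\in A\}$ and $[f]_n:=[\{f\}]_n$. For $g\in\mathbb Z$ and $x\in X$, for all large $n$ one has $x=(f_n,c_{n+1},\dots)\in X_n$ with $g+f_n\in F_n$, and $T_gx:=(g+f_n,c_{n+1},c_{n+2},\dots)\in X_n$; this is a well-defined free continuous $\mathbb Z$-action on $X$. $\mu$ is the unique Borel measure on $X$ with $\mu([f]_n)=3^{-n}$ for all $f\in F_n$, $n\ge0$; it is an infinite, Radon, $T_1$-invariant, ergodic measure. **Radon MSJ.** A Borel measure on a locally compact space is Radon if it is finite on compact sets. For $d>1$, a $d$-fold Radon self-joining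 of $T_1$ is a Radon $(T_1)^{\times d}$-invariant measure on $X^d$ all of whose coordinate projections (which need not be $\sigma$-finite) are equivalent to $\mu$, i.e. have the same null sets. $J^e_{d,\mathrm{Ra}}(T_1)$ is the set of those which are ergodic for $(T_1)^{\times d}$. $C(T_1)$ is the group of all invertible $\mu$-nonsingular transformations of $(X,\mu)$ commuting with $T_1$ (mod $\mu$-null sets). For $S_1,\dots,S_{d-1}\in C(T_1)$ the graph-joining $\mu_{S_1,\dots,S_{d-1}}$ is the measure on $X^d$ with $\mu_{S_1,\dots,S_{d-1}}(A_1\times\cdots\times A_d)=\mu(A_1\cap S_1^{-1}A_2\cap\cdots\cap S_{d-1}^{-1}A_d)$. $T_1$ has Radon MSJ$_d$ if $C(T_1)=\{T_n: n\in\mathbb Z\}$ and for each $\lambda\in J^e_{d,\mathrm{Ra}}(T_1)$ there is a partition of $\{1,\dots,d\}$ into subsets $J_1,\dots,J_k$ such that $\lambda$ is the direct product of its marginals $\lambda_i$ on $X^{J_i}$, where (up to a multiplicative constant) $\lambda_i$ is a graph-joining of $T_1$ if $\#J_i>1$ and $\lambda_i=\mu$ if $\#J_i=1$. $T_1$ has Radon MSJ if it has Radon MSJ$_d$ for every $d>1$. *)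

theory Defs
  imports "HOL-Analysis.Analysis" "HOL-Library.Disjoint_Sets"
begin

definition borel_of :: "'a topology \<Rightarrow> 'a measure" where
  "borel_of \<tau> = sigma (topspace \<tau>) {U. openin \<tau> U}"

text \<open>\<open>X\<^sup>J\<close> consists of the functions on \<open>J\<close> that are \<^const>\<open>undefined\<close> off \<open>J\<close>;
  \<open>X\<^sup>d\<close> is the case \<open>J = {1..d}\<close>.\<close>

abbreviation pow_top :: "nat set \<Rightarrow> (nat \<Rightarrow> 'a::topological_space) topology" where
  "pow_top J \<equiv> product_topology (\<lambda>_. euclidean) J"

definition radon_on :: "'a topology \<Rightarrow> 'a measure \<Rightarrow> bool" where
  "radon_on \<tau> M \<longleftrightarrow>
     sets M = sets (borel_of \<tau>) \<and> (\<forall>K. compactin \<tau> K \<longrightarrow> emeasure M K < \<infinity>)"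

definition invariant_under :: "('a \<Rightarrow> 'a) \<Rightarrow> 'a measure \<Rightarrow> bool" where
  "invariant_under f M \<longleftrightarrow>
     f \<in> measurable M M \<and> (\<forall>A\<in>sets M. emeasure M (f -` A \<inter> space M) = emeasure M A)"

definition ergodic_under :: "('a \<Rightarrow> 'a) \<Rightarrow> 'a measure \<Rightarrow> bool" where
  "ergodic_under f M \<longleftrightarrow>
     (\<forall>A\<in>sets M. f -` A \<inter> space M = A \<longrightarrow> A \<in> null_sets M \<or> space M - A \<in> null_sets M)"

definition diag_map :: "nat set \<Rightarrow> ('a \<Rightarrow> 'a) \<Rightarrow> (nat \<Rightarrow> 'a) \<Rightarrow> nat \<Rightarrow> 'a" where
  "diag_map J f x = (\<lambda>j\<in>J. f (x j))"

definition radon_self_joining ::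
    "nat \<Rightarrow> 'a::topological_space measure \<Rightarrow> ('a \<Rightarrow> 'a) \<Rightarrow> (nat \<Rightarrow> 'a) measure \<Rightarrow> bool" where
  "radon_self_joining d \<mu> f \<theta> \<longleftrightarrow>
     radon_on (pow_top {1..d}) \<theta> \<and>
     invariant_under (diag_map {1..d} f) \<theta> \<and>
     (\<forall>i\<in>{1..d}. null_sets (distr \<theta> \<mu> (\<lambda>x. x i)) = null_sets \<mu>)"

definition ergodic_radon_self_joinings ::
    "nat \<Rightarrow> 'a::topological_space measure \<Rightarrow> ('a \<Rightarrow> 'a) \<Rightarrow> (nat \<Rightarrow> 'a) measure set" where
  "ergodic_radon_self_joinings d \<mu> f =
     {\<theta>. radon_self_joining d \<mu> f \<theta> \<and> ergodic_under (diag_map {1..d} f) \<theta>}"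

text \<open>Invertibility, like commutation, is only required modulo null sets.\<close>

definition invertible_nonsingular :: "'a measure \<Rightarrow> ('a \<Rightarrow> 'a) \<Rightarrow> bool" where
  "invertible_nonsingular \<mu> S \<longleftrightarrow>
     S \<in> measurable \<mu> \<mu> \<and>
     (\<exists>R\<in>measurable \<mu> \<mu>. (AE x in \<mu>. R (S x) = x) \<and> (AE x in \<mu>. S (R x) = x)) \<and>
     null_sets (distr \<mu> \<mu> S) = null_sets \<mu>"

definition centralizer :: "'a measure \<Rightarrow> ('a \<Rightarrow> 'a) \<Rightarrow> ('a \<Rightarrow> 'a) set" where
  "centralizer \<mu> f =
     {S. invertible_nonsingular \<mu> S \<and> (AE x in \<mu>. S (f x) = f (S x))}"

text \<open>A graph-joining on \<open>X\<^sup>J\<close>: the least element of \<open>J\<close> plays the role of the first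
  coordinate, which carries the identity.\<close>

definition graph_joining ::
    "nat set \<Rightarrow> 'a::topological_space measure \<Rightarrow> ('a \<Rightarrow> 'a) \<Rightarrow> (nat \<Rightarrow> 'a) measure \<Rightarrow> bool" where
  "graph_joining J \<mu> f \<kappa> \<longleftrightarrow>
     sets \<kappa> = sets (borel_of (pow_top J)) \<and>
     (\<exists>S. S (Min J) = id \<and> (\<forall>j\<in>J - {Min J}. S j \<in> centralizer \<mu> f) \<and>
        (\<forall>A\<in>J \<rightarrow> sets \<mu>. emeasure \<kappa> (Pi\<^sub>E J A) = emeasure \<mu> (\<Inter>j\<in>J. S j -` A j \<inter> space \<mu>)))"

text \<open>\<open>\<P>\<close> is the partition of \<open>{1..d}\<close> and \<open>\<nu> J\<close> is the factor of \<open>\<theta>\<close> on \<open>X\<^sup>J\<close>.  That \<open>\<theta>\<close> is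
  the direct product of the \<open>\<nu> J\<close> is expressed through the canonical identification of \<open>X\<^sup>d\<close> with
  the product of the \<open>X\<^sup>J\<close>.  As all measures are infinite, the literal push-forward of \<open>\<theta>\<close>
  to \<open>X\<^sup>J\<close> is \<open>\<infinity> \<cdot> \<nu> J\<close> when there is more than one block; the marginals of a product are
  therefore understood to be its (\<open>\<sigma>\<close>-finite) factors.\<close>

definition product_of_graph_joinings ::
    "nat \<Rightarrow> 'a::topological_space measure \<Rightarrow> ('a \<Rightarrow> 'a) \<Rightarrow> (nat \<Rightarrow> 'a) measure \<Rightarrow> bool" where
  "product_of_graph_joinings d \<mu> f \<theta> \<longleftrightarrow>
     (\<exists>\<P> \<nu>. partition_on {1..d} \<P> \<and>
        distr \<theta> (Pi\<^sub>M \<P> \<nu>) (\<lambda>x. \<lambda>J\<in>\<P>. restrict x J) = Pi\<^sub>M \<P> \<nu> \<and>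
        (\<forall>J\<in>\<P>. sets (\<nu> J) = sets (borel_of (pow_top J)) \<and>
           (\<exists>c::ennreal. 0 < c \<and> c < \<infinity> \<and>
              (if card J > 1 then \<exists>\<kappa>. graph_joining J \<mu> f \<kappa> \<and> \<nu> J = scale_measure c \<kappa>
               else \<forall>i\<in>J. distr (\<nu> J) \<mu> (\<lambda>x. x i) = scale_measure c \<mu>))))"

text \<open>The action \<open>T\<close> of the integers is passed as a whole; the transformation itself is \<open>T 1\<close>.\<close>

definition radon_MSJ_fold ::
    "nat \<Rightarrow> 'a::topological_space measure \<Rightarrow> (int \<Rightarrow> 'a \<Rightarrow> 'a) \<Rightarrow> bool" where
  "radon_MSJ_fold d \<mu> T \<longleftrightarrow>
     (\<forall>n. T n \<in> centralizer \<mu> (T 1)) \<and>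
     (\<forall>S\<in>centralizer \<mu> (T 1). \<exists>n. AE x in \<mu>. S x = T n x) \<and>
     (\<forall>\<theta>\<in>ergodic_radon_self_joinings d \<mu> (T 1). product_of_graph_joinings d \<mu> (T 1) \<theta>)"

definition radon_MSJ :: "'a::topological_space measure \<Rightarrow> (int \<Rightarrow> 'a \<Rightarrow> 'a) \<Rightarrow> bool" where
  "radon_MSJ \<mu> T \<longleftrightarrow> (\<forall>d>1. radon_MSJ_fold d \<mu> T)"

primrec chacon_h :: "nat \<Rightarrow> int" where
  "chacon_h 0 = 1"
| "chacon_h (Suc n) = 6 * chacon_h n + 1"

text \<open>All \<open>chacon_h n\<close> are odd, so the division is exact.\<close>

definition chacon_F :: "nat \<Rightarrow> int set" where
  "chacon_F n = {- ((chacon_h n - 1) div 2) .. (chacon_h n - 1) div 2}"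

text \<open>Only used for \<open>k \<ge> 1\<close>.\<close>

definition chacon_C :: "nat \<Rightarrow> int set" where
  "chacon_C k = {- chacon_h (k - 1), 0, chacon_h (k - 1) + 1}"

text \<open>A point \<open>(f\<^sub>n, c\<^sub>n\<^sub>+\<^sub>1, c\<^sub>n\<^sub>+\<^sub>2, \<dots>)\<close> of \<open>X\<^sub>n\<close> is a function \<open>y\<close> on \<open>{n..}\<close> with \<open>y n = f\<^sub>n\<close> and
  \<open>y k = c\<^sub>k\<close> for \<open>k > n\<close>.\<close>

definition chacon_Xn_top :: "nat \<Rightarrow> (nat \<Rightarrow> int) topology" where
  "chacon_Xn_top n =
     product_topology (\<lambda>k. discrete_topology (if k = n then chacon_F n else chacon_C k)) {n..}"

abbreviation chacon_Xn :: "nat \<Rightarrow> (nat \<Rightarrow> int) set" where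
  "chacon_Xn n \<equiv> topspace (chacon_Xn_top n)"

definition chacon_emb :: "nat \<Rightarrow> (nat \<Rightarrow> int) \<Rightarrow> nat \<Rightarrow> int" where
  "chacon_emb n y = (\<lambda>k\<in>{Suc n..}. if k = Suc n then y n + y (Suc n) else y k)"

primrec chacon_emb_iter :: "nat \<Rightarrow> nat \<Rightarrow> (nat \<Rightarrow> int) \<Rightarrow> nat \<Rightarrow> int" where
  "chacon_emb_iter n 0 y = y"
| "chacon_emb_iter n (Suc i) y = chacon_emb (n + i) (chacon_emb_iter n i y)"

text \<open>The inductive limit is the quotient of the disjoint union of the \<open>X\<^sub>n\<close> that identifies two
  points when their images in some later \<open>X\<^sub>N\<close> agree.\<close>

definition chacon_rel :: "nat \<times> (nat \<Rightarrow> int) \<Rightarrow> nat \<times> (nat \<Rightarrow> int) \<Rightarrow> bool" where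
  "chacon_rel p q \<longleftrightarrow>
     snd p \<in> chacon_Xn (fst p) \<and> snd q \<in> chacon_Xn (fst q) \<and>
     (\<exists>i j. fst p + i = fst q + j \<and>
        chacon_emb_iter (fst p) i (snd p) = chacon_emb_iter (fst q) j (snd q))"

lemma chacon_emb_iter_add:
  "chacon_emb_iter n (i + k) y = chacon_emb_iter (n + i) k (chacon_emb_iter n i y)"
  by (induction k) (simp_all add: add.assoc)

lemma chacon_rel_part_equivp: "part_equivp chacon_rel"
proof (rule part_equivpI)
  have "(\<lambda>k\<in>{0..}. 0) \<in> chacon_Xn 0"
    by (auto simp: chacon_Xn_top_def chacon_F_def chacon_C_def)
  then show "\<exists>p. chacon_rel p p"
    by (intro exI[of _ "(0, \<lambda>k\<in>{0..}. 0)"]) (auto simp: chacon_rel_def)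
  show "symp chacon_rel"
    by (rule sympI) (unfold chacon_rel_def, metis)
  show "transp chacon_rel"
  proof (rule transpI)
    fix p q r assume pq: "chacon_rel p q" and qr: "chacon_rel q r"
    obtain i j where ij: "fst p + i = fst q + j"
        "chacon_emb_iter (fst p) i (snd p) = chacon_emb_iter (fst q) j (snd q)"
      using pq by (auto simp: chacon_rel_def)
    obtain k l where kl: "fst q + k = fst r + l"
        "chacon_emb_iter (fst q) k (snd q) = chacon_emb_iter (fst r) l (snd r)"
      using qr by (auto simp: chacon_rel_def)
    have "chacon_emb_iter (fst p) (i + k) (snd p) = chacon_emb_iter (fst q) (j + k) (snd q)"
      by (simp add: chacon_emb_iter_add ij)
    also have "\<dots> = chacon_emb_iter (fst r) (l + j) (snd r)"
      by (subst add.commute) (simp add: chacon_emb_iter_add kl)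
    finally have "chacon_emb_iter (fst p) (i + k) (snd p) = chacon_emb_iter (fst r) (l + j) (snd r)" .
    moreover have "fst p + (i + k) = fst r + (l + j)"
      using ij(1) kl(1) by linarith
    ultimately show "chacon_rel p r"
      using pq qr unfolding chacon_rel_def by blast
  qed
qed

quotient_type chacon = "nat \<times> (nat \<Rightarrow> int)" / partial: chacon_rel
  by (rule chacon_rel_part_equivp)

text \<open>The canonical map from \<open>X\<^sub>n\<close> to \<open>X\<close>, meaningful on \<open>chacon_Xn n\<close>.\<close>

definition chacon_pt :: "nat \<Rightarrow> (nat \<Rightarrow> int) \<Rightarrow> chacon" where
  "chacon_pt n y = abs_chacon (n, y)"

instantiation chacon :: topological_space
begin

definition open_chacon :: "chacon set \<Rightarrow> bool" where
  "open_chacon U \<longleftrightarrow> (\<forall>n. openin (chacon_Xn_top n) {y \<in> chacon_Xn n. chacon_pt n y \<in> U})"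

instance
proof
  show "open (UNIV :: chacon set)"
    by (simp add: open_chacon_def)
  fix U V :: "chacon set" assume "open U" "open V"
  moreover have "{y \<in> chacon_Xn n. chacon_pt n y \<in> U \<inter> V} =
      {y \<in> chacon_Xn n. chacon_pt n y \<in> U} \<inter> {y \<in> chacon_Xn n. chacon_pt n y \<in> V}" for n
    by auto
  ultimately show "open (U \<inter> V)"
    by (simp add: open_chacon_def openin_Int)
next
  fix K :: "chacon set set" assume "\<forall>U\<in>K. open U"
  moreover have "{y \<in> chacon_Xn n. chacon_pt n y \<in> \<Union>K} =
      (\<Union>U\<in>K. {y \<in> chacon_Xn n. chacon_pt n y \<in> U})" for n
    by auto
  ultimately show "open (\<Union>K)"
    by (auto simp: open_chacon_def)
qed

end

definition chacon_cyl :: "nat \<Rightarrow> int set \<Rightarrow> chacon set" where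
  "chacon_cyl n A = chacon_pt n ` {y \<in> chacon_Xn n. y n \<in> A}"

definition chacon_T :: "int \<Rightarrow> chacon \<Rightarrow> chacon" where
  "chacon_T g x = (THE z. \<forall>\<^sub>F n in sequentially. \<exists>y\<in>chacon_Xn n.
     x = chacon_pt n y \<and> g + y n \<in> chacon_F n \<and> z = chacon_pt n (y(n := g + y n)))"

definition chacon_measure :: "chacon measure" where
  "chacon_measure = (THE M. sets M = sets borel \<and>
     (\<forall>n. \<forall>f\<in>chacon_F n. emeasure M (chacon_cyl n {f}) = ennreal (1 / 3 ^ n)))"

end

theory Submission
  imports Defs "HOL-Probability.Probability"
begin

text \<open>Let \<open>\<theta>\<close> be an ergodic self-joining on \<open>X\<^sup>J\<close>, and call the vector of the digits \<open>c\<^sub>n\<^sub>+\<^sub>1\<close> of the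
  coordinates of a point its pattern at \<open>n\<close>.  Suppose first that almost every point has infinitely
  often a pattern that takes exactly the two values \<open>- h\<^sub>n, 0\<close> or exactly \<open>0, h\<^sub>n + 1\<close>, the larger value
  on a fixed set \<open>I\<close>.  Then the power \<open>h\<^sub>n\<close> of the diagonal action moves the coordinates in \<open>I\<close> across the
  spacer, so that it acts on the first \<open>n\<close> digits as \<open>T\<^sub>-\<^sub>1\<close> on \<open>I\<close> and trivially off \<open>I\<close>.  This
  makes \<open>\<theta>\<close> quasi-invariant, and then invariant, under the shift of the coordinates in \<open>I\<close> alone, and
  with the ergodicity of \<open>\<theta>\<close> it splits \<open>\<theta>\<close> as a product over \<open>I\<close> and \<open>J - I\<close>; one concludes by induction.
  Otherwise the patterns are eventually constant or contain both \<open>- h\<^sub>n\<close> and \<open>h\<^sub>n + 1\<close>.  As \<open>X\<^sub>n\<close> occupies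
  less than half of \<open>F\<^sub>n\<^sub>+\<^sub>1\<close>, two points of an orbit then have the same nonconstant patterns, so by
  ergodicity these are deterministic; as the marginals are equivalent to \<open>\<mu>\<close>, only finitely many occur.
  Eventually constant patterns mean that all coordinates lie in one orbit, which yields a graph joining.\<close>

section \<open>Coordinates and the action\<close>

text \<open>The factor 6 in \<open>chacon_h\<close> does two jobs. Points of X_n can be moved by up
  to h_n inside F_(n+1), so that such powers act on positions by mere addition. And positions of two
  points of X_n differ at level n+1 by at most 3 h_n, so that two such differences cannot make up
  h_(n+1), the smallest gap between the next digits. Which of the two adjacent patterns occurs
  decides the sign of the power, and it cannot be prescribed. Hence the comparison is two-sided: the
  measure of a set is at most the sum of the measures of its preimages under the partial shifts by 1
  and by -1. Ergodicity turns this into preservation of null sets. As partial shifts commute with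
  the diagonal action, the measure is then merely scaled by some r; that r = 1 needs large powers. A
  projection to fewer coordinates need not be sigma-finite, so the splitting uses slices, with the
  other coordinates confined to a compact set. The centralizer is read off from the classification
  of two-fold joinings, applied to the graph of S.\<close>

lemma chacon_h_ge_1: "1 \<le> chacon_h n"
  by (induction n) auto

lemma odd_chacon_h: "odd (chacon_h n)"
  by (cases n) auto

text \<open>Oddness of \<open>chacon_h n\<close> removes the division, so that later bounds are
  plain linear arithmetic.\<close>

lemma mem_chacon_F: "f \<in> chacon_F n \<longleftrightarrow> 2 * \<bar>f\<bar> < chacon_h n"
  using odd_chacon_h[of n] by (auto simp: chacon_F_def elim!: oddE)

lemma mem_chacon_C: "c \<in> chacon_C (Suc n) \<longleftrightarrow> c = - chacon_h n \<or> c = 0 \<or> c = chacon_h n + 1"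
  by (auto simp: chacon_C_def)

lemma finite_chacon_F: "finite (chacon_F n)"
  by (simp add: chacon_F_def)

text \<open>The elements of \<open>chacon_C (Suc n)\<close> are at least h_n apart, and h_n is the
  number of points of \<open>chacon_F n\<close>, so the three translates are disjoint. This is the
  injectivity of the embedding of X_n into X_(n+1).\<close>

lemma chacon_F_C_unique:
  assumes "f \<in> chacon_F n" "f' \<in> chacon_F n" "c \<in> chacon_C (Suc n)" "c' \<in> chacon_C (Suc n)" "f + c = f' + c'"
  shows "f = f'" "c = c'"
  using assms unfolding mem_chacon_F mem_chacon_C by auto

lemma chacon_F_add_C: "f \<in> chacon_F n \<Longrightarrow> c \<in> chacon_C (Suc n) \<Longrightarrow> f + c \<in> chacon_F (Suc n)"
  unfolding mem_chacon_F mem_chacon_C using chacon_h_ge_1[of n] by auto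

lemma atLeast_cases:
  assumes "k \<in> {n::nat..}"
  obtains "k = n" | j where "k = Suc j" "n \<le> j"
  using assms by (cases k) (auto simp: le_Suc_eq)

lemma mem_chacon_Xn:
  "y \<in> chacon_Xn n \<longleftrightarrow> y \<in> extensional {n..} \<and> y n \<in> chacon_F n \<and> (\<forall>k\<ge>n. y (Suc k) \<in> chacon_C (Suc k))"
proof -
  have "(\<forall>k\<in>{n..}. y k \<in> (if k = n then chacon_F n else chacon_C k)) \<longleftrightarrow>
     y n \<in> chacon_F n \<and> (\<forall>k\<ge>n. y (Suc k) \<in> chacon_C (Suc k))"
    (is "?l \<longleftrightarrow> ?r")
  proof
    assume ?l
    then have "y n \<in> chacon_F n" "y (Suc k) \<in> chacon_C (Suc k)" if "n \<le> k" for k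
      using that by (auto dest: bspec[of _ _ n] bspec[of _ _ "Suc k"])
    then show ?r by blast
  next
    assume ?r
    show ?l
    proof
      fix k assume "k \<in> {n..}"
      then show "y k \<in> (if k = n then chacon_F n else chacon_C k)"
        by (cases rule: atLeast_cases) (use \<open>?r\<close> in auto)
    qed
  qed
  then show ?thesis
    unfolding chacon_Xn_top_def topspace_product_topology topspace_discrete_topology PiE_iff o_def by blast
qed

lemma chacon_emb_in_Xn: "y \<in> chacon_Xn n \<Longrightarrow> chacon_emb n y \<in> chacon_Xn (Suc n)"
  by (auto simp: mem_chacon_Xn chacon_emb_def intro: chacon_F_add_C)

lemma chacon_emb_inj:
  assumes "y \<in> chacon_Xn n" "y' \<in> chacon_Xn n" "chacon_emb n y = chacon_emb n y'"
  shows "y = y'"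
proof (rule extensionalityI[of _ "{n..}"])
  have e: "k > n \<Longrightarrow> chacon_emb n y k = chacon_emb n y' k" for k
    using assms(3) by simp
  have 1: "y n + y (Suc n) = y' n + y' (Suc n)"
    using e[of "Suc n"] by (simp add: chacon_emb_def)
  then have 2: "y n = y' n" "y (Suc n) = y' (Suc n)"
    using chacon_F_C_unique[OF _ _ _ _ 1] assms(1,2) by (auto simp: mem_chacon_Xn)
  fix k assume "k \<in> {n..}"
  then consider "k = n" | "k = Suc n" | "k > Suc n" by force
  then show "y k = y' k"
    using 2 e[of k] by cases (auto simp: chacon_emb_def)
qed (use assms in \<open>auto simp: mem_chacon_Xn\<close>)

lemma chacon_emb_iter_in_Xn: "y \<in> chacon_Xn n \<Longrightarrow> chacon_emb_iter n i y \<in> chacon_Xn (n + i)"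
  by (induction i) (auto intro: chacon_emb_in_Xn)

lemma chacon_emb_iter_inj:
  "y \<in> chacon_Xn n \<Longrightarrow> y' \<in> chacon_Xn n \<Longrightarrow> chacon_emb_iter n i y = chacon_emb_iter n i y' \<Longrightarrow> y = y'"
  by (induction i) (auto dest: chacon_emb_inj[rotated 2] intro: chacon_emb_iter_in_Xn)

lemma chacon_pt_eq_iff:
  assumes "y \<in> chacon_Xn n" "y' \<in> chacon_Xn m"
  shows "chacon_pt n y = chacon_pt m y' \<longleftrightarrow> chacon_rel (n, y) (m, y')"
proof -
  have "chacon_rel (n, y) (n, y)" "chacon_rel (m, y') (m, y')"
    using assms unfolding chacon_rel_def by auto
  then show ?thesis
    unfolding chacon_pt_def using Quotient3_rel[OF Quotient3_chacon] by blast
qed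

lemma chacon_pt_inj: "y \<in> chacon_Xn n \<Longrightarrow> y' \<in> chacon_Xn n \<Longrightarrow> chacon_pt n y = chacon_pt n y' \<Longrightarrow> y = y'"
  by (auto simp: chacon_pt_eq_iff chacon_rel_def dest: chacon_emb_iter_inj)

lemma chacon_pt_emb: "y \<in> chacon_Xn n \<Longrightarrow> chacon_pt (Suc n) (chacon_emb n y) = chacon_pt n y"
  by (subst chacon_pt_eq_iff)
     (auto simp: chacon_rel_def chacon_emb_in_Xn intro!: exI[of _ 0] exI[of _ 1])

section \<open>The sets X_n inside X; positions and digits of points\<close>

definition lev :: "nat \<Rightarrow> chacon set" where
  "lev n = chacon_pt n ` chacon_Xn n"

text \<open>Off \<open>lev n\<close> there is no witness, so \<open>coords n x\<close>, and
  \<open>pos n x\<close> with it, is unspecified; membership in \<open>lev n\<close> therefore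
  accompanies most statements about positions.\<close>

definition coords :: "nat \<Rightarrow> chacon \<Rightarrow> nat \<Rightarrow> int" where
  "coords n x = (THE y. y \<in> chacon_Xn n \<and> x = chacon_pt n y)"

definition pos :: "nat \<Rightarrow> chacon \<Rightarrow> int" where
  "pos n x = coords n x n"

text \<open>This is the digit c_(n+1), see \<open>inc_eq_coords\<close>. Written as a difference of
  positions it makes sums of digits telescope.\<close>

definition inc :: "nat \<Rightarrow> chacon \<Rightarrow> int" where
  "inc n x = pos (Suc n) x - pos n x"

lemma coords_pt: "y \<in> chacon_Xn n \<Longrightarrow> coords n (chacon_pt n y) = y"
  unfolding coords_def by (rule the_equality) (auto dest: chacon_pt_inj)

lemma coords_in_Xn: "x \<in> lev n \<Longrightarrow> coords n x \<in> chacon_Xn n"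
  and pt_coords: "x \<in> lev n \<Longrightarrow> chacon_pt n (coords n x) = x"
  by (auto simp: lev_def coords_pt)

lemma lev_Suc: "x \<in> lev n \<Longrightarrow> x \<in> lev (Suc n)"
  and coords_Suc: "x \<in> lev n \<Longrightarrow> coords (Suc n) x = chacon_emb n (coords n x)"
  by (metis chacon_emb_in_Xn chacon_pt_emb imageI lev_def pt_coords coords_in_Xn)
     (metis chacon_emb_in_Xn chacon_pt_emb pt_coords coords_in_Xn coords_pt)

lemma lev_mono: "m \<le> n \<Longrightarrow> lev m \<subseteq> lev n"
  by (rule lift_Suc_mono_le[of lev]) (auto intro: lev_Suc)

lemma lev_le: "x \<in> lev m \<Longrightarrow> m \<le> n \<Longrightarrow> x \<in> lev n"
  using lev_mono by blast

lemma ex_lev: "\<exists>n. x \<in> lev n"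
proof -
  obtain p where p: "chacon_rel p p" "x = abs_chacon p"
    using Quotient3_abs_rep[OF Quotient3_chacon] Quotient3_rel_rep[OF Quotient3_chacon] by metis
  then have "snd p \<in> chacon_Xn (fst p)" "x = chacon_pt (fst p) (snd p)"
    by (auto simp: chacon_rel_def chacon_pt_def)
  then show ?thesis by (auto simp: lev_def)
qed

lemma pos_in_F: "x \<in> lev n \<Longrightarrow> pos n x \<in> chacon_F n"
  using coords_in_Xn[of x n] by (auto simp: pos_def mem_chacon_Xn)

lemma inc_eq_coords: "x \<in> lev n \<Longrightarrow> inc n x = coords n x (Suc n)"
  by (simp add: inc_def pos_def coords_Suc chacon_emb_def)

lemma inc_in_C: "x \<in> lev n \<Longrightarrow> inc n x \<in> chacon_C (Suc n)"
  using coords_in_Xn[of x n] by (auto simp: inc_eq_coords mem_chacon_Xn)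

lemma inc_cases: "x \<in> lev n \<Longrightarrow> inc n x = - chacon_h n \<or> inc n x = 0 \<or> inc n x = chacon_h n + 1"
  using inc_in_C mem_chacon_C by blast

lemma pos_Suc: "pos (Suc n) x = pos n x + inc n x"
  by (simp add: inc_def)

lemma coords_eq_inc: "n \<le> k \<Longrightarrow> x \<in> lev n \<Longrightarrow> coords n x (Suc k) = inc k x"
proof (induction n rule: inc_induct)
  case (step n)
  then have "coords n x (Suc k) = coords (Suc n) x (Suc k)"
    by (simp add: coords_Suc chacon_emb_def)
  with step show ?case by (simp add: lev_Suc)
qed (simp add: inc_eq_coords)

lemma lev_eqI:
  assumes "x \<in> lev n" "y \<in> lev n" "pos n x = pos n y" "\<And>k. n \<le> k \<Longrightarrow> inc k x = inc k y"
  shows "x = y"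
proof -
  have "coords n x = coords n y"
  proof (rule extensionalityI[of _ "{n..}"])
    fix k assume "k \<in> {n..}"
    then consider "k = n" | j where "k = Suc j" "n \<le> j"
      by (rule atLeast_cases)
    then show "coords n x k = coords n y k"
      using assms by cases (auto simp: pos_def[symmetric] coords_eq_inc)
  qed (use assms coords_in_Xn in \<open>auto simp: mem_chacon_Xn\<close>)
  then show ?thesis
    using assms pt_coords by metis
qed

lemma lev_eqI_pos:
  assumes "x \<in> lev n" "y \<in> lev n" "\<And>k. n \<le> k \<Longrightarrow> pos k x = pos k y"
  shows "x = y"
  using assms by (intro lev_eqI[of x n y]) (auto simp: inc_def)

text \<open>Points are constructed from sequences of positions: the increments are the digits, and
  \<open>p n\<close> is the first coordinate.\<close>

lemma ex_point:
  assumes "p n \<in> chacon_F n" "\<And>k. n \<le> k \<Longrightarrow> p (Suc k) - p k \<in> chacon_C (Suc k)"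
  obtains x where "x \<in> lev n" "\<And>k. n \<le> k \<Longrightarrow> pos k x = p k"
proof -
  define y where "y = (\<lambda>k\<in>{n..}. if k = n then p n else p k - p (k - 1))"
  have y: "y \<in> chacon_Xn n"
    using assms by (auto simp: mem_chacon_Xn y_def)
  define x where "x = chacon_pt n y"
  have x: "x \<in> lev n" "coords n x = y"
    using y by (auto simp: x_def lev_def coords_pt)
  have "pos k x = p k" if "n \<le> k" for k
    using that
  proof (induction k rule: dec_induct)
    case base
    then show ?case using x(2) by (simp add: pos_def y_def)
  next
    case (step k)
    then have "inc k x = p (Suc k) - p k"
      using coords_eq_inc[OF step(1) x(1)] x(2) by (simp add: y_def)
    then show ?case using step by (simp add: pos_Suc)
  qed
  then show ?thesis using x that by blast
qed

text \<open>Prepending f to the positions of x from level n+1 on gives a point of X_n, and this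
  point must be x. So membership in X_n is visible from the position at level n+1.\<close>

lemma lev_Suc_decompose:
  assumes "x \<in> lev (Suc n)" "pos (Suc n) x = f + c" "f \<in> chacon_F n" "c \<in> chacon_C (Suc n)"
  shows "x \<in> lev n" "pos n x = f" "inc n x = c"
proof -
  obtain z where z: "z \<in> lev n" "\<And>k. n \<le> k \<Longrightarrow> pos k z = (if k = n then f else pos k x)"
  proof (rule ex_point[of "\<lambda>k. if k = n then f else pos k x" n])
    fix k assume "n \<le> k"
    then show "(if Suc k = n then f else pos (Suc k) x) - (if k = n then f else pos k x) \<in> chacon_C (Suc k)"
      using assms inc_in_C[OF lev_le[OF assms(1), of k]] by (auto simp: inc_def)
  qed (use assms in auto)
  have "x = z"
    using z assms by (intro lev_eqI_pos[of x "Suc n"]) (auto simp: lev_Suc)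
  moreover have "pos n z = f"
    by (simp add: z(2))
  ultimately show "x \<in> lev n" "pos n x = f" "inc n x = c"
    using z(1) assms(2) by (simp_all add: inc_def)
qed

text \<open>Going down from n, the position at each level splits in only one way into a position and
  a digit. Hence the position at n decides membership in X_m and all positions in between; this is
  how statements about a high level reach the lower ones.\<close>

lemma lev_agree:
  assumes "m \<le> n" "y \<in> lev n" "z \<in> lev m" "pos n y = pos n z"
  shows "y \<in> lev m \<and> (\<forall>k. m \<le> k \<and> k \<le> n \<longrightarrow> pos k y = pos k z)"
  using assms
proof (induction n rule: dec_induct)
  case (step n)
  have z: "z \<in> lev n" using lev_le[OF \<open>z \<in> lev m\<close> \<open>m \<le> n\<close>] .
  have e: "pos (Suc n) y = pos n z + inc n z"
    using \<open>pos (Suc n) y = _\<close> by (simp add: inc_def)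
  have "y \<in> lev n" "pos n y = pos n z"
    using lev_Suc_decompose[OF \<open>y \<in> lev (Suc n)\<close> e pos_in_F[OF z] inc_in_C[OF z]] by auto
  with step.IH step.prems show ?case by (auto simp: le_Suc_eq)
qed (auto simp: le_antisym)

lemma pos_shift_Suc:
  assumes "x \<in> lev n" "pos n x + g \<in> chacon_F n"
  shows "pos (Suc n) x + g \<in> chacon_F (Suc n)"
  using chacon_F_add_C[OF assms(2) inc_in_C[OF assms(1)]] by (simp add: pos_Suc algebra_simps)

lemma pos_shift_le:
  assumes "n \<le> k" "x \<in> lev n" "pos n x + g \<in> chacon_F n"
  shows "pos k x + g \<in> chacon_F k"
  using assms by (induction k rule: dec_induct) (auto intro: pos_shift_Suc lev_le)

text \<open>With h = h_n, twice the absolute value is at most (h - 1) + 2 (h + 1) + 2 h = 5 h + 1,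
  which is below h_(n+1) = 6 h + 1.\<close>

lemma pos_Suc_margin:
  assumes "x \<in> lev n" "\<bar>g\<bar> \<le> chacon_h n"
  shows "pos (Suc n) x + g \<in> chacon_F (Suc n)"
  using pos_in_F[OF assms(1)] inc_cases[OF assms(1)] assms(2) chacon_h_ge_1[of n]
  unfolding mem_chacon_F pos_Suc by auto

lemma chacon_h_ge: "int n < chacon_h n"
  by (induction n) auto

lemma ex_pos_shift:
  "\<exists>n. x \<in> lev n \<and> pos n x + g \<in> chacon_F n"
proof -
  obtain m where "x \<in> lev m" using ex_lev by blast
  then have "x \<in> lev (max m (nat \<bar>g\<bar>))" using lev_le by (metis max.cobounded1)
  moreover have "\<bar>g\<bar> \<le> chacon_h (max m (nat \<bar>g\<bar>))"
    using chacon_h_ge[of "max m (nat \<bar>g\<bar>)"] by linarith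
  ultimately show ?thesis
    using pos_Suc_margin lev_Suc by blast
qed

text \<open>The point z whose positions are those of x plus g is a witness at every level k \<ge> n,
  and at each such level it is the only one. Any candidate for the definite description must agree
  with z at a common large level.\<close>

lemma chacon_T_props:
  assumes "x \<in> lev n" "pos n x + g \<in> chacon_F n"
  shows "chacon_T g x \<in> lev n \<and> (\<forall>k\<ge>n. pos k (chacon_T g x) = pos k x + g)"
proof -
  obtain z where z: "z \<in> lev n" "\<And>k. n \<le> k \<Longrightarrow> pos k z = pos k x + g"
  proof (rule ex_point[of "\<lambda>k. pos k x + g" n])
    show "pos (Suc k) x + g - (pos k x + g) \<in> chacon_C (Suc k)" if "n \<le> k" for k
      using inc_in_C[OF lev_le[OF assms(1) that]] by (simp add: inc_def)
  qed (use assms in auto)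
  have E: "(\<exists>y\<in>chacon_Xn k. x = chacon_pt k y \<and> g + y k \<in> chacon_F k \<and> w = chacon_pt k (y(k := g + y k))) \<longleftrightarrow> w = z"
    if "n \<le> k" for k w
  proof -
    have xk: "x \<in> lev k" "z \<in> lev k" using assms z lev_le that by blast+
    have "coords k z = (coords k x)(k := g + coords k x k)"
    proof (rule extensionalityI[of _ "{k..}"])
      fix j assume "j \<in> {k..}"
      then consider "j = k" | i where "j = Suc i" "k \<le> i"
        by (rule atLeast_cases)
      then show "coords k z j = ((coords k x)(k := g + coords k x k)) j"
        using z(2)[OF that] z(2) that xk
        by cases (auto simp: pos_def[symmetric] coords_eq_inc inc_def)
    qed (use xk coords_in_Xn in \<open>auto simp: mem_chacon_Xn extensional_def\<close>)
    then have z': "z = chacon_pt k ((coords k x)(k := g + coords k x k))"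
      using pt_coords[OF xk(2)] by simp
    have "g + coords k x k \<in> chacon_F k"
      using pos_shift_le[OF that assms] by (simp add: pos_def add.commute)
    with z' xk show ?thesis
      by (metis pt_coords coords_in_Xn coords_pt)
  qed
  have "chacon_T g x = z"
    unfolding chacon_T_def
  proof (rule the_equality)
    show "\<forall>\<^sub>F k in sequentially. \<exists>y\<in>chacon_Xn k. x = chacon_pt k y \<and> g + y k \<in> chacon_F k \<and> z = chacon_pt k (y(k := g + y k))"
      using E eventually_sequentially by blast
    fix w
    assume "\<forall>\<^sub>F k in sequentially. \<exists>y\<in>chacon_Xn k. x = chacon_pt k y \<and> g + y k \<in> chacon_F k \<and> w = chacon_pt k (y(k := g + y k))"
    then obtain K where "\<And>k. K \<le> k \<Longrightarrow> \<exists>y\<in>chacon_Xn k. x = chacon_pt k y \<and> g + y k \<in> chacon_F k \<and> w = chacon_pt k (y(k := g + y k))"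
      unfolding eventually_sequentially by blast
    from this[of "max K n"] show "w = z"
      using E[of "max K n" w] by simp
  qed
  with z show ?thesis by simp
qed

lemma T_in_lev: "x \<in> lev n \<Longrightarrow> pos n x + g \<in> chacon_F n \<Longrightarrow> chacon_T g x \<in> lev n"
  and pos_T: "x \<in> lev n \<Longrightarrow> pos n x + g \<in> chacon_F n \<Longrightarrow> n \<le> k \<Longrightarrow> pos k (chacon_T g x) = pos k x + g"
  and inc_T: "x \<in> lev n \<Longrightarrow> pos n x + g \<in> chacon_F n \<Longrightarrow> n \<le> k \<Longrightarrow> inc k (chacon_T g x) = inc k x"
  using chacon_T_props by (auto simp: inc_def)

lemma T_in_lev_Suc: "x \<in> lev n \<Longrightarrow> \<bar>g\<bar> \<le> chacon_h n \<Longrightarrow> chacon_T g x \<in> lev (Suc n)"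
  and pos_T_Suc: "x \<in> lev n \<Longrightarrow> \<bar>g\<bar> \<le> chacon_h n \<Longrightarrow> pos (Suc n) (chacon_T g x) = pos (Suc n) x + g"
  using T_in_lev pos_T pos_Suc_margin lev_Suc by blast+

lemma T_eventually:
  "\<exists>n. x \<in> lev n \<and> chacon_T g x \<in> lev n \<and> (\<forall>k\<ge>n. pos k (chacon_T g x) = pos k x + g)"
  using ex_pos_shift[of x g] T_in_lev pos_T by metis

lemma T_add: "chacon_T g (chacon_T h x) = chacon_T (g + h) x"
proof -
  obtain n1 where 1: "x \<in> lev n1" "chacon_T h x \<in> lev n1" "\<And>k. n1 \<le> k \<Longrightarrow> pos k (chacon_T h x) = pos k x + h"
    using T_eventually[of x h] by blast
  obtain n2 where 2: "chacon_T g (chacon_T h x) \<in> lev n2" "\<And>k. n2 \<le> k \<Longrightarrow> pos k (chacon_T g (chacon_T h x)) = pos k (chacon_T h x) + g"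
    using T_eventually[of "chacon_T h x" g] by blast
  obtain n3 where 3: "chacon_T (g + h) x \<in> lev n3" "\<And>k. n3 \<le> k \<Longrightarrow> pos k (chacon_T (g + h) x) = pos k x + (g + h)"
    using T_eventually[of x "g + h"] by blast
  let ?n = "max n1 (max n2 n3)"
  show ?thesis
    using 1 2 3 by (intro lev_eqI_pos[of _ ?n]) (auto intro: lev_le)
qed

lemma T_0[simp]: "chacon_T 0 x = x"
proof -
  obtain n where "x \<in> lev n" "chacon_T 0 x \<in> lev n" "\<And>k. n \<le> k \<Longrightarrow> pos k (chacon_T 0 x) = pos k x + 0"
    using T_eventually[of x 0] by blast
  then show ?thesis by (intro lev_eqI_pos[of _ n]) auto
qed

lemma T_uminus[simp]: "chacon_T (- g) (chacon_T g x) = x" "chacon_T g (chacon_T (- g) x) = x"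
  by (simp_all add: T_add)

text \<open>Equality of digits from some level on means lying in the same orbit. This is what turns
  eventually constant patterns into a graph.\<close>

lemma T_eqI:
  assumes "x \<in> lev n" "y \<in> lev n" "\<And>k. n \<le> k \<Longrightarrow> inc k x = inc k y"
  shows "y = chacon_T (pos n y - pos n x) x"
  using assms pos_in_F[of y n]
  by (intro lev_eqI[of _ n]) (auto simp: T_in_lev pos_T inc_T)

section \<open>Cylinders and the Borel structure\<close>

definition cyl :: "nat \<Rightarrow> int \<Rightarrow> chacon set" where
  "cyl n f = {x \<in> lev n. pos n x = f}"

lemma chacon_cyl_eq: "chacon_cyl n {f} = cyl n f"
  unfolding chacon_cyl_def cyl_def lev_def pos_def by (auto simp: coords_pt)

text \<open>The factors are discrete, so a basic neighbourhood prescribes finitely many coordinates,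
  all of them below some N.\<close>

lemma openin_Xn_iff:
  "openin (chacon_Xn_top m) S \<longleftrightarrow>
     S \<subseteq> chacon_Xn m \<and> (\<forall>y\<in>S. \<exists>N. \<forall>z\<in>chacon_Xn m. (\<forall>k\<in>{m..N}. z k = y k) \<longrightarrow> z \<in> S)"
    (is "_ \<longleftrightarrow> ?r")
proof
  assume o: "openin (chacon_Xn_top m) S"
  have "\<exists>N. \<forall>z\<in>chacon_Xn m. (\<forall>k\<in>{m..N}. z k = y k) \<longrightarrow> z \<in> S" if yS: "y \<in> S" for y
  proof -
    let ?X = "\<lambda>k. discrete_topology (if k = m then chacon_F m else chacon_C k)"
    obtain U where U: "finite {i \<in> {m..}. U i \<noteq> topspace (?X i)}" "y \<in> Pi\<^sub>E {m..} U" "Pi\<^sub>E {m..} U \<subseteq> S"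
      using bspec[OF o[unfolded chacon_Xn_top_def openin_product_topology_alt] yS] by blast
    obtain N where N: "\<And>i. i \<in> {m..} \<Longrightarrow> U i \<noteq> topspace (?X i) \<Longrightarrow> i \<le> N"
      using U(1) unfolding finite_nat_set_iff_bounded_le by blast
    have "z \<in> S" if z: "z \<in> chacon_Xn m" "\<forall>k\<in>{m..N}. z k = y k" for z
    proof -
      have "z i \<in> U i" if "i \<in> {m..}" for i
      proof (cases "i \<le> N")
        case True
        then show ?thesis using z(2) U(2) that by (auto simp: PiE_iff)
      next
        case False
        then have "U i = topspace (?X i)" using N[OF that] by blast
        then show ?thesis
          using z(1) that unfolding chacon_Xn_top_def topspace_product_topology PiE_iff by simp
      qed
      moreover have "z \<in> extensional {m..}" using z(1) by (simp add: mem_chacon_Xn)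
      ultimately have "z \<in> Pi\<^sub>E {m..} U" by (simp add: PiE_iff)
      then show ?thesis using U(3) by blast
    qed
    then show ?thesis by blast
  qed
  then show ?r using openin_subset[OF o] by blast
next
  assume r: ?r
  define X where "X = (\<lambda>k. discrete_topology (if k = m then chacon_F m else chacon_C k))"
  have X: "openin (X i) V \<longleftrightarrow> V \<subseteq> topspace (X i)" for i V
    by (simp add: X_def)
  have top: "chacon_Xn m = Pi\<^sub>E {m..} (\<lambda>k. topspace (X k))"
    unfolding chacon_Xn_top_def topspace_product_topology o_def X_def ..
  have "openin (product_topology X {m..}) S"
    unfolding openin_product_topology_alt
  proof
    fix y assume y: "y \<in> S"
    then obtain N where N: "\<And>z. z \<in> chacon_Xn m \<Longrightarrow> (\<forall>k\<in>{m..N}. z k = y k) \<Longrightarrow> z \<in> S"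
      using r by blast
    have yX: "y \<in> Pi\<^sub>E {m..} (\<lambda>k. topspace (X k))"
      using y r top by blast
    let ?U = "\<lambda>i. if i \<le> N then {y i} else topspace (X i)"
    have "finite {i \<in> {m..}. ?U i \<noteq> topspace (X i)}"
      by (rule finite_subset[of _ "{..N}"]) auto
    moreover have "\<forall>i\<in>{m..}. openin (X i) (?U i)"
      using yX by (auto simp: X)
    moreover have "y \<in> Pi\<^sub>E {m..} ?U"
      using yX by (auto simp: PiE_iff)
    moreover have "Pi\<^sub>E {m..} ?U \<subseteq> S"
    proof
      fix z assume z: "z \<in> Pi\<^sub>E {m..} ?U"
      then have "\<forall>k\<in>{m..N}. z k = y k" by (force simp: PiE_iff)
      moreover from z have "z i \<in> topspace (X i)" if "i \<in> {m..}" for i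
        using that PiE_mem[OF z that] PiE_mem[OF yX that] by (auto split: if_splits)
      then have "z \<in> chacon_Xn m"
        using z unfolding top by (simp add: PiE_iff)
      ultimately show "z \<in> S" by (intro N)
    qed
    ultimately show "\<exists>U. finite {i \<in> {m..}. U i \<noteq> topspace (X i)} \<and> (\<forall>i\<in>{m..}. openin (X i) (U i)) \<and> y \<in> Pi\<^sub>E {m..} U \<and> Pi\<^sub>E {m..} U \<subseteq> S"
      by (intro exI[of _ ?U] conjI)
  qed
  then show "openin (chacon_Xn_top m) S"
    by (simp add: chacon_Xn_top_def X_def)
qed

lemma pos_sum:
  assumes "m \<le> n"
  shows "pos n x = pos m x + (\<Sum>k\<in>{m..<n}. inc k x)"
  using assms by (induction n rule: dec_induct) (auto simp: pos_Suc)

text \<open>Openness in the inductive limit is tested in every X_m, also for m > n. The coordinates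
  up to \<open>max m n\<close> fix the position at that level, and \<open>lev_agree\<close> leads
  from there back to n.\<close>

lemma open_cyl: "open (cyl n f)"
  unfolding open_chacon_def
proof
  fix m
  show "openin (chacon_Xn_top m) {y \<in> chacon_Xn m. chacon_pt m y \<in> cyl n f}"
    unfolding openin_Xn_iff
  proof (intro conjI ballI)
    fix y assume "y \<in> {y \<in> chacon_Xn m. chacon_pt m y \<in> cyl n f}"
    then have y: "y \<in> chacon_Xn m" and x: "chacon_pt m y \<in> lev n" "pos n (chacon_pt m y) = f"
      by (auto simp: cyl_def)
    have "z \<in> {y \<in> chacon_Xn m. chacon_pt m y \<in> cyl n f}"
      if z: "z \<in> chacon_Xn m" and eq: "\<forall>k\<in>{m..max m n}. z k = y k" for z
    proof -
      have lm: "chacon_pt m y \<in> lev m" "chacon_pt m z \<in> lev m"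
        using y z by (auto simp: lev_def)
      have i: "inc k (chacon_pt m z) = inc k (chacon_pt m y)" if "m \<le> k" "k < max m n" for k
        using coords_eq_inc[OF that(1) lm(1)] coords_eq_inc[OF that(1) lm(2)] y z eq that by (simp add: coords_pt)
      have "pos m (chacon_pt m z) = pos m (chacon_pt m y)"
        using y z eq by (simp add: pos_def coords_pt)
      then have "pos (max m n) (chacon_pt m z) = pos (max m n) (chacon_pt m y)"
        unfolding pos_sum[of m "max m n", OF max.cobounded1] using i by (auto intro!: sum.cong)
      then have "chacon_pt m z \<in> lev n \<and> pos n (chacon_pt m z) = pos n (chacon_pt m y)"
        using lev_agree[of n "max m n" "chacon_pt m z" "chacon_pt m y"] x lev_le[OF lm(2), of "max m n"] by simp
      then show ?thesis using z x by (simp add: cyl_def)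
    qed
    then show "\<exists>N. \<forall>z\<in>chacon_Xn m. (\<forall>k\<in>{m..N}. z k = y k) \<longrightarrow> z \<in> {y \<in> chacon_Xn m. chacon_pt m y \<in> cyl n f}"
      by blast
  qed blast
qed

text \<open>The form "for all large k" allows the level to be raised until further conditions hold,
  for instance until a shift acts by addition on positions.\<close>

lemma cyl_base:
  assumes "open U" "x \<in> U"
  shows "\<exists>n. \<forall>k\<ge>n. x \<in> lev k \<and> cyl k (pos k x) \<subseteq> U"
proof -
  obtain m where m: "x \<in> lev m" using ex_lev by blast
  let ?S = "{y \<in> chacon_Xn m. chacon_pt m y \<in> U}"
  have "coords m x \<in> ?S" using assms m by (simp add: coords_in_Xn pt_coords)
  moreover have "openin (chacon_Xn_top m) ?S" using assms by (auto simp: open_chacon_def)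
  ultimately obtain N where N: "\<And>z. z \<in> chacon_Xn m \<Longrightarrow> (\<forall>k\<in>{m..N}. z k = coords m x k) \<Longrightarrow> chacon_pt m z \<in> U"
    unfolding openin_Xn_iff by blast
  have "cyl k (pos k x) \<subseteq> U" if k: "max m N \<le> k" for k
  proof
    fix z assume "z \<in> cyl k (pos k x)"
    then have z: "z \<in> lev k" "pos k z = pos k x" by (auto simp: cyl_def)
    then have *: "z \<in> lev m" "\<And>j. m \<le> j \<Longrightarrow> j \<le> k \<Longrightarrow> pos j z = pos j x"
      using lev_agree[of m k z x] m k by auto
    have "coords m z j = coords m x j" if "j \<in> {m..N}" for j
    proof -
      have "j \<in> {m..}" using that by simp
      then show ?thesis
        by (cases rule: atLeast_cases)
           (use that k m *(1) *(2)[of j] *(2)[of "j - 1"] in \<open>auto simp: coords_eq_inc inc_def pos_def[symmetric]\<close>)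
    qed
    then show "z \<in> U"
      using N[OF coords_in_Xn[OF *(1)]] by (simp add: pt_coords *(1))
  qed
  then show ?thesis using lev_le[OF m] by (intro exI[of _ "max m N"]) auto
qed

text \<open>Cylinders are nested or disjoint, since by \<open>lev_agree\<close> the position at n
  determines what happens at m.\<close>

lemma cyl_inter:
  assumes "m \<le> n" "cyl m f \<inter> cyl n g \<noteq> {}"
  shows "cyl n g \<subseteq> cyl m f"
proof -
  obtain x where x: "x \<in> lev m" "pos m x = f" "x \<in> lev n" "pos n x = g"
    using assms(2) by (auto simp: cyl_def)
  show ?thesis
  proof
    fix z assume "z \<in> cyl n g"
    then have "z \<in> lev n" "pos n z = pos n x" using x by (auto simp: cyl_def)
    from lev_agree[OF assms(1) this(1) x(1) this(2)] show "z \<in> cyl m f"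
      using assms(1) x(2) by (simp add: cyl_def)
  qed
qed

text \<open>The empty set is added to make the family stable under intersection.\<close>

definition cyls :: "chacon set set" where
  "cyls = insert {} (range (\<lambda>(n, f). cyl n f))"

lemma cyl_in_cyls: "cyl n f \<in> cyls"
  by (force simp: cyls_def)

lemma countable_cyls: "countable cyls"
  by (simp add: cyls_def)

lemma Int_stable_cyls: "Int_stable cyls"
proof (rule Int_stableI)
  fix A B assume "A \<in> cyls" "B \<in> cyls"
  then consider "A = {} \<or> B = {}" | m f n g where "A = cyl m f" "B = cyl n g"
    by (auto simp: cyls_def)
  then show "A \<inter> B \<in> cyls"
  proof cases
    case 2
    have "cyl m f \<inter> cyl n g = {} \<or> cyl m f \<inter> cyl n g = cyl n g \<or> cyl m f \<inter> cyl n g = cyl m f"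
      using cyl_inter[of m n f g] cyl_inter[of n m g f] nat_le_linear[of m n] by blast
    then show ?thesis
      unfolding 2 using cyl_in_cyls[of n g] cyl_in_cyls[of m f] by (metis cyls_def insertI1)
  qed (auto simp: cyls_def)
qed

lemma open_eq_Union_cyls:
  assumes "open U"
  shows "U = \<Union>{C \<in> cyls. C \<subseteq> U}"
proof (intro equalityI subsetI)
  fix x assume "x \<in> U"
  then obtain n where n: "x \<in> lev n" "cyl n (pos n x) \<subseteq> U" using cyl_base[OF assms] by blast
  then show "x \<in> \<Union>{C \<in> cyls. C \<subseteq> U}"
    using cyl_in_cyls[of n "pos n x"] by (auto simp: cyl_def)
qed blast

lemma sets_borel_cyls: "sets (borel :: chacon measure) = sigma_sets UNIV cyls"
proof -
  have "sigma_sets UNIV {U :: chacon set. open U} = sigma_sets UNIV cyls"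
  proof (rule sigma_sets_eqI)
    fix U :: "chacon set" assume "U \<in> {U. open U}"
    then have "U = \<Union>{C \<in> cyls. C \<subseteq> U}" using open_eq_Union_cyls by blast
    also have "\<dots> \<in> sigma_sets UNIV cyls"
      by (rule sigma_sets_UNION) (auto intro: countable_subset[OF _ countable_cyls])
    finally show "U \<in> sigma_sets UNIV cyls" .
  next
    fix C assume "C \<in> cyls"
    then show "C \<in> sigma_sets UNIV {U. open U}"
      by (auto simp: cyls_def open_cyl)
  qed
  then show ?thesis by (simp add: borel_def)
qed

lemma cyl_measurable[measurable]: "cyl n f \<in> sets borel"
  by (simp add: open_cyl)

lemma lev_eq_UN: "lev n = (\<Union>f\<in>chacon_F n. cyl n f)"
  by (auto simp: cyl_def pos_in_F)

lemma open_lev: "open (lev n)"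
  unfolding lev_eq_UN using open_cyl by blast

lemma lev_measurable[measurable]: "lev n \<in> sets borel"
  by (simp add: open_lev)

lemma pred_pos[measurable]: "Measurable.pred borel (\<lambda>x. x \<in> lev n \<and> pos n x = f)"
  using cyl_measurable[of n f] by (simp add: cyl_def pred_def)

lemma measurable_cylsI:
  assumes "\<And>C. C \<in> cyls \<Longrightarrow> f -` C \<inter> space M \<in> sets M"
  shows "f \<in> measurable M (borel :: chacon measure)"
proof -
  have "f \<in> measurable M (sigma UNIV cyls)"
    by (rule measurable_measure_of) (use assms in auto)
  moreover have "sets (sigma UNIV cyls) = sets (borel :: chacon measure)"
    by (simp add: sets_borel_cyls)
  ultimately show ?thesis using measurable_cong_sets by blast
qed

lemma T_measurable[measurable]: "chacon_T g \<in> borel_measurable borel"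
proof (rule measurable_cylsI)
  fix C assume "C \<in> cyls"
  then have oC: "open C" by (auto simp: cyls_def open_cyl)
  let ?I = "{(n, f). \<exists>x. x \<in> cyl n f \<and> f + g \<in> chacon_F n \<and> cyl n (f + g) \<subseteq> C}"
  have "chacon_T g -` C = (\<Union>(n, f)\<in>?I. cyl n f)"
  proof (intro equalityI subsetI)
    fix x assume "x \<in> chacon_T g -` C"
    then obtain n where n: "\<And>k. n \<le> k \<Longrightarrow> cyl k (pos k (chacon_T g x)) \<subseteq> C"
      using cyl_base[OF oC, of "chacon_T g x"] by auto
    obtain m where m: "x \<in> lev m" "chacon_T g x \<in> lev m" "\<And>k. m \<le> k \<Longrightarrow> pos k (chacon_T g x) = pos k x + g"
      using T_eventually[of x g] by blast
    let ?k = "max m n"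
    have l: "x \<in> lev ?k" "chacon_T g x \<in> lev ?k" using m lev_le max.cobounded1 by blast+
    have "pos ?k x + g \<in> chacon_F ?k"
      using pos_in_F[OF l(2)] m(3)[of ?k] by simp
    moreover have "cyl ?k (pos ?k x + g) \<subseteq> C" using n[of ?k] m(3)[of ?k] by simp
    ultimately have "(?k, pos ?k x) \<in> ?I" "x \<in> cyl ?k (pos ?k x)" using l(1) by (auto simp: cyl_def)
    then show "x \<in> (\<Union>(n, f)\<in>?I. cyl n f)" by blast
  next
    fix x assume "x \<in> (\<Union>(n, f)\<in>?I. cyl n f)"
    then obtain n f where "x \<in> lev n" "pos n x = f" "f + g \<in> chacon_F n" "cyl n (f + g) \<subseteq> C"
      by (auto simp: cyl_def)
    then show "x \<in> chacon_T g -` C"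
      using T_in_lev[of x n g] pos_T[of x n g n] by (auto simp: cyl_def)
  qed
  moreover have "(\<Union>(n, f)\<in>?I. cyl n f) \<in> sets borel"
    by (rule sets.countable_UN') auto
  ultimately show "chacon_T g -` C \<inter> space borel \<in> sets borel" by simp
qed

lemma compact_lev: "compact (lev n)"
proof -
  have "compact_space (chacon_Xn_top n)"
    unfolding chacon_Xn_top_def compact_space_product_topology
    by (auto simp: compact_space_discrete_topology finite_chacon_F) (simp add: chacon_C_def)
  moreover have "continuous_map (chacon_Xn_top n) euclidean (chacon_pt n)"
    unfolding continuous_map_def by (auto simp: open_chacon_def)
  ultimately have "compactin euclidean (chacon_pt n ` chacon_Xn n)"
    using image_compactin compact_space_def by blast
  then show ?thesis by (simp add: lev_def)
qed

section \<open>Finite powers of X: Borel sets and exhaustion by compact open sets\<close>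

abbreviation XJ :: "nat set \<Rightarrow> (nat \<Rightarrow> chacon) measure" where
  "XJ J \<equiv> Pi\<^sub>M J (\<lambda>_. borel)"

abbreviation levJ :: "nat set \<Rightarrow> nat \<Rightarrow> (nat \<Rightarrow> chacon) set" where
  "levJ J n \<equiv> Pi\<^sub>E J (\<lambda>_. lev n)"

text \<open>An open set of the finite power is a union of boxes of cylinders, and there are only
  countably many such boxes. Hence the Borel sets of the product topology are those of the product
  sigma-algebra, which is used from here on.\<close>

lemma sets_borel_of_pow_top:
  assumes "finite J"
  shows "sets (borel_of (pow_top J :: (nat \<Rightarrow> chacon) topology)) = sets (XJ J)"
proof -
  let ?O = "{U. openin (pow_top J :: (nat \<Rightarrow> chacon) topology) U}"
  have OP: "?O \<subseteq> Pow (Pi\<^sub>E J (\<lambda>_. UNIV))"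
    using openin_subset[of "pow_top J :: (nat \<Rightarrow> chacon) topology"] by (auto simp only: topspace_product_topology topspace_euclidean o_def)
  have "sigma_sets (Pi\<^sub>E J (\<lambda>_. UNIV)) ?O = sets (XJ J)"
  proof (rule antisym)
    have "U \<in> sets (XJ J)" if oU: "openin (pow_top J) U" for U :: "(nat \<Rightarrow> chacon) set"
    proof -
      define B where "B = Pi\<^sub>E J ` Pi\<^sub>E J (\<lambda>_. cyls)"
      have "countable B"
        using countable_PiE[OF assms, of "\<lambda>_. cyls"] countable_cyls by (simp add: B_def)
      moreover have "U = \<Union>{b \<in> B. b \<subseteq> U}"
      proof (intro equalityI subsetI)
        fix x assume x: "x \<in> U"
        from bspec[OF oU[unfolded openin_product_topology_alt] x]
        obtain V where V': "\<forall>i\<in>J. openin euclidean (V i)" "x \<in> Pi\<^sub>E J V" "Pi\<^sub>E J V \<subseteq> U"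
          by (elim exE conjE)
        then have V: "\<And>i. i \<in> J \<Longrightarrow> open (V i)" "x \<in> Pi\<^sub>E J V" "Pi\<^sub>E J V \<subseteq> U"
          by auto
        have "\<forall>i\<in>J. \<exists>C\<in>cyls. x i \<in> C \<and> C \<subseteq> V i"
        proof
          fix i assume i: "i \<in> J"
          then have "x i \<in> \<Union>{C \<in> cyls. C \<subseteq> V i}"
            using open_eq_Union_cyls[OF V(1)[OF i]] PiE_mem[OF V(2) i] by simp
          then show "\<exists>C\<in>cyls. x i \<in> C \<and> C \<subseteq> V i" by blast
        qed
        then obtain C where C: "\<And>i. i \<in> J \<Longrightarrow> C i \<in> cyls \<and> x i \<in> C i \<and> C i \<subseteq> V i"
          by metis
        have "x \<in> Pi\<^sub>E J (restrict C J)"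
          using C V(2) by (simp add: PiE_iff)
        moreover have "restrict C J \<in> Pi\<^sub>E J (\<lambda>_. cyls)"
          using C by simp
        moreover have "Pi\<^sub>E J (restrict C J) \<subseteq> Pi\<^sub>E J V"
          by (rule PiE_mono) (simp add: C)
        ultimately show "x \<in> \<Union>{b \<in> B. b \<subseteq> U}"
          using V(3) by (intro UnionI[of "Pi\<^sub>E J (restrict C J)"]) (auto simp only: B_def mem_Collect_eq)
      qed blast
      moreover have "b \<in> sets (XJ J)" if "b \<in> B" for b
      proof -
        from that obtain C where "b = Pi\<^sub>E J C" and C: "C \<in> Pi\<^sub>E J (\<lambda>_. cyls)" by (auto simp: B_def)
        moreover have "C i \<in> sets borel" if "i \<in> J" for i
          using PiE_mem[OF C that] by (auto simp: cyls_def)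
        ultimately show ?thesis
          by (simp add: sets_PiM_I_finite assms)
      qed
      ultimately show ?thesis
        using sets.countable_Union[of "{b \<in> B. b \<subseteq> U}" "XJ J"] countable_subset[of "{b \<in> B. b \<subseteq> U}" B] by auto
    qed
    then show "sigma_sets (Pi\<^sub>E J (\<lambda>_. UNIV)) ?O \<subseteq> sets (XJ J)"
      using sets.sigma_sets_subset[of ?O "XJ J"] by (auto simp: space_PiM)
  next
    have "sigma_sets (Pi\<^sub>E J (\<lambda>_. UNIV)) ?O = sets (sigma (Pi\<^sub>E J (\<lambda>_. UNIV)) ?O)"
      by (simp add: sets_measure_of[OF OP])
    moreover have "sets (XJ J) \<subseteq> sets (sigma (Pi\<^sub>E J (\<lambda>_. UNIV)) ?O)"
    proof (rule sets_PiM_in_sets)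
      fix i and A :: "chacon set" assume i: "i \<in> J" "A \<in> sets borel"
      have sp: "space (sigma (Pi\<^sub>E J (\<lambda>_. UNIV)) ?O) = Pi\<^sub>E J (\<lambda>_. UNIV)"
        by (rule space_measure_of[OF OP])
      have "(\<lambda>x. x i) \<in> borel_measurable (sigma (Pi\<^sub>E J (\<lambda>_. UNIV)) ?O)"
      proof (rule borel_measurableI)
        fix S :: "chacon set" assume "open S"
        then have "openin (pow_top J) {x \<in> topspace (pow_top J :: (nat \<Rightarrow> chacon) topology). x i \<in> S}"
          using continuous_map_product_projection[OF i(1), of "\<lambda>_. euclidean :: chacon topology"]
          by (auto simp: continuous_map_def)
        moreover have "{x \<in> topspace (pow_top J :: (nat \<Rightarrow> chacon) topology). x i \<in> S} = (\<lambda>x. x i) -` S \<inter> Pi\<^sub>E J (\<lambda>_. UNIV)"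
          by auto
        ultimately show "(\<lambda>x. x i) -` S \<inter> space (sigma (Pi\<^sub>E J (\<lambda>_. UNIV)) ?O) \<in> sets (sigma (Pi\<^sub>E J (\<lambda>_. UNIV)) ?O)"
          unfolding sp sets_measure_of[OF OP] by (simp add: sigma_sets.Basic)
      qed
      from measurable_sets[OF this i(2)] show "{x \<in> space (sigma (Pi\<^sub>E J (\<lambda>_. UNIV)) ?O). x i \<in> A} \<in> sets (sigma (Pi\<^sub>E J (\<lambda>_. UNIV)) ?O)"
        by (simp add: vimage_def Int_def conj_commute)
    qed (simp add: space_measure_of[OF OP])
    ultimately show "sets (XJ J) \<subseteq> sigma_sets (Pi\<^sub>E J (\<lambda>_. UNIV)) ?O" by simp
  qed
  then show ?thesis
    unfolding borel_of_def using sets_measure_of[OF OP] by (simp add: topspace_product_topology o_def)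
qed

lemma compactin_levJ: "compactin (pow_top J) (levJ J n)"
  by (auto simp: compactin_PiE compact_lev)

lemma openin_levJ: "finite J \<Longrightarrow> openin (pow_top J) (levJ J n)"
  by (auto simp: openin_PiE open_lev)

lemma UN_levJ:
  assumes "finite J"
  shows "(\<Union>n. levJ J n) = Pi\<^sub>E J (\<lambda>_. UNIV)"
proof (intro equalityI subsetI)
  fix x :: "nat \<Rightarrow> chacon" assume x: "x \<in> Pi\<^sub>E J (\<lambda>_. UNIV)"
  have "\<forall>i. \<exists>n. x i \<in> lev n" using ex_lev by blast
  then obtain n where n: "\<And>i. x i \<in> lev (n i)" by metis
  have "x i \<in> lev (Max (n ` J))" if "i \<in> J" for i
    using lev_le[OF n[of i]] assms that by simp
  then show "x \<in> (\<Union>n. levJ J n)" using x by (auto simp: PiE_iff intro!: exI[of _ "Max (n ` J)"])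
qed (auto simp: PiE_iff)

lemma levJ_mono: "m \<le> n \<Longrightarrow> levJ J m \<subseteq> levJ J n"
  by (intro PiE_mono lev_mono)

text \<open>The sets \<open>levJ J n\<close> are open, increasing and exhaust the power. As they are
  compact too, the Radon property reduces to finiteness on each of them.\<close>

lemma compactin_subset_levJ:
  assumes "finite J" "compactin (pow_top J) K"
  shows "\<exists>n. K \<subseteq> levJ J n"
proof -
  have "K \<subseteq> \<Union>(range (levJ J))"
    using compactin_subset_topspace[OF assms(2)] UN_levJ[OF assms(1)] by auto
  then obtain \<F> where F: "finite \<F>" "\<F> \<subseteq> range (levJ J)" "K \<subseteq> \<Union>\<F>"
    using assms(2) openin_levJ[OF assms(1)] unfolding compactin_def by (metis (no_types, lifting) imageE)
  obtain N where N: "finite N" "\<F> = levJ J ` N"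
    using finite_subset_image[OF F(1,2)] by auto
  have "levJ J n \<subseteq> levJ J (Max N)" if "n \<in> N" for n
    using levJ_mono N(1) that by simp
  then have "\<Union>\<F> \<subseteq> levJ J (Max N)"
    unfolding N(2) by (rule UN_least)
  then show ?thesis by (intro exI[of _ "Max N"] order_trans[OF F(3)])
qed

lemma levJ_measurable[measurable]: "finite J \<Longrightarrow> levJ J n \<in> sets (XJ J)"
  by (intro sets_PiM_I_finite) auto

lemma radon_on_iff:
  assumes "finite J"
  shows "radon_on (pow_top J :: (nat \<Rightarrow> chacon) topology) M \<longleftrightarrow>
    sets M = sets (XJ J) \<and> (\<forall>n. emeasure M (levJ J n) < \<infinity>)"
proof -
  have "emeasure M K < \<infinity>"
    if "sets M = sets (XJ J)" "\<And>n. emeasure M (levJ J n) < \<infinity>" and K: "compactin (pow_top J) K" for K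
  proof -
    obtain n where "K \<subseteq> levJ J n" using compactin_subset_levJ[OF assms K] by blast
    then have "emeasure M K \<le> emeasure M (levJ J n)"
      by (rule emeasure_mono) (simp add: that levJ_measurable[OF assms])
    then show ?thesis using that(2)[of n] by (rule le_less_trans)
  qed
  then show ?thesis
    using assms compactin_levJ by (auto simp: radon_on_def sets_borel_of_pow_top)
qed

section \<open>Ergodic actions of the integers\<close>

text \<open>The point is that one V serves finitely many measures at once, so an inequality between
  these measures passes from an algebra to the generated sigma-algebra.\<close>

lemma finite_measures_approx:
  fixes M :: "'i \<Rightarrow> 'a measure"
  assumes I: "finite I" and fin: "\<And>i. i \<in> I \<Longrightarrow> finite_measure (M i)"
    and sets: "\<And>i. i \<in> I \<Longrightarrow> sets (M i) = sigma_sets \<Omega> G"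
    and G: "algebra \<Omega> G" and A: "A \<in> sigma_sets \<Omega> G" and e: "e > 0"
  shows "\<exists>V\<in>G. \<forall>i\<in>I. measure (M i) (sym_diff A V) < e"
  using A e
proof (induction arbitrary: e)
  case (Basic a)
  then show ?case by (intro bexI[of _ a]) auto
next
  case Empty
  interpret algebra \<Omega> G by fact
  show ?case using Empty by (intro bexI[of _ "{}"]) auto
next
  case (Compl a)
  then obtain V where V: "V \<in> G" "\<forall>i\<in>I. measure (M i) (sym_diff a V) < e" by blast
  interpret algebra \<Omega> G by fact
  have "a \<subseteq> \<Omega>" "V \<subseteq> \<Omega>"
    using Compl(1) V(1) sigma_sets_into_sp[of G \<Omega>] space_closed by auto
  then have "sym_diff (\<Omega> - a) (\<Omega> - V) = sym_diff a V" by blast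
  with V show ?case by (intro bexI[of _ "\<Omega> - V"]) auto
next
  case (Union a)
  interpret algebra \<Omega> G by fact
  define B where "B n = (\<Union>i<n. a i)" for n
  have aS: "i \<in> I \<Longrightarrow> a n \<in> sets (M i)" for i n using Union(1) sets by simp
  have "eventually (\<lambda>n. \<forall>i\<in>I. measure (M i) ((\<Union>n. a n) - B n) < e / 2) sequentially"
    unfolding eventually_ball_finite_distrib[OF I]
  proof
    fix i assume i: "i \<in> I"
    interpret finite_measure "M i" using fin[OF i] .
    have "(\<lambda>n. measure (M i) ((\<Union>n. a n) - B n)) \<longlonglongrightarrow> measure (M i) (\<Inter>n. (\<Union>n. a n) - B n)"
      by (rule finite_Lim_measure_decseq)
         (use aS[OF i] in \<open>auto simp: B_def decseq_def intro!: sets.Diff sets.countable_UN\<close>)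
    moreover have "(\<Inter>n. (\<Union>n. a n) - B n) = {}" unfolding B_def by blast
    ultimately have "(\<lambda>n. measure (M i) ((\<Union>n. a n) - B n)) \<longlonglongrightarrow> 0" by (simp only: measure_empty)
    then show "\<forall>\<^sub>F n in sequentially. measure (M i) ((\<Union>n. a n) - B n) < e / 2"
      by (rule order_tendstoD) (use Union(3) in simp)
  qed
  then obtain n where n: "\<And>i. i \<in> I \<Longrightarrow> measure (M i) ((\<Union>n. a n) - B n) < e / 2"
    unfolding eventually_sequentially by blast
  \<comment> \<open>The first n sets share an error of e / 2; \<open>Suc n\<close> keeps the divisor
    positive when n = 0.\<close>
  define d where "d = e / (2 * real (Suc n))"
  have "d > 0" using Union(3) by (simp add: d_def)
  then have "\<forall>k. \<exists>V\<in>G. \<forall>i\<in>I. measure (M i) (sym_diff (a k) V) < d" using Union(2) by blast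
  then obtain V where V: "\<And>k. V k \<in> G" "\<And>k i. i \<in> I \<Longrightarrow> measure (M i) (sym_diff (a k) (V k)) < d" by metis
  have "measure (M i) (sym_diff (\<Union>n. a n) (\<Union>k<n. V k)) < e" if i: "i \<in> I" for i
  proof -
    interpret finite_measure "M i" using fin[OF i] .
    have VS: "V k \<in> sets (M i)" for k using V(1) sets[OF i] by (simp add: sigma_sets.Basic)
    have S: "sym_diff (a k) (V k) \<in> sets (M i)" for k using VS aS[OF i] by auto
    have "measure (M i) (sym_diff (\<Union>n. a n) (\<Union>k<n. V k))
        \<le> measure (M i) (((\<Union>n. a n) - B n) \<union> (\<Union>k<n. sym_diff (a k) (V k)))"
      using S aS[OF i] by (intro finite_measure_mono) (auto simp: B_def)
    also have "\<dots> \<le> measure (M i) ((\<Union>n. a n) - B n) + measure (M i) (\<Union>k<n. sym_diff (a k) (V k))"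
      using S aS[OF i] by (intro measure_Un_le) (auto simp: B_def)
    also have "measure (M i) (\<Union>k<n. sym_diff (a k) (V k)) \<le> (\<Sum>k<n. measure (M i) (sym_diff (a k) (V k)))"
      using S by (intro finite_measure_subadditive_finite) auto
    also have "\<dots> \<le> (\<Sum>k<n. d)" using V(2)[OF i] by (intro sum_mono) (simp add: less_imp_le)
    also have "\<dots> \<le> e / 2" using Union(3) by (simp add: d_def field_simps)
    finally show ?thesis using n[OF i] by linarith
  qed
  moreover have "(\<Union>k<n. V k) \<in> G" using V(1) by auto
  ultimately show ?case by blast
qed

text \<open>The laws are only asked for on the space: on families of points,
  \<open>pshift J J 0\<close> also restricts to J and is the identity only there. Invariance is only
  asked for the generator, as in the definition of a joining.\<close>

locale int_action =
  fixes M :: "'a measure" and \<tau> :: "int \<Rightarrow> 'a \<Rightarrow> 'a"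
  assumes meas[measurable]: "\<tau> g \<in> measurable M M"
    and add: "x \<in> space M \<Longrightarrow> \<tau> g (\<tau> h x) = \<tau> (g + h) x"
    and zero: "x \<in> space M \<Longrightarrow> \<tau> 0 x = x"
    and inv1: "A \<in> sets M \<Longrightarrow> emeasure M (\<tau> 1 -` A \<inter> space M) = emeasure M A"
begin

lemma tau_space: "x \<in> space M \<Longrightarrow> \<tau> g x \<in> space M"
  using measurable_space[OF meas] .

lemma vimage_tau_add:
  "\<tau> (g + h) -` A \<inter> space M = \<tau> h -` (\<tau> g -` A \<inter> space M) \<inter> space M"
  using tau_space add by auto

lemma inv:
  assumes "A \<in> sets M"
  shows "emeasure M (\<tau> g -` A \<inter> space M) = emeasure M A"
proof -
  have pos: "emeasure M (\<tau> (int n) -` A \<inter> space M) = emeasure M A" if "A \<in> sets M" for n A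
    using that
  proof (induction n arbitrary: A)
    case 0
    then have "\<tau> 0 -` A \<inter> space M = A" using zero sets.sets_into_space by fastforce
    then show ?case by simp
  next
    case (Suc n)
    have *: "\<tau> (int (Suc n)) -` A \<inter> space M = \<tau> (int n) -` (\<tau> 1 -` A \<inter> space M) \<inter> space M"
      using vimage_tau_add[of 1 "int n" A] by (simp add: add.commute)
    show ?case
      unfolding * Suc.IH[OF measurable_sets[OF meas Suc.prems]] by (rule inv1[OF Suc.prems])
  qed
  show ?thesis
  proof (cases "g \<ge> 0")
    case True
    then show ?thesis using pos[OF assms, of "nat g"] by simp
  next
    case False
    \<comment> \<open>For negative g, invariance under the positive power - g is applied to the
      preimage of A.\<close>
    have "A = \<tau> (int (nat (- g))) -` (\<tau> g -` A \<inter> space M) \<inter> space M"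
    proof (rule set_eqI)
      fix x show "x \<in> A \<longleftrightarrow> x \<in> \<tau> (int (nat (- g))) -` (\<tau> g -` A \<inter> space M) \<inter> space M"
        using False zero[of x] add[of x g "- g"] tau_space[of x "- g"] sets.sets_into_space[OF assms] by auto
    qed
    then show ?thesis
      using pos[of "\<tau> g -` A \<inter> space M" "nat (- g)"] measurable_sets[OF meas assms] by simp
  qed
qed

lemma distr_tau: "distr M M (\<tau> g) = M"
  by (rule measure_eqI) (auto simp: emeasure_distr inv)

lemma saturate:
  assumes A: "A \<in> sets M"
  defines "S \<equiv> (\<Union>g. \<tau> g -` A \<inter> space M)"
  shows "S \<in> sets M" "A \<subseteq> S" "\<tau> h -` S \<inter> space M = S" "A \<in> null_sets M \<Longrightarrow> S \<in> null_sets M"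
proof -
  have m: "\<tau> g -` A \<inter> space M \<in> sets M" for g using measurable_sets[OF meas A] .
  show "S \<in> sets M" unfolding S_def using m by (intro sets.countable_UN') auto
  show "A \<subseteq> S" unfolding S_def using zero sets.sets_into_space[OF A] by fastforce
  show "\<tau> h -` S \<inter> space M = S"
  proof (intro equalityI subsetI)
    fix x assume "x \<in> \<tau> h -` S \<inter> space M"
    then show "x \<in> S" unfolding S_def using add by auto
  next
    fix x assume "x \<in> S"
    then obtain g where "x \<in> space M" "\<tau> g x \<in> A" unfolding S_def by auto
    then show "x \<in> \<tau> h -` S \<inter> space M"
      unfolding S_def using add[of x "g - h" h] tau_space[of x h] by (auto intro!: exI[of _ "g - h"])
  qed
  assume n: "A \<in> null_sets M"
  then have "\<tau> g -` A \<inter> space M \<in> null_sets M" for g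
    using inv[OF A, of g] m[of g] by (simp add: null_sets_def)
  then show "S \<in> null_sets M" unfolding S_def by (intro null_sets_UN') auto
qed

end

locale ergodic_int_action = int_action +
  assumes erg: "ergodic_under (\<tau> 1) M"
begin

lemma ergodicD: "A \<in> sets M \<Longrightarrow> \<tau> 1 -` A \<inter> space M = A \<Longrightarrow> A \<in> null_sets M \<or> space M - A \<in> null_sets M"
  using erg by (simp add: ergodic_under_def)

lemma AE_invariant:
  assumes "Measurable.pred M P" "\<And>x. x \<in> space M \<Longrightarrow> P (\<tau> 1 x) \<longleftrightarrow> P x"
  shows "(AE x in M. P x) \<or> (AE x in M. \<not> P x)"
proof -
  let ?A = "{x \<in> space M. P x}"
  have A: "?A \<in> sets M" using assms(1) by simp
  moreover have "\<tau> 1 -` ?A \<inter> space M = ?A" using assms(2) tau_space by auto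
  ultimately have "?A \<in> null_sets M \<or> space M - ?A \<in> null_sets M" by (rule ergodicD)
  then show ?thesis
  proof
    assume "?A \<in> null_sets M"
    then have "AE x in M. \<not> P x" by (rule AE_I') auto
    then show ?thesis ..
  next
    assume "space M - ?A \<in> null_sets M"
    then have "AE x in M. P x" by (rule AE_I') auto
    then show ?thesis ..
  qed
qed

lemma AE_const:
  fixes F :: "'a \<Rightarrow> ennreal"
  assumes [measurable]: "F \<in> borel_measurable M" and i: "\<And>x. x \<in> space M \<Longrightarrow> F (\<tau> 1 x) = F x"
  obtains c where "AE x in M. F x = c"
proof -
  define S where "S = {q::rat. AE x in M. F x \<le> ennreal (real_of_rat q)}"
  \<comment> \<open>Each threshold set is invariant, so every rational is almost surely an upper
    bound or almost surely exceeded. If S is empty, the infimum is \<infinity>.\<close>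
  define c where "c = (INF q\<in>S. ennreal (real_of_rat q))"
  have "AE x in M. \<forall>q\<in>S. F x \<le> ennreal (real_of_rat q)"
    unfolding AE_ball_countable[OF countableI_type] by (simp add: S_def)
  then have "AE x in M. F x \<le> c"
    by eventually_elim (auto simp: c_def intro: INF_greatest)
  moreover have "AE x in M. \<forall>q. q \<notin> S \<longrightarrow> ennreal (real_of_rat q) < F x"
    unfolding AE_all_countable
  proof
    fix q
    have "(AE x in M. F x \<le> ennreal (real_of_rat q)) \<or> (AE x in M. \<not> F x \<le> ennreal (real_of_rat q))"
      by (rule AE_invariant) (auto simp: i)
    then show "AE x in M. q \<notin> S \<longrightarrow> ennreal (real_of_rat q) < F x"
      by (auto simp: S_def not_le)
  qed
  then have "AE x in M. c \<le> F x"
  proof eventually_elim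
    case (elim x)
    show ?case
    proof (rule ccontr)
      assume "\<not> c \<le> F x"
      then obtain q where q: "F x < ennreal (real_of_rat q)" "ennreal (real_of_rat q) < c"
        using ennreal_rat_dense[of "F x" c] unfolding not_le by blast
      then have "q \<in> S" using elim by (meson less_asym)
      then show False using q(2) unfolding c_def by (meson INF_lower leD)
    qed
  qed
  ultimately have "AE x in M. F x = c" by eventually_elim simp
  then show ?thesis using that by blast
qed

text \<open>The density of one invariant measure with respect to another is an invariant function.\<close>

lemma invariant_abs_cont_proportional:
  assumes "sigma_finite_measure M" "sigma_finite_measure N" "sets N = sets M" "absolutely_continuous M N"
    and N: "\<And>A g. A \<in> sets M \<Longrightarrow> emeasure N (\<tau> g -` A \<inter> space M) = emeasure N A"
  obtains c where "c < \<infinity>" "\<And>A. A \<in> sets M \<Longrightarrow> emeasure N A = c * emeasure M A"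
proof -
  interpret sigma_finite_measure M by fact
  define f where "f = RN_deriv M N"
  have [measurable]: "f \<in> borel_measurable M" by (simp add: f_def)
  have sp: "space N = space M" using assms(3) by (rule sets_eq_imp_space_eq)
  have dN: "distr N M (\<tau> g) = N" for g
    by (rule measure_eqI) (use assms(3) sp N in \<open>auto simp: emeasure_distr cong: measurable_cong_sets\<close>)
  have "AE x in M. f (\<tau> g x) = f x" for g
    using RN_deriv_distr[of "\<tau> g" M "\<tau> (- g)" N] assms(3,4) add zero
    by (simp add: distr_tau dN f_def)
  then have ae: "AE x in M. \<forall>g. f (\<tau> g x) = f x" unfolding AE_all_countable by blast
  \<comment> \<open>The density is only almost everywhere invariant, for each g. The supremum over
    the orbit is invariant at every point, as \<open>AE_const\<close> demands, and equals the
    density almost everywhere.\<close>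
  define F where "F x = (SUP g. f (\<tau> g x))" for x
  have [measurable]: "F \<in> borel_measurable M" unfolding F_def by measurable
  have "F (\<tau> 1 x) = F x" if "x \<in> space M" for x
  proof -
    have "F (\<tau> 1 x) = (SUP g. f (\<tau> (g + 1) x))" unfolding F_def using add[OF that] by simp
    also have "range (\<lambda>g. f (\<tau> (g + 1) x)) = range (\<lambda>g. f (\<tau> g x))"
    proof (intro equalityI subsetI)
      fix y assume "y \<in> range (\<lambda>g. f (\<tau> g x))"
      then obtain g where "y = f (\<tau> ((g - 1) + 1) x)" by auto
      then show "y \<in> range (\<lambda>g. f (\<tau> (g + 1) x))" by blast
    qed auto
    finally show ?thesis by (simp add: F_def)
  qed
  then obtain c where c: "AE x in M. F x = c" using AE_const[of F] by auto
  have fc: "AE x in M. f x = c"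
    using ae c by eventually_elim (simp add: F_def)
  have em: "emeasure N A = c * emeasure M A" if "A \<in> sets M" for A
  proof -
    have "emeasure N A = emeasure (density M f) A"
      unfolding f_def using density_RN_deriv[OF assms(4,3)] by simp
    also have "\<dots> = (\<integral>\<^sup>+ x. f x * indicator A x \<partial>M)" using that by (simp add: emeasure_density)
    also have "\<dots> = (\<integral>\<^sup>+ x. c * indicator A x \<partial>M)" using fc by (intro nn_integral_cong_AE) auto
    finally show ?thesis using that by (simp add: nn_integral_cmult_indicator)
  qed
  show ?thesis
  proof (cases "c = \<infinity>")
    case True
    \<comment> \<open>The density of a sigma-finite measure is finite almost everywhere, so here M
      and N both vanish and 0 serves as the constant.\<close>
    have "AE x in M. f x \<noteq> \<infinity>" unfolding f_def using RN_deriv_finite[OF assms(2,4,3)] .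
    then have "AE x in M. False" using fc by eventually_elim (simp add: True)
    then have z: "emeasure M A = 0" if "A \<in> sets M" for A
      using that emeasure_space[of M A] by (simp add: AE_iff_measurable[OF sets.top])
    show ?thesis
      by (rule that[of 0]) (use em z in auto)
  next
    case False
    then show ?thesis using that[of c] em by (simp add: less_top)
  qed
qed

end

section \<open>The invariant measure\<close>

lemma cyl_empty: "f \<notin> chacon_F n \<Longrightarrow> cyl n f = {}"
  using pos_in_F by (auto simp: cyl_def)

lemma cyl_nonempty:
  assumes "f \<in> chacon_F n"
  shows "\<exists>x. x \<in> cyl n f"
proof -
  obtain x where "x \<in> lev n" "\<And>k. n \<le> k \<Longrightarrow> pos k x = f"
    by (rule ex_point[of "\<lambda>_. f" n]) (use assms in \<open>auto simp: mem_chacon_C\<close>)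
  then show ?thesis by (auto simp: cyl_def)
qed

lemma cyl_split:
  assumes "f \<in> chacon_F n"
  shows "cyl n f = (\<Union>c\<in>chacon_C (Suc n). cyl (Suc n) (f + c))"
proof (intro equalityI subsetI)
  fix x assume "x \<in> cyl n f"
  then show "x \<in> (\<Union>c\<in>chacon_C (Suc n). cyl (Suc n) (f + c))"
    using inc_in_C[of x n] by (auto simp: cyl_def pos_Suc lev_Suc)
next
  fix x assume "x \<in> (\<Union>c\<in>chacon_C (Suc n). cyl (Suc n) (f + c))"
  then obtain c where "c \<in> chacon_C (Suc n)" "x \<in> lev (Suc n)" "pos (Suc n) x = f + c"
    by (auto simp: cyl_def)
  from lev_Suc_decompose[OF this(2,3) assms this(1)] show "x \<in> cyl n f" by (simp add: cyl_def)
qed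

lemma chacon_F_0: "chacon_F 0 = {0}"
  by (auto simp: mem_chacon_F)

lemma lev_0: "lev 0 = cyl 0 0"
  by (simp add: lev_eq_UN chacon_F_0)

lemma card_chacon_C: "card (chacon_C (Suc n)) = 3" "finite (chacon_C (Suc n))"
  using chacon_h_ge_1[of n] by (auto simp: chacon_C_def card_insert_if)

lemma emeasure_cyl_split:
  assumes "sets M = sets borel" "f \<in> chacon_F n"
  shows "emeasure M (cyl n f) = (\<Sum>c\<in>chacon_C (Suc n). emeasure M (cyl (Suc n) (f + c)))"
  unfolding cyl_split[OF assms(2)]
  by (intro sum_emeasure[symmetric]) (auto simp: assms(1) card_chacon_C disjoint_family_on_def cyl_def)

lemma cyl_measure_eqI:
  assumes "sets M = sets borel" "sets N = sets borel"
    and "\<And>n f. f \<in> chacon_F n \<Longrightarrow> emeasure M (cyl n f) = emeasure N (cyl n f)"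
    and "\<And>n f. f \<in> chacon_F n \<Longrightarrow> emeasure M (cyl n f) \<noteq> \<infinity>"
  shows "M = N"
proof (rule measure_eqI_generator_eq_countable[where A = cyls])
  show "Int_stable cyls" by (rule Int_stable_cyls)
  have *: "emeasure M (cyl n f) = emeasure N (cyl n f)" "emeasure M (cyl n f) \<noteq> \<infinity>" for n f
    using assms(3,4)[of f n] by (cases "f \<in> chacon_F n"; simp add: cyl_empty)+
  show "emeasure M X = emeasure N X" if "X \<in> cyls" for X
    using that * by (auto simp: cyls_def)
  show "\<And>a. a \<in> cyls \<Longrightarrow> emeasure M a \<noteq> \<infinity>"
    using * by (auto simp: cyls_def)
  show "\<Union>cyls = UNIV"
    using open_eq_Union_cyls[of UNIV] by simp
qed (simp_all add: assms(1,2) sets_borel_cyls countable_cyls)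

lemma vimage_T_cyl:
  assumes "f \<in> chacon_F n" "f + g \<in> chacon_F n"
  shows "chacon_T g -` cyl n (f + g) = cyl n f"
proof (intro equalityI subsetI)
  fix x assume "x \<in> chacon_T g -` cyl n (f + g)"
  then have *: "chacon_T g x \<in> lev n" "pos n (chacon_T g x) = f + g" by (auto simp: cyl_def)
  then show "x \<in> cyl n f"
    using T_in_lev[OF *(1), of "- g"] pos_T[OF *(1), of "- g" n] assms by (simp add: cyl_def)
next
  fix x assume "x \<in> cyl n f"
  then show "x \<in> chacon_T g -` cyl n (f + g)"
    using T_in_lev[of x n g] pos_T[of x n g n] assms by (auto simp: cyl_def)
qed

text \<open>The shift permutes the cylinders of one level, which therefore have equal mass, and each
  cylinder splits into three of the next level.\<close>

lemma invariant_cyl: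
  assumes "sets M = sets borel" and inv: "\<And>g A. A \<in> sets borel \<Longrightarrow> emeasure M (chacon_T g -` A) = emeasure M A"
    and f: "f \<in> chacon_F n"
  shows "emeasure M (cyl n f) = emeasure M (lev 0) * ennreal (1 / 3 ^ n)"
  using f
proof (induction n arbitrary: f)
  case 0
  then show ?case by (simp add: chacon_F_0 lev_0)
next
  case (Suc n)
  have eq: "emeasure M (cyl (Suc n) f') = emeasure M (cyl (Suc n) f)" if "f' \<in> chacon_F (Suc n)" for f'
    using inv[of "cyl (Suc n) f" "f - f'"] vimage_T_cyl[of f' "Suc n" "f - f'"] that Suc.prems by simp
  have z: "0 \<in> chacon_F n" using chacon_h_ge_1[of n] by (simp add: mem_chacon_F)
  have "emeasure M (lev 0) * ennreal (1 / 3 ^ n) = emeasure M (cyl n 0)" using Suc.IH[OF z] by simp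
  also have "\<dots> = (\<Sum>c\<in>chacon_C (Suc n). emeasure M (cyl (Suc n) (0 + c)))"
    by (rule emeasure_cyl_split[OF assms(1) z])
  also have "\<dots> = (\<Sum>c\<in>chacon_C (Suc n). emeasure M (cyl (Suc n) f))"
    by (intro sum.cong refl eq chacon_F_add_C z)
  also have "\<dots> = ennreal 3 * emeasure M (cyl (Suc n) f)" by (simp add: card_chacon_C)
  finally have "ennreal (1 / 3) * (ennreal 3 * emeasure M (cyl (Suc n) f)) =
      ennreal (1 / 3) * (emeasure M (lev 0) * ennreal (1 / 3 ^ n))" by simp
  then have "(ennreal (1 / 3) * ennreal 3) * emeasure M (cyl (Suc n) f) =
      emeasure M (lev 0) * (ennreal (1 / 3) * ennreal (1 / 3 ^ n))" by (simp only: ac_simps)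
  moreover have "ennreal (1 / 3) * ennreal 3 = 1" "ennreal (1 / 3) * ennreal (1 / 3 ^ n) = ennreal (1 / 3 ^ Suc n)"
    by (subst ennreal_mult[symmetric]; simp)+
  ultimately show ?case by (simp only: mult_1)
qed

text \<open>The measure is assembled from the disjoint cylinders that are not contained in an earlier
  \<open>X\<^sub>n\<close>; each of them carries a multiple of the product of the uniform measures on the digits.\<close>

definition first_cyls :: "(nat \<times> int) set" where
  "first_cyls = {(m, f). f \<in> chacon_F m \<and> (\<forall>n<m. cyl m f \<inter> lev n = {})}"

text \<open>Coordinate k stands for the digit c_(k+1). All digits are drawn, although
  \<open>point_of m f\<close> uses only those with k \<ge> m, so that one probability space serves
  all starting levels.\<close>

definition digit_measure :: "(nat \<Rightarrow> int) measure" where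
  "digit_measure = Pi\<^sub>M UNIV (\<lambda>k. uniform_count_measure (chacon_C (Suc k)))"

definition point_of :: "nat \<Rightarrow> int \<Rightarrow> (nat \<Rightarrow> int) \<Rightarrow> chacon" where
  "point_of m f \<omega> = chacon_pt m (\<lambda>k\<in>{m..}. if k = m then f else \<omega> (k - 1))"

lemma space_digit_measure: "\<omega> \<in> space digit_measure \<longleftrightarrow> (\<forall>k. \<omega> k \<in> chacon_C (Suc k))"
  by (auto simp: digit_measure_def space_PiM space_uniform_count_measure)

lemma point_of:
  assumes "f \<in> chacon_F m" "\<omega> \<in> space digit_measure"
  shows "point_of m f \<omega> \<in> lev m" "pos m (point_of m f \<omega>) = f" "m \<le> k \<Longrightarrow> inc k (point_of m f \<omega>) = \<omega> k"
proof -
  let ?y = "\<lambda>k\<in>{m..}. if k = m then f else \<omega> (k - 1)"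
  have y: "?y \<in> chacon_Xn m"
    using assms by (auto simp: mem_chacon_Xn space_digit_measure)
  show l: "point_of m f \<omega> \<in> lev m" using y by (auto simp: point_of_def lev_def)
  show "pos m (point_of m f \<omega>) = f" using coords_pt[OF y] by (simp add: point_of_def pos_def)
  show "inc k (point_of m f \<omega>) = \<omega> k" if "m \<le> k"
    using coords_eq_inc[OF that l] coords_pt[OF y] that by (simp add: point_of_def)
qed

lemma emeasure_digits:
  assumes "\<And>j. j \<in> {m..<n} \<Longrightarrow> e j \<in> chacon_C (Suc j)"
  shows "emeasure digit_measure {\<omega> \<in> space digit_measure. \<forall>j\<in>{m..<n}. \<omega> j = e j} = ennreal (1 / 3 ^ (n - m))"
proof -
  interpret product_prob_space "\<lambda>k. uniform_count_measure (chacon_C (Suc k))" UNIV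
    by (intro product_prob_spaceI prob_space_uniform_count_measure) (auto simp: chacon_C_def)
  have "emeasure digit_measure {\<omega> \<in> space digit_measure. \<forall>j\<in>{m..<n}. \<omega> j \<in> {e j}} =
      (\<Prod>j\<in>{m..<n}. emeasure (uniform_count_measure (chacon_C (Suc j))) {e j})"
    unfolding digit_measure_def
    by (rule emeasure_PiM_Collect) (use assms in \<open>auto simp: sets_uniform_count_measure\<close>)
  also have "\<dots> = (\<Prod>j\<in>{m..<n}. ennreal (1 / 3))"
    using assms by (intro prod.cong refl) (simp add: emeasure_uniform_count_measure card_chacon_C)
  also have "\<dots> = ennreal (1 / 3 ^ (n - m))"
    by (simp add: ennreal_power power_one_over)
  finally show ?thesis by simp
qed

definition hits :: "nat \<Rightarrow> int \<Rightarrow> chacon set \<Rightarrow> (nat \<Rightarrow> int) set" where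
  "hits m f A = {\<omega> \<in> space digit_measure. point_of m f \<omega> \<in> A}"

text \<open>By \<open>lev_agree\<close>, reaching the cylinder from level m means having the right
  digits between m and n.\<close>

lemma hits_cyl_eq:
  assumes "m \<le> n" "f0 \<in> chacon_F m" "\<omega>0 \<in> hits m f0 (cyl n f)"
  shows "hits m f0 (cyl n f) = {\<omega> \<in> space digit_measure. \<forall>j\<in>{m..<n}. \<omega> j = \<omega>0 j}"
proof (intro equalityI subsetI)
  have 0: "\<omega>0 \<in> space digit_measure" "point_of m f0 \<omega>0 \<in> cyl n f" using assms(3) by (auto simp: hits_def)
  note p0 = point_of[OF assms(2) 0(1)]
  {
    fix \<omega> assume "\<omega> \<in> hits m f0 (cyl n f)"
    then have w: "\<omega> \<in> space digit_measure" "point_of m f0 \<omega> \<in> cyl n f" by (auto simp: hits_def)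
    note p = point_of[OF assms(2) w(1)]
    have "pos n (point_of m f0 \<omega>) = pos n (point_of m f0 \<omega>0)" using 0 w by (simp add: cyl_def)
    then have a: "\<And>k. m \<le> k \<Longrightarrow> k \<le> n \<Longrightarrow> pos k (point_of m f0 \<omega>) = pos k (point_of m f0 \<omega>0)"
      using lev_agree[OF assms(1) lev_le[OF p(1) assms(1)] p0(1)] by blast
    have "\<omega> j = \<omega>0 j" if "j \<in> {m..<n}" for j
      using a[of j] a[of "Suc j"] that p(3)[of j] p0(3)[of j] by (simp add: inc_def)
    then show "\<omega> \<in> {\<omega> \<in> space digit_measure. \<forall>j\<in>{m..<n}. \<omega> j = \<omega>0 j}" using w by simp
  }
  fix \<omega> assume "\<omega> \<in> {\<omega> \<in> space digit_measure. \<forall>j\<in>{m..<n}. \<omega> j = \<omega>0 j}"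
  then have w: "\<omega> \<in> space digit_measure" "\<And>j. j \<in> {m..<n} \<Longrightarrow> \<omega> j = \<omega>0 j" by auto
  note p = point_of[OF assms(2) w(1)]
  have "pos n (point_of m f0 \<omega>) = pos n (point_of m f0 \<omega>0)"
    unfolding pos_sum[OF assms(1)] using p p0 w(2) by (auto intro!: sum.cong)
  then have "point_of m f0 \<omega> \<in> cyl n f" using 0(2) lev_le[OF p(1) assms(1)] by (simp add: cyl_def)
  then show "\<omega> \<in> hits m f0 (cyl n f)" using w by (simp add: hits_def)
qed

lemma point_of_measurable: 
  assumes "f \<in> chacon_F m"
  shows "point_of m f \<in> borel_measurable digit_measure"
proof -
  have c: "hits m f (cyl n g) \<in> sets digit_measure" if "m \<le> n" for n g
  proof (cases "hits m f (cyl n g) = {}")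
    case False
    then obtain \<omega>0 where w: "\<omega>0 \<in> hits m f (cyl n g)" by blast
    have "(\<lambda>\<omega>. \<omega> j) \<in> measurable digit_measure (count_space UNIV)" for j
    proof -
      have "(\<lambda>\<omega>. \<omega> j) \<in> measurable digit_measure (uniform_count_measure (chacon_C (Suc j)))"
        unfolding digit_measure_def by measurable
      also have "measurable digit_measure (uniform_count_measure (chacon_C (Suc j))) =
          measurable digit_measure (count_space (chacon_C (Suc j)))"
        by (rule measurable_cong_sets) (auto simp: sets_uniform_count_measure)
      finally show ?thesis
        using measurable_compose[of "\<lambda>\<omega>. \<omega> j" digit_measure "count_space (chacon_C (Suc j))" "\<lambda>x. x" "count_space UNIV"]
        by simp
    qed
    note [measurable] = this
    show ?thesis unfolding hits_cyl_eq[OF that assms w] by measurable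
  qed simp
  have "hits m f C \<in> sets digit_measure" if "C \<in> cyls" for C
  proof -
    have oC: "open C" using that by (auto simp: cyls_def open_cyl)
    let ?I = "{(n, g). m \<le> n \<and> cyl n g \<subseteq> C}"
    have "hits m f C = (\<Union>(n, g)\<in>?I. hits m f (cyl n g))"
    proof (intro equalityI subsetI)
      fix \<omega> assume w: "\<omega> \<in> hits m f C"
      then obtain n where n: "\<And>k. k \<ge> n \<Longrightarrow> point_of m f \<omega> \<in> lev k \<and> cyl k (pos k (point_of m f \<omega>)) \<subseteq> C"
        using cyl_base[OF oC, of "point_of m f \<omega>"] by (auto simp: hits_def)
      then have "(max m n, pos (max m n) (point_of m f \<omega>)) \<in> ?I" by simp
      moreover have "\<omega> \<in> hits m f (cyl (max m n) (pos (max m n) (point_of m f \<omega>)))"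
        using w n[of "max m n"] by (simp add: hits_def cyl_def)
      ultimately show "\<omega> \<in> (\<Union>(n, g)\<in>?I. hits m f (cyl n g))" by blast
    qed (auto simp: hits_def)
    also have "\<dots> \<in> sets digit_measure" by (rule sets.countable_UN') (auto intro: c)
    finally show ?thesis .
  qed
  then show ?thesis
    by (intro measurable_cylsI) (simp add: hits_def vimage_def Int_def conj_commute)
qed

lemma emeasure_hits_Suc:
  assumes "m \<le> n" "f0 \<in> chacon_F m" "f \<in> chacon_F n" "c \<in> chacon_C (Suc n)"
  shows "emeasure digit_measure (hits m f0 (cyl (Suc n) (f + c))) =
    ennreal (1 / 3) * emeasure digit_measure (hits m f0 (cyl n f))"
proof (cases "hits m f0 (cyl n f) = {}")
  case True
  then have "hits m f0 (cyl (Suc n) (f + c)) = {}"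
    using assms(4) unfolding cyl_split[OF assms(3)] by (auto simp: hits_def)
  with True show ?thesis by simp
next
  case False
  then obtain w where w: "w \<in> hits m f0 (cyl n f)" by blast
  then have ws: "w \<in> space digit_measure" "point_of m f0 w \<in> cyl n f" by (auto simp: hits_def)
  let ?w = "w(n := c)"
  have s: "?w \<in> space digit_measure" using ws assms(4) by (simp add: space_digit_measure)
  have "?w \<in> hits m f0 (cyl n f)"
    unfolding hits_cyl_eq[OF assms(1,2) w] using s by simp
  then have "?w \<in> hits m f0 (cyl (Suc n) (f + c))"
    using point_of(1,3)[OF assms(2) s] assms(1) by (auto simp: hits_def cyl_def pos_Suc lev_Suc)
  note e1 = hits_cyl_eq[OF le_SucI[OF assms(1)] assms(2) this]
  have e2: "hits m f0 (cyl n f) = {\<omega> \<in> space digit_measure. \<forall>j\<in>{m..<n}. \<omega> j = w j}"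
    by (rule hits_cyl_eq[OF assms(1,2) w])
  have "emeasure digit_measure (hits m f0 (cyl (Suc n) (f + c))) = ennreal (1 / 3 ^ (Suc n - m))"
    unfolding e1 by (rule emeasure_digits) (use s in \<open>simp add: space_digit_measure\<close>)
  moreover have "emeasure digit_measure (hits m f0 (cyl n f)) = ennreal (1 / 3 ^ (n - m))"
    unfolding e2 by (rule emeasure_digits) (use ws in \<open>simp add: space_digit_measure\<close>)
  ultimately show ?thesis
    using assms(1) by (simp add: Suc_diff_le flip: ennreal_mult)
qed

text \<open>Either the cylinder is itself one of the chosen ones, and then only its own piece meets
  it, or it lies in X_(n-1) and carries a third of the mass of the cylinder of level n - 1 around
  it.\<close>

lemma ex_chacon_measure:
  "\<exists>M. sets M = sets borel \<and> (\<forall>n. \<forall>f\<in>chacon_F n. emeasure M (cyl n f) = ennreal (1 / 3 ^ n))"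
proof -
  \<comment> \<open>Integration against the counting measure is used as a countable sum with values
    in \<open>ennreal\<close>; the piece at (m, f) has total mass 1 / 3 ^ m.\<close>
  define \<phi> where "\<phi> A = (\<integral>\<^sup>+ k. ennreal (1 / 3 ^ fst k) * emeasure digit_measure (hits (fst k) (snd k) A) \<partial>count_space first_cyls)" for A
  have hits_sets: "hits m f A \<in> sets digit_measure" if "(m, f) \<in> first_cyls" "A \<in> sets borel" for m f A
    using measurable_sets[OF point_of_measurable that(2), of f m] that(1)
    by (simp add: first_cyls_def hits_def vimage_def Int_def conj_commute)
  define M where "M = measure_of UNIV (sets borel) \<phi>"
  have sM: "sets M = sets borel" unfolding M_def
    using sets.sigma_sets_eq[of "borel :: chacon measure"] by simp
  have em: "emeasure M A = \<phi> A" if "A \<in> sets borel" for A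
  proof (rule emeasure_measure_of[OF M_def])
    show "sets borel \<subseteq> Pow (UNIV :: chacon set)" by simp
    show "A \<in> sets M" using that sM by simp
    show "positive (sets M) \<phi>" by (simp add: positive_def \<phi>_def hits_def)
    show "countably_additive (sets M) \<phi>"
    proof (rule countably_additiveI)
      fix B :: "nat \<Rightarrow> chacon set" assume B: "range B \<subseteq> sets M" "disjoint_family B"
      have "(\<Sum>i. \<phi> (B i)) = (\<integral>\<^sup>+ k. (\<Sum>i. ennreal (1 / 3 ^ fst k) * emeasure digit_measure (hits (fst k) (snd k) (B i))) \<partial>count_space first_cyls)"
        unfolding \<phi>_def by (rule nn_integral_suminf[symmetric]) simp
      also have "\<dots> = \<phi> (\<Union>i. B i)"
        unfolding \<phi>_def
      proof (intro nn_integral_cong)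
        fix k assume "k \<in> space (count_space first_cyls)"
        then have k: "(fst k, snd k) \<in> first_cyls" by simp
        have "(\<Sum>i. emeasure digit_measure (hits (fst k) (snd k) (B i))) = emeasure digit_measure (\<Union>i. hits (fst k) (snd k) (B i))"
          using B hits_sets[OF k] sM by (intro suminf_emeasure) (auto simp: disjoint_family_on_def hits_def)
        also have "(\<Union>i. hits (fst k) (snd k) (B i)) = hits (fst k) (snd k) (\<Union>i. B i)" by (auto simp: hits_def)
        finally show "(\<Sum>i. ennreal (1 / 3 ^ fst k) * emeasure digit_measure (hits (fst k) (snd k) (B i))) =
            ennreal (1 / 3 ^ fst k) * emeasure digit_measure (hits (fst k) (snd k) (\<Union>i. B i))"
          by (simp add: ennreal_suminf_cmult)
      qed
      finally show "(\<Sum>i. \<phi> (B i)) = \<phi> (\<Union>i. B i)" .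
    qed
  qed
  have "\<phi> (cyl n f) = ennreal (1 / 3 ^ n)" if "f \<in> chacon_F n" for n f
    using that
  proof (induction n arbitrary: f rule: less_induct)
    case (less n)
    show ?case
    proof (cases "(n, f) \<in> first_cyls")
      case True
      have "\<phi> (cyl n f) = (\<integral>\<^sup>+ k. ennreal (1 / 3 ^ n) * indicator {(n, f)} k \<partial>count_space first_cyls)"
        unfolding \<phi>_def
      proof (intro nn_integral_cong)
        fix k assume "k \<in> space (count_space first_cyls)"
        then obtain m f0 where k: "k = (m, f0)" "(m, f0) \<in> first_cyls" by (cases k) auto
        then have f0: "f0 \<in> chacon_F m" by (simp add: first_cyls_def)
        have "hits m f0 (cyl n f) = (if k = (n, f) then space digit_measure else {})"
        proof (cases "k = (n, f)")
          case True
          then show ?thesis using k point_of(1,2)[OF f0] by (auto simp: hits_def cyl_def)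
        next
          case False
          have "\<omega> \<notin> hits m f0 (cyl n f)" for \<omega>
          proof
            assume "\<omega> \<in> hits m f0 (cyl n f)"
            then have w: "\<omega> \<in> space digit_measure" "point_of m f0 \<omega> \<in> cyl n f" by (auto simp: hits_def)
            note p = point_of(1,2)[OF f0 w(1)]
            consider "m < n" | "m = n" | "n < m" by linarith
            then show False
            proof cases
              case 1 then show False using \<open>(n, f) \<in> first_cyls\<close> p w unfolding first_cyls_def by blast
            next
              case 2 then show False using False k p w by (simp add: cyl_def)
            next
              case 3
              have "point_of m f0 \<omega> \<in> cyl m f0 \<inter> lev n" using p w by (simp add: cyl_def)
              then show False using 3 k(2) unfolding first_cyls_def by blast
            qed
          qed
          then show ?thesis using False by auto
        qed
        moreover have "emeasure digit_measure (space digit_measure) = 1"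
          using emeasure_digits[of 0 0] by simp
        ultimately show "ennreal (1 / 3 ^ fst k) * emeasure digit_measure (hits (fst k) (snd k) (cyl n f)) =
            ennreal (1 / 3 ^ n) * indicator {(n, f)} k"
          using k by auto
      qed
      also have "\<dots> = ennreal (1 / 3 ^ n)"
        using True by (subst nn_integral_cmult_indicator) auto
      finally show ?thesis .
    next
      case False
      \<comment> \<open>The cylinder meets an earlier X_j, hence X_(n-1); the point x found there
        shows which cylinder of level n - 1 contains it.\<close>
      then obtain j x where j: "j < n" "x \<in> cyl n f" "x \<in> lev j" using less.prems by (auto simp: first_cyls_def)
      then obtain n' where "n = Suc n'" by (cases n) auto
      then have n': "n = Suc n'" "x \<in> lev n'" using lev_le[OF j(3), of n'] j(1) by auto
      define f' c where "f' = pos n' x" and "c = inc n' x"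
      have f': "f' \<in> chacon_F n'" "c \<in> chacon_C (Suc n')" "f = f' + c"
        using n' j pos_in_F inc_in_C by (auto simp: f'_def c_def cyl_def pos_Suc)
      have "\<phi> (cyl n f) = (\<integral>\<^sup>+ k. ennreal (1 / 3) * (ennreal (1 / 3 ^ fst k) * emeasure digit_measure (hits (fst k) (snd k) (cyl n' f'))) \<partial>count_space first_cyls)"
        unfolding \<phi>_def
      proof (intro nn_integral_cong)
        fix k assume "k \<in> space (count_space first_cyls)"
        then obtain m f0 where k: "k = (m, f0)" "(m, f0) \<in> first_cyls" by (cases k) auto
        then have f0: "f0 \<in> chacon_F m" by (simp add: first_cyls_def)
        have "emeasure digit_measure (hits m f0 (cyl n f)) = ennreal (1 / 3) * emeasure digit_measure (hits m f0 (cyl n' f'))"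
        proof (cases "m \<le> n'")
          case True
          then show ?thesis using emeasure_hits_Suc[OF True f0 f'(1,2)] n' f' by simp
        next
          case False
          \<comment> \<open>A piece that begins after n - 1 is disjoint from X_(n-1), hence misses
            the larger cylinder and the smaller one alike.\<close>
          have sub: "cyl n f \<subseteq> cyl n' f'" using UN_upper[OF f'(2), of "\<lambda>c. cyl (Suc n') (f' + c)"] cyl_split[OF f'(1)] n'(1) f'(3) by simp
          have "hits m f0 (cyl n' f') = {}"
          proof (rule ccontr)
            assume "hits m f0 (cyl n' f') \<noteq> {}"
            then obtain \<omega> where w: "\<omega> \<in> space digit_measure" "point_of m f0 \<omega> \<in> cyl n' f'" by (auto simp: hits_def)
            then have "point_of m f0 \<omega> \<in> cyl m f0 \<inter> lev n'" using point_of(1,2)[OF f0 w(1)] by (simp add: cyl_def)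
            moreover have "cyl m f0 \<inter> lev n' = {}" using False k(2) by (simp add: first_cyls_def)
            ultimately show False by simp
          qed
          moreover from this have "hits m f0 (cyl n f) = {}" using sub by (auto simp: hits_def)
          ultimately show ?thesis by simp
        qed
        then show "ennreal (1 / 3 ^ fst k) * emeasure digit_measure (hits (fst k) (snd k) (cyl n f)) =
            ennreal (1 / 3) * (ennreal (1 / 3 ^ fst k) * emeasure digit_measure (hits (fst k) (snd k) (cyl n' f')))"
          using k by (simp add: ac_simps)
      qed
      also have "\<dots> = ennreal (1 / 3) * \<phi> (cyl n' f')"
        unfolding \<phi>_def by (rule nn_integral_cmult) simp
      also have "\<dots> = ennreal (1 / 3 ^ n)"
        using less.IH[OF _ f'(1)] n' by (simp flip: ennreal_mult)
      finally show ?thesis .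
    qed
  qed
  then show ?thesis using sM em by (intro exI[of _ M]) simp
qed

section \<open>Invariance, uniqueness and ergodicity of the measure\<close>

lemma sets_chacon_measure[measurable_cong, simp]: "sets chacon_measure = sets borel"
  and emeasure_cyl: "f \<in> chacon_F n \<Longrightarrow> emeasure chacon_measure (cyl n f) = ennreal (1 / 3 ^ n)"
proof -
  have "\<exists>!M. sets M = sets borel \<and> (\<forall>n. \<forall>f\<in>chacon_F n. emeasure M (cyl n f) = ennreal (1 / 3 ^ n))"
    using ex_chacon_measure by (auto intro!: cyl_measure_eqI)
  from theI'[OF this] show "sets chacon_measure = sets borel"
    "f \<in> chacon_F n \<Longrightarrow> emeasure chacon_measure (cyl n f) = ennreal (1 / 3 ^ n)"
    unfolding chacon_measure_def chacon_cyl_eq by auto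
qed

lemma space_chacon_measure[simp]: "space chacon_measure = UNIV"
  using sets_eq_imp_space_eq[OF sets_chacon_measure] by simp

lemma emeasure_lev_finite: "emeasure chacon_measure (lev n) < \<infinity>"
proof -
  have "emeasure chacon_measure (lev n) = (\<Sum>f\<in>chacon_F n. emeasure chacon_measure (cyl n f))"
    unfolding lev_eq_UN by (intro sum_emeasure[symmetric]) (auto simp: finite_chacon_F disjoint_family_on_def cyl_def)
  also have "\<dots> < \<infinity>" by (simp add: emeasure_cyl ennreal_mult_less_top of_nat_less_top)
  finally show ?thesis .
qed

lemma emeasure_lev_0: "emeasure chacon_measure (lev 0) = 1"
  using emeasure_cyl[of 0 0] by (simp add: chacon_F_0 lev_0)

text \<open>The shift by g may push a cylinder out of its F_n. After refinement to a level above |g|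
  all pieces have room to move, and cylinders of one level have equal mass.\<close>

lemma emeasure_T:
  assumes "A \<in> sets borel"
  shows "emeasure chacon_measure (chacon_T g -` A) = emeasure chacon_measure A"
proof -
  let ?M = "distr chacon_measure borel (chacon_T g)"
  have em: "emeasure ?M A = emeasure chacon_measure (chacon_T g -` A)" if "A \<in> sets borel" for A
    using that by (simp add: emeasure_distr)
  have "chacon_measure = ?M"
  proof (rule cyl_measure_eqI)
    fix n f assume f: "f \<in> chacon_F n"
    show "emeasure chacon_measure (cyl n f) \<noteq> \<infinity>" using f by (simp add: emeasure_cyl)
    define N where "N = max n (nat \<bar>g\<bar>)"
    define S where "S = {f' \<in> chacon_F (Suc N). cyl (Suc N) f' \<subseteq> cyl n f}"
    have "\<bar>g\<bar> \<le> int N" by (simp add: N_def)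
    then have N: "n \<le> N" "\<bar>g\<bar> \<le> chacon_h N" using chacon_h_ge[of N] by (auto simp: N_def)
    have eq: "cyl n f = (\<Union>f'\<in>S. cyl (Suc N) f')"
    proof (intro equalityI subsetI)
      fix x assume x: "x \<in> cyl n f"
      then have l: "x \<in> lev (Suc N)" using lev_le[of x n "Suc N"] N by (auto simp: cyl_def)
      then have "x \<in> cyl (Suc N) (pos (Suc N) x)" by (simp add: cyl_def)
      moreover from this have "cyl (Suc N) (pos (Suc N) x) \<subseteq> cyl n f"
        using x N by (intro cyl_inter) auto
      ultimately show "x \<in> (\<Union>f'\<in>S. cyl (Suc N) f')" using pos_in_F[OF l] by (auto simp: S_def)
    qed (auto simp: S_def)
    have fS: "finite S" by (simp add: S_def finite_chacon_F)
    have sh: "f' - g \<in> chacon_F (Suc N)" if f': "f' \<in> S" for f'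
    proof -
      obtain x where "x \<in> cyl (Suc N) f'" using cyl_nonempty[of f' "Suc N"] f' by (auto simp: S_def)
      then have "x \<in> lev N" "pos (Suc N) x = f'" using f' N lev_le by (auto simp: S_def cyl_def)
      then show ?thesis using pos_Suc_margin[of x N "- g"] N by simp
    qed
    have eq': "chacon_T g -` cyl n f = (\<Union>f'\<in>S. cyl (Suc N) (f' - g))"
      unfolding eq vimage_UN
    proof (rule SUP_cong)
      fix f' assume "f' \<in> S"
      then show "chacon_T g -` cyl (Suc N) f' = cyl (Suc N) (f' - g)"
        using vimage_T_cyl[of "f' - g" "Suc N" g] sh by (auto simp: S_def)
    qed simp
    have "emeasure ?M (cyl n f) = (\<Sum>f'\<in>S. emeasure chacon_measure (cyl (Suc N) (f' - g)))"
      unfolding em[OF cyl_measurable] eq'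
      by (intro sum_emeasure[symmetric]) (auto simp: fS disjoint_family_on_def cyl_def)
    also have "\<dots> = (\<Sum>f'\<in>S. emeasure chacon_measure (cyl (Suc N) f'))"
      using sh by (intro sum.cong refl) (auto simp: emeasure_cyl S_def)
    also have "\<dots> = emeasure chacon_measure (cyl n f)"
      unfolding eq by (intro sum_emeasure) (auto simp: fS disjoint_family_on_def cyl_def)
    finally show "emeasure chacon_measure (cyl n f) = emeasure ?M (cyl n f)" by simp
  qed auto
  then show ?thesis using em[OF assms] by simp
qed

lemma invariant_measure_unique:
  assumes "sets M = sets borel" "\<And>g A. A \<in> sets borel \<Longrightarrow> emeasure M (chacon_T g -` A) = emeasure M A"
    and "emeasure M (lev 0) < \<infinity>"
  shows "M = scale_measure (emeasure M (lev 0)) chacon_measure"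
proof (rule cyl_measure_eqI)
  fix n f assume f: "f \<in> chacon_F n"
  show "emeasure M (cyl n f) = emeasure (scale_measure (emeasure M (lev 0)) chacon_measure) (cyl n f)"
    using invariant_cyl[OF assms(1,2) f] f by (simp add: emeasure_cyl)
  then show "emeasure M (cyl n f) \<noteq> \<infinity>"
    using f assms(3) by (simp add: emeasure_cyl ennreal_mult_eq_top_iff less_top)
qed (use assms(1) in auto)

text \<open>The restriction of the measure to A is again invariant and finite on X_0, hence a
  multiple of the measure by uniqueness; the multiple is evaluated on the complement of A.\<close>

lemma chacon_measure_ergodic:
  assumes "A \<in> sets borel" and A: "\<And>g. AE x in chacon_measure. chacon_T g x \<in> A \<longleftrightarrow> x \<in> A"
  shows "emeasure chacon_measure A = 0 \<or> emeasure chacon_measure (- A) = 0"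
proof -
  let ?M = "density chacon_measure (indicator A)"
  have em: "emeasure ?M B = emeasure chacon_measure (A \<inter> B)" if "B \<in> sets borel" for B
    using that assms(1) by (simp add: emeasure_density nn_integral_indicator flip: indicator_inter_arith)
  have "?M = scale_measure (emeasure ?M (lev 0)) chacon_measure"
  proof (rule invariant_measure_unique)
    fix g and B :: "chacon set" assume B: "B \<in> sets borel"
    have [measurable]: "A \<in> sets borel" "B \<in> sets borel" using assms B by auto
    have Tm: "chacon_T g -` B \<in> sets borel" "chacon_T g -` (A \<inter> B) \<in> sets borel"
      using measurable_sets[OF T_measurable[of g], of B] measurable_sets[OF T_measurable[of g], of "A \<inter> B"] by auto
    have "emeasure ?M (chacon_T g -` B) = emeasure chacon_measure (A \<inter> chacon_T g -` B)"
      by (rule em[OF Tm(1)])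
    also have "\<dots> = emeasure chacon_measure (chacon_T g -` (A \<inter> B))"
      by (rule emeasure_eq_AE) (use A[of g] Tm in auto)
    also have "\<dots> = emeasure chacon_measure (A \<inter> B)" by (rule emeasure_T) simp
    finally show "emeasure ?M (chacon_T g -` B) = emeasure ?M B" using em[OF B] by simp
  next
    have "emeasure ?M (lev 0) \<le> emeasure chacon_measure (lev 0)"
      unfolding em[OF lev_measurable] by (rule emeasure_mono) auto
    then show "emeasure ?M (lev 0) < \<infinity>" by (simp add: emeasure_lev_0 order_le_less_trans)
  qed simp
  then have *: "emeasure chacon_measure (A \<inter> B) = emeasure ?M (lev 0) * emeasure chacon_measure B" if "B \<in> sets borel" for B
    using em[OF that] by (metis emeasure_scale_measure)
  have "emeasure ?M (lev 0) = 0 \<or> emeasure chacon_measure (- A) = 0"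
    using *[of "- A"] assms(1) by (auto simp: borel_comp)
  then show ?thesis using *[of UNIV] by auto
qed

section \<open>Joinings and patterns\<close>

definition inc_set :: "nat \<Rightarrow> int \<Rightarrow> chacon set" where
  "inc_set n c = {z \<in> lev n. inc n z = c}"

lemma inc_set_measurable[measurable]: "inc_set n c \<in> sets borel"
proof -
  have "inc_set n c = (\<Union>f\<in>chacon_F n. cyl n f \<inter> cyl (Suc n) (f + c))"
    using pos_in_F lev_Suc by (auto simp: inc_set_def cyl_def inc_def)
  also have "\<dots> \<in> sets borel" by (intro sets.finite_UN finite_chacon_F sets.Int cyl_measurable)
  finally show ?thesis .
qed

lemma T_inc_set_eventually: "\<exists>N. \<forall>n\<ge>N. \<forall>c. chacon_T g z \<in> inc_set n c \<longleftrightarrow> z \<in> inc_set n c"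
proof -
  obtain N where N: "z \<in> lev N" "chacon_T g z \<in> lev N" "\<And>k. k \<ge> N \<Longrightarrow> pos k (chacon_T g z) = pos k z + g"
    using T_eventually[of z g] by blast
  have "chacon_T g z \<in> inc_set n c \<longleftrightarrow> z \<in> inc_set n c" if "N \<le> n" for n c
    using N(1,2) N(3)[of n] N(3)[of "Suc n"] lev_le that by (auto simp: inc_set_def inc_def)
  then show ?thesis by blast
qed

lemma cyls_separate:
  assumes "x \<noteq> y"
  shows "\<exists>C\<in>cyls. x \<in> C \<and> y \<notin> C"
proof -
  obtain m n where "x \<in> lev m" "y \<in> lev n" using ex_lev by blast
  then have l: "x \<in> lev (max m n)" "y \<in> lev (max m n)" using lev_le max.cobounded1 max.cobounded2 by blast+
  then obtain k where "max m n \<le> k" "pos k x \<noteq> pos k y" using lev_eqI_pos assms by blast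
  then have "x \<in> cyl k (pos k x)" "y \<notin> cyl k (pos k x)" using l lev_le by (auto simp: cyl_def)
  then show ?thesis using cyl_in_cyls by blast
qed

text \<open>Countably many cylinders separate points, so equality is a countable conjunction of
  measurable conditions.\<close>

lemma pred_chacon_eq[measurable (raw)]:
  assumes [measurable]: "f \<in> borel_measurable M" "g \<in> borel_measurable M"
  shows "Measurable.pred M (\<lambda>x. f x = (g x :: chacon))"
proof -
  have "(\<lambda>x. f x = g x) = (\<lambda>x. \<forall>C\<in>cyls. f x \<in> C \<longleftrightarrow> g x \<in> C)"
    using cyls_separate by (intro ext) metis
  moreover have "Measurable.pred M (\<lambda>x. \<forall>C\<in>cyls. f x \<in> C \<longleftrightarrow> g x \<in> C)"
    unfolding pred_def
  proof (rule sets.sets_Collect_countable_All'[OF _ countable_cyls])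
    fix C assume "C \<in> cyls"
    then have [measurable]: "C \<in> sets borel" by (auto simp: cyls_def)
    show "{x \<in> space M. f x \<in> C \<longleftrightarrow> g x \<in> C} \<in> sets M" by measurable
  qed
  ultimately show ?thesis by simp
qed

abbreviation spJ :: "nat set \<Rightarrow> (nat \<Rightarrow> chacon) set" where
  "spJ J \<equiv> Pi\<^sub>E J (\<lambda>_. UNIV)"

definition pshift :: "nat set \<Rightarrow> nat set \<Rightarrow> int \<Rightarrow> (nat \<Rightarrow> chacon) \<Rightarrow> nat \<Rightarrow> chacon" where
  "pshift J I g x = (\<lambda>j\<in>J. if j \<in> I then chacon_T g (x j) else x j)"

lemma pshift_diag: "pshift J J g = diag_map J (chacon_T g)"
  by (auto simp: pshift_def diag_map_def fun_eq_iff)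

lemma pshift_apply: "j \<in> J \<Longrightarrow> pshift J I g x j = (if j \<in> I then chacon_T g (x j) else x j)"
  by (simp add: pshift_def)

lemma pshift_in_spJ[simp]: "pshift J I g x \<in> spJ J"
  by (simp add: pshift_def)

lemma pshift_measurable[measurable]: "pshift J I g \<in> measurable (XJ J) (XJ J)"
  unfolding pshift_def by (rule measurable_restrict) (auto intro: measurable_compose[OF _ T_measurable])

lemma pshift_add: "pshift J I g (pshift J I h x) = pshift J I (g + h) x"
  by (auto simp: pshift_def fun_eq_iff T_add)

lemma pshift_0: "x \<in> spJ J \<Longrightarrow> pshift J I 0 x = x"
  by (auto simp: pshift_def fun_eq_iff PiE_iff extensional_def)

lemma pshift_inverse: "x \<in> spJ J \<Longrightarrow> pshift J I (- g) (pshift J I g x) = x" "x \<in> spJ J \<Longrightarrow> pshift J I g (pshift J I (- g) x) = x"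
  by (simp_all add: pshift_add pshift_0)

lemma pshift_commute: "pshift J I g (pshift J I' h x) = pshift J I' h (pshift J I g x)"
  by (auto simp: pshift_def fun_eq_iff T_add add.commute)

lemma pshift_levJ: "x \<in> levJ J n \<Longrightarrow> \<bar>g\<bar> \<le> chacon_h n \<Longrightarrow> pshift J I g x \<in> levJ J (Suc n)"
  by (auto simp: pshift_def PiE_iff T_in_lev_Suc lev_Suc)

lemma pred_coord:
  "j \<in> J \<Longrightarrow> A \<in> sets borel \<Longrightarrow> Measurable.pred (XJ J) (\<lambda>x. x j \<in> A)"
  using measurable_component_singleton[of j J "\<lambda>_. borel"] by simp

lemma sigma_finite_levJ:
  assumes "finite J" "sets M = sets (XJ J)" "\<And>n. emeasure M (levJ J n) < \<infinity>"
  shows "sigma_finite_measure M"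
proof
  have "space M = spJ J" using sets_eq_imp_space_eq[OF assms(2)] by (simp add: space_PiM)
  then show "\<exists>A. countable A \<and> A \<subseteq> sets M \<and> \<Union> A = space M \<and> (\<forall>a\<in>A. emeasure M a \<noteq> \<infinity>)"
    using assms UN_levJ[OF assms(1)] by (intro exI[of _ "range (levJ J)"]) (auto simp: less_top)
qed

text \<open>In \<open>adj0\<close> and \<open>adj1\<close> the set \<open>I\<close> is where the digit is the larger one of the two that occur; the
  power \<open>h\<^sub>n\<close> of the diagonal action turns the first pattern into the second.\<close>

definition adj0 :: "nat set \<Rightarrow> nat set \<Rightarrow> nat \<Rightarrow> (nat \<Rightarrow> chacon) \<Rightarrow> bool" where
  "adj0 J I n x \<longleftrightarrow> (\<forall>i\<in>J. x i \<in> inc_set n (if i \<in> I then 0 else - chacon_h n))"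

definition adj1 :: "nat set \<Rightarrow> nat set \<Rightarrow> nat \<Rightarrow> (nat \<Rightarrow> chacon) \<Rightarrow> bool" where
  "adj1 J I n x \<longleftrightarrow> (\<forall>i\<in>J. x i \<in> inc_set n (if i \<in> I then chacon_h n + 1 else 0))"

definition const_pattern :: "nat set \<Rightarrow> nat \<Rightarrow> (nat \<Rightarrow> chacon) \<Rightarrow> bool" where
  "const_pattern J n x \<longleftrightarrow> (\<exists>c\<in>chacon_C (Suc n). \<forall>i\<in>J. x i \<in> inc_set n c)"

definition spread :: "nat set \<Rightarrow> nat \<Rightarrow> (nat \<Rightarrow> chacon) \<Rightarrow> bool" where
  "spread J n x \<longleftrightarrow> (\<exists>i\<in>J. x i \<in> inc_set n (- chacon_h n)) \<and> (\<exists>i\<in>J. x i \<in> inc_set n (chacon_h n + 1))"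

text \<open>There are three possible digits. A nonconstant pattern in which one of the extreme
  digits is missing takes exactly two neighbouring values, and I collects the places of the larger
  one.\<close>

lemma pattern_cases:
  assumes "x \<in> levJ J n"
  shows "const_pattern J n x \<or> spread J n x \<or> (\<exists>I. I \<noteq> {} \<and> I \<subset> J \<and> (adj0 J I n x \<or> adj1 J I n x))"
proof (cases "const_pattern J n x \<or> spread J n x")
  case False
  have D: "x i \<in> inc_set n (inc n (x i))" "inc n (x i) = - chacon_h n \<or> inc n (x i) = 0 \<or> inc n (x i) = chacon_h n + 1"
    if "i \<in> J" for i
    using assms that inc_cases[of "x i" n] by (auto simp: inc_set_def PiE_iff)
  have nc: "\<exists>i\<in>J. inc n (x i) \<noteq> c" if "c \<in> chacon_C (Suc n)" for c
    using False that D(1) unfolding const_pattern_def by metis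
  from False consider "\<forall>i\<in>J. inc n (x i) \<noteq> - chacon_h n" | "\<forall>i\<in>J. inc n (x i) \<noteq> chacon_h n + 1"
    unfolding spread_def using D(1) by metis
  then show ?thesis
  proof cases
    case 1
    let ?I = "{i \<in> J. inc n (x i) = chacon_h n + 1}"
    have adj: "adj0 J ?I n x \<or> adj1 J ?I n x"
    proof (rule disjI2)
      show "adj1 J ?I n x"
      unfolding adj1_def
    proof
      fix i assume i: "i \<in> J"
      then have "inc n (x i) = (if i \<in> ?I then chacon_h n + 1 else 0)" using D(2)[OF i] 1 by auto
      then show "x i \<in> inc_set n (if i \<in> ?I then chacon_h n + 1 else 0)" using D(1)[OF i] by (simp only:)
      qed
    qed
    moreover have "?I \<subset> J" using nc[of "chacon_h n + 1"] by (auto simp: mem_chacon_C)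
    moreover obtain i where i: "i \<in> J" "inc n (x i) \<noteq> 0" using nc[of "0"] by (auto simp: mem_chacon_C)
    then have "i \<in> ?I" using 1 D(2)[OF i(1)] by auto
    then have "?I \<noteq> {}" by blast
    ultimately show ?thesis by (intro disjI2) (intro exI[of _ ?I] conjI)
  next
    case 2
    let ?I = "{i \<in> J. inc n (x i) = 0}"
    have adj: "adj0 J ?I n x \<or> adj1 J ?I n x"
    proof (rule disjI1)
      show "adj0 J ?I n x"
      unfolding adj0_def
    proof
      fix i assume i: "i \<in> J"
      then have "inc n (x i) = (if i \<in> ?I then 0 else - chacon_h n)" using D(2)[OF i] 2 by auto
      then show "x i \<in> inc_set n (if i \<in> ?I then 0 else - chacon_h n)" using D(1)[OF i] by (simp only:)
      qed
    qed
    moreover have "?I \<subset> J" using nc[of 0] by (auto simp: mem_chacon_C)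
    moreover obtain i where i: "i \<in> J" "inc n (x i) \<noteq> - chacon_h n" using nc[of "- chacon_h n"] by (auto simp: mem_chacon_C)
    then have "i \<in> ?I" using 2 D(2)[OF i(1)] by auto
    then have "?I \<noteq> {}" by blast
    ultimately show ?thesis by (intro disjI2) (intro exI[of _ ?I] conjI)
  qed
qed blast

lemma pattern_measurable:
  assumes "finite J"
  shows "Measurable.pred (XJ J) (adj0 J I n)" "Measurable.pred (XJ J) (adj1 J I n)"
    "Measurable.pred (XJ J) (const_pattern J n)" "Measurable.pred (XJ J) (spread J n)"
proof -
  have fC: "finite (chacon_C (Suc n))" by (rule card_chacon_C)
  show "Measurable.pred (XJ J) (adj0 J I n)" "Measurable.pred (XJ J) (adj1 J I n)"
    "Measurable.pred (XJ J) (const_pattern J n)" "Measurable.pred (XJ J) (spread J n)"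
    unfolding adj0_def[abs_def] adj1_def[abs_def] const_pattern_def[abs_def] spread_def[abs_def]
    by (intro pred_intros_finite pred_intros_logic assms fC pred_coord inc_set_measurable; assumption)+
qed

text \<open>The index set is an arbitrary finite set, so that the induction can pass to I and J - I.
  The marginals enter through their null sets alone, since they need not be sigma-finite.\<close>

locale joining =
  fixes J :: "nat set" and \<theta> :: "(nat \<Rightarrow> chacon) measure"
  assumes fin_J: "finite J" and ne_J: "J \<noteq> {}"
    and sets_th: "sets \<theta> = sets (XJ J)"
    and fin_th: "\<And>n. emeasure \<theta> (levJ J n) < \<infinity>"
    and inv_th: "\<And>A. A \<in> sets (XJ J) \<Longrightarrow> emeasure \<theta> (pshift J J 1 -` A \<inter> spJ J) = emeasure \<theta> A"
    and erg_th: "ergodic_under (pshift J J 1) \<theta>"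
    and marg: "\<And>i A. i \<in> J \<Longrightarrow> A \<in> sets borel \<Longrightarrow>
      emeasure \<theta> {x \<in> spJ J. x i \<in> A} = 0 \<longleftrightarrow> emeasure chacon_measure A = 0"
begin

declare sets_th[measurable_cong]

lemma space_th: "space \<theta> = spJ J"
  using sets_eq_imp_space_eq[OF sets_th] by (simp add: space_PiM)

sublocale ergodic_int_action \<theta> "pshift J J"
proof
  show "pshift J J g \<in> measurable \<theta> \<theta>" for g
    using pshift_measurable sets_th measurable_cong_sets by blast
qed (use inv_th erg_th pshift_0 in \<open>auto simp: space_th pshift_add sets_th\<close>)

lemma sigma_finite_th: "sigma_finite_measure \<theta>"
  using fin_J sets_th fin_th by (rule sigma_finite_levJ)

lemma nonzero: "emeasure \<theta> (spJ J) \<noteq> 0"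
proof -
  obtain i where i: "i \<in> J" using ne_J by blast
  have "emeasure chacon_measure (lev 0) \<le> emeasure chacon_measure UNIV" by (rule emeasure_mono) auto
  then have "emeasure chacon_measure UNIV \<noteq> 0" by (auto simp: emeasure_lev_0)
  then show ?thesis using marg[OF i, of UNIV] by simp
qed

lemma not_AE_False: "\<not> (AE x in \<theta>. False)"
proof
  assume "AE x in \<theta>. False"
  then have "emeasure \<theta> (space \<theta>) = 0" by (simp add: AE_iff_measurable[OF sets.top])
  then show False using nonzero by (simp add: space_th)
qed

definition tame :: "nat \<Rightarrow> (nat \<Rightarrow> chacon) \<Rightarrow> bool" where
  "tame m x \<longleftrightarrow> x \<in> levJ J m \<and> (\<forall>n\<ge>m. const_pattern J n x \<or> spread J n x)"

lemma tame_measurable[measurable]: "Measurable.pred \<theta> (tame m)"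
proof -
  have "Measurable.pred \<theta> (\<lambda>x. x \<in> levJ J m)" using levJ_measurable[OF fin_J] sets_th by simp
  moreover have "Measurable.pred \<theta> (const_pattern J n)" "Measurable.pred \<theta> (spread J n)" for n
    using pattern_measurable[OF fin_J] sets_th measurable_cong_sets by blast+
  ultimately show ?thesis unfolding tame_def[abs_def] by measurable
qed

lemma adjacent_eventually:
  assumes "x \<in> spJ J"
  shows "\<exists>N. \<forall>n\<ge>N. adj0 J I n (pshift J J g x) = adj0 J I n x \<and> adj1 J I n (pshift J J g x) = adj1 J I n x"
proof -
  have "\<forall>i. \<exists>N. \<forall>n\<ge>N. \<forall>c. chacon_T g (x i) \<in> inc_set n c \<longleftrightarrow> x i \<in> inc_set n c"
    using T_inc_set_eventually by blast
  then obtain N where N: "\<And>i n c. n \<ge> N i \<Longrightarrow> chacon_T g (x i) \<in> inc_set n c \<longleftrightarrow> x i \<in> inc_set n c" by metis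
  have M: "N i \<le> Max (N ` J)" if "i \<in> J" for i using that fin_J by simp
  have "adj0 J I n (pshift J J g x) = adj0 J I n x \<and> adj1 J I n (pshift J J g x) = adj1 J I n x"
    if "Max (N ` J) \<le> n" for n
    unfolding adj0_def adj1_def using N order_trans[OF M that] by (auto simp: pshift_apply)
  then show ?thesis by blast
qed

definition freq_adj :: "nat set \<Rightarrow> (nat \<Rightarrow> chacon) \<Rightarrow> bool" where
  "freq_adj I x \<longleftrightarrow> (\<forall>m. \<exists>n\<ge>m. adj0 J I n x \<or> adj1 J I n x)"

lemma adj_measurable[measurable]: "Measurable.pred \<theta> (adj0 J I n)" "Measurable.pred \<theta> (adj1 J I n)"
  using pattern_measurable[OF fin_J] sets_th measurable_cong_sets by blast+

lemma freq_adj_measurable[measurable]: "Measurable.pred \<theta> (freq_adj I)"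
  unfolding freq_adj_def[abs_def] by measurable

lemma freq_adj_invariant:
  assumes "x \<in> spJ J"
  shows "freq_adj I (pshift J J g x) = freq_adj I x"
proof -
  obtain N where N: "\<And>n. n \<ge> N \<Longrightarrow> adj0 J I n (pshift J J g x) = adj0 J I n x \<and> adj1 J I n (pshift J J g x) = adj1 J I n x"
    using adjacent_eventually[OF assms] by blast
  show ?thesis
  proof
    assume *: "freq_adj I (pshift J J g x)"
    show "freq_adj I x" unfolding freq_adj_def
    proof
      fix m
      obtain n where "n \<ge> max m N" "adj0 J I n (pshift J J g x) \<or> adj1 J I n (pshift J J g x)"
        using * unfolding freq_adj_def by blast
      then show "\<exists>n\<ge>m. adj0 J I n x \<or> adj1 J I n x" using N[of n] by auto
    qed
  next
    assume *: "freq_adj I x"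
    show "freq_adj I (pshift J J g x)" unfolding freq_adj_def
    proof
      fix m
      obtain n where "n \<ge> max m N" "adj0 J I n x \<or> adj1 J I n x"
        using * unfolding freq_adj_def by blast
      then show "\<exists>n\<ge>m. adj0 J I n (pshift J J g x) \<or> adj1 J I n (pshift J J g x)" using N[of n] by auto
    qed
  qed
qed

text \<open>Each \<open>freq_adj I\<close> is invariant, hence null or conull, and there are
  finitely many I. The second alternative only offers positive measure, because
  \<open>tame m\<close> is not invariant under the shift.\<close>

lemma dichotomy:
  obtains (adjacent) I where "I \<noteq> {}" "I \<subset> J" "AE x in \<theta>. freq_adj I x"
    | (tame) m where "\<not> (AE x in \<theta>. \<not> tame m x)"
proof (cases "\<exists>I. I \<noteq> {} \<and> I \<subset> J \<and> (AE x in \<theta>. freq_adj I x)")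
  case False
  have "AE x in \<theta>. \<forall>I\<in>{I. I \<noteq> {} \<and> I \<subset> J}. \<not> freq_adj I x"
  proof (rule AE_finite_allI)
    show "finite {I. I \<noteq> {} \<and> I \<subset> J}" by (rule finite_subset[of _ "Pow J"]) (auto simp: fin_J)
    fix I assume "I \<in> {I. I \<noteq> {} \<and> I \<subset> J}"
    moreover have "(AE x in \<theta>. freq_adj I x) \<or> (AE x in \<theta>. \<not> freq_adj I x)"
      by (rule AE_invariant) (auto simp: freq_adj_invariant space_th)
    ultimately show "AE x in \<theta>. \<not> freq_adj I x" using False by blast
  qed
  then have ex: "AE x in \<theta>. \<exists>m. tame m x"
  proof (rule AE_mp, intro AE_I2 impI)
    fix x assume x: "x \<in> space \<theta>" "\<forall>I\<in>{I. I \<noteq> {} \<and> I \<subset> J}. \<not> freq_adj I x"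
    have "\<forall>I. \<exists>m. I \<noteq> {} \<and> I \<subset> J \<longrightarrow> (\<forall>n\<ge>m. \<not> (adj0 J I n x \<or> adj1 J I n x))"
      using x(2) unfolding freq_adj_def by blast
    then obtain m where m: "\<And>I n. I \<noteq> {} \<Longrightarrow> I \<subset> J \<Longrightarrow> n \<ge> m I \<Longrightarrow> \<not> (adj0 J I n x \<or> adj1 J I n x)" by metis
    obtain k where k: "x \<in> levJ J k" using UN_levJ[OF fin_J] x(1) unfolding space_th by blast
    define K where "K = max k (Max (m ` Pow J))"
    have "m I \<le> K" if "I \<subset> J" for I
      using that fin_J unfolding K_def by (intro max.coboundedI2 Max_ge) auto
    then have mK: "\<not> (adj0 J I n x \<or> adj1 J I n x)" if "I \<noteq> {}" "I \<subset> J" "n \<ge> K" for I n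
      using m[OF that(1,2) order_trans[OF _ that(3)]] that(2) by blast
    have kK: "k \<le> K" by (simp add: K_def)
    have "const_pattern J n x \<or> spread J n x" if n: "n \<ge> K" for n
    proof -
      have "x \<in> levJ J n" using levJ_mono[OF order_trans[OF kK n]] k by (rule subsetD)
      from pattern_cases[OF this] show ?thesis using mK[OF _ _ n] by metis
    qed
    moreover have "x \<in> levJ J K" using levJ_mono[OF kK] k by (rule subsetD)
    ultimately have "tame K x" by (simp add: tame_def)
    then show "\<exists>m. tame m x" ..
  qed
  have "\<exists>m. \<not> (AE x in \<theta>. \<not> tame m x)"
  proof (rule ccontr)
    assume "\<nexists>m. \<not> (AE x in \<theta>. \<not> tame m x)"
    then have "AE x in \<theta>. \<forall>m. \<not> tame m x" unfolding AE_all_countable by blast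
    with ex have "AE x in \<theta>. False" by eventually_elim blast
    then show False using not_AE_False by blast
  qed
  then show ?thesis using that(2) by blast
qed (use that(1) in blast)

end

section \<open>Patterns without adjacent values: graph joinings\<close>

lemma AE_eq_null: "A \<in> sets M \<Longrightarrow> (AE x in M. x \<notin> A) \<longleftrightarrow> emeasure M A = 0"
  by (subst AE_iff_measurable[where N = A]) (auto dest: sets.sets_into_space)

text \<open>The constraints before N cut out a union of cylinders of level N, and a prescribed digit
  at N leaves at most one of the three parts of each.\<close>

lemma inc_prescribed_step:
  assumes "m \<le> N" "S \<subseteq> {m..}" "N \<in> S"
  shows "emeasure chacon_measure {z \<in> lev m. \<forall>n\<in>S \<inter> {..<Suc N}. z \<in> inc_set n (a n)} \<le>
    ennreal (1 / 3) * emeasure chacon_measure {z \<in> lev m. \<forall>n\<in>S \<inter> {..<N}. z \<in> inc_set n (a n)}"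
    (is "emeasure _ ?Z' \<le> _ * emeasure _ ?Z")
proof -
  define F where "F = {f \<in> chacon_F N. cyl N f \<subseteq> ?Z}"
  have fF: "finite F" by (simp add: F_def finite_chacon_F)
  have Z: "?Z = (\<Union>f\<in>F. cyl N f)"
  proof (intro equalityI subsetI)
    fix z assume z: "z \<in> ?Z"
    then have zl: "z \<in> lev m" "z \<in> lev N" using lev_le[OF _ assms(1)] by auto
    have "cyl N (pos N z) \<subseteq> ?Z"
    proof
      fix w assume "w \<in> cyl N (pos N z)"
      then have w: "w \<in> lev N" "pos N w = pos N z" by (auto simp: cyl_def)
      then have *: "w \<in> lev m" "\<And>k. m \<le> k \<Longrightarrow> k \<le> N \<Longrightarrow> pos k w = pos k z"
        using lev_agree[OF assms(1) w(1) zl(1) w(2)] by auto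
      have "w \<in> inc_set n (a n)" if n: "n \<in> S \<inter> {..<N}" for n
      proof -
        have "m \<le> n" "z \<in> inc_set n (a n)" using z n assms(2) by auto
        then show ?thesis using *(2)[of n] *(2)[of "Suc n"] n lev_le[OF *(1)] by (auto simp: inc_set_def inc_def)
      qed
      then show "w \<in> ?Z" using *(1) by simp
    qed
    then have "pos N z \<in> F" using pos_in_F[OF zl(2)] by (simp add: F_def)
    then show "z \<in> (\<Union>f\<in>F. cyl N f)" using zl(2) by (intro UN_I[of "pos N z"]) (auto simp: cyl_def)
  qed (auto simp: F_def)
  have "?Z' \<subseteq> (\<Union>f\<in>F. cyl (Suc N) (f + a N))"
  proof
    fix z assume z: "z \<in> ?Z'"
    then have "z \<in> ?Z" "z \<in> inc_set N (a N)" using assms(3) by auto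
    then obtain f where "f \<in> F" "z \<in> cyl N f" unfolding Z by blast
    then show "z \<in> (\<Union>f\<in>F. cyl (Suc N) (f + a N))"
      using \<open>z \<in> inc_set N (a N)\<close> by (intro UN_I[of f]) (auto simp: cyl_def inc_set_def inc_def lev_Suc)
  qed
  then have "emeasure chacon_measure ?Z' \<le> emeasure chacon_measure (\<Union>f\<in>F. cyl (Suc N) (f + a N))"
    using fF by (intro emeasure_mono) auto
  also have "\<dots> \<le> (\<Sum>f\<in>F. emeasure chacon_measure (cyl (Suc N) (f + a N)))"
    using fF by (intro emeasure_subadditive_finite) auto
  also have "\<dots> \<le> (\<Sum>f\<in>F. ennreal (1 / 3) * emeasure chacon_measure (cyl N f))"
  proof (rule sum_mono)
    fix f assume "f \<in> F"
    then have f: "f \<in> chacon_F N" by (simp add: F_def)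
    have "ennreal (1 / 3) * ennreal (1 / 3 ^ N) = ennreal (1 / 3 ^ Suc N)"
      by (subst ennreal_mult[symmetric]; simp)
    then show "emeasure chacon_measure (cyl (Suc N) (f + a N)) \<le> ennreal (1 / 3) * emeasure chacon_measure (cyl N f)"
      using emeasure_cyl[OF f] emeasure_cyl[of "f + a N" "Suc N"]
      by (cases "f + a N \<in> chacon_F (Suc N)") (simp_all add: cyl_empty)
  qed
  also have "\<dots> = ennreal (1 / 3) * (\<Sum>f\<in>F. emeasure chacon_measure (cyl N f))" by (simp add: sum_distrib_left)
  also have "(\<Sum>f\<in>F. emeasure chacon_measure (cyl N f)) = emeasure chacon_measure ?Z"
    unfolding Z by (intro sum_emeasure) (auto simp: fF disjoint_family_on_def cyl_def)
  finally show ?thesis .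
qed

lemma inc_prescribed_sets: "{z \<in> lev m. \<forall>n\<in>S. z \<in> inc_set n (a n)} \<in> sets borel"
proof -
  have "Measurable.pred borel (\<lambda>z. z \<in> lev m \<and> (\<forall>n. n \<in> S \<longrightarrow> z \<in> inc_set n (a n)))" by measurable
  then show ?thesis by (simp add: pred_def Ball_def)
qed

text \<open>Every prescribed digit costs a factor 1/3. This will forbid patterns that are
  deterministic and nonconstant infinitely often.\<close>

lemma inc_prescribed_null:
  assumes "infinite S" "S \<subseteq> {m..}"
  shows "emeasure chacon_measure {z \<in> lev m. \<forall>n\<in>S. z \<in> inc_set n (a n)} = 0"
proof -
  let ?Z = "\<lambda>N. {z \<in> lev m. \<forall>n\<in>S \<inter> {..<N}. z \<in> inc_set n (a n)}"
  let ?\<mu> = "emeasure chacon_measure"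
  have bd: "\<exists>N. ?\<mu> (?Z N) \<le> ennreal ((1 / 3) ^ k) * ?\<mu> (lev m)" for k
  proof (induction k)
    case 0
    show ?case by (intro exI[of _ 0]) (simp add: emeasure_mono)
  next
    case (Suc k)
    then obtain N where N: "?\<mu> (?Z N) \<le> ennreal ((1 / 3) ^ k) * ?\<mu> (lev m)" by blast
    obtain n where n: "n \<in> S" "n \<ge> N" using assms(1) by (meson infinite_nat_iff_unbounded_le)
    have "?\<mu> (?Z (Suc n)) \<le> ennreal (1 / 3) * ?\<mu> (?Z n)"
      by (rule inc_prescribed_step) (use n assms(2) in auto)
    also have "?\<mu> (?Z n) \<le> ?\<mu> (?Z N)"
      using n by (intro emeasure_mono) (auto intro: inc_prescribed_sets)
    also note N
    finally have "?\<mu> (?Z (Suc n)) \<le> ennreal (1 / 3) * (ennreal ((1 / 3) ^ k) * ?\<mu> (lev m))"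
      by (simp add: mult_left_mono)
    also have "\<dots> = (ennreal (1 / 3) * ennreal ((1 / 3) ^ k)) * ?\<mu> (lev m)"
      by (simp only: mult.assoc)
    also have "ennreal (1 / 3) * ennreal ((1 / 3) ^ k) = ennreal ((1 / 3) ^ Suc k)"
      by (subst ennreal_mult[symmetric]; simp)
    finally show ?case by blast
  qed
  have fin: "?\<mu> (lev m) \<noteq> \<top>" using emeasure_lev_finite[of m] by simp
  have "?\<mu> {z \<in> lev m. \<forall>n\<in>S. z \<in> inc_set n (a n)} \<le> ennreal ((1 / 3) ^ k * measure chacon_measure (lev m))" for k
  proof -
    obtain N where N: "?\<mu> (?Z N) \<le> ennreal ((1 / 3) ^ k) * ?\<mu> (lev m)" using bd by blast
    have "?\<mu> {z \<in> lev m. \<forall>n\<in>S. z \<in> inc_set n (a n)} \<le> ?\<mu> (?Z N)"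
      by (intro emeasure_mono) (auto intro: inc_prescribed_sets)
    then show ?thesis using N fin by (simp add: emeasure_eq_ennreal_measure ennreal_mult)
  qed
  moreover have "(\<lambda>k. ennreal ((1 / 3) ^ k * measure chacon_measure (lev m))) \<longlonglongrightarrow> ennreal (0 * measure chacon_measure (lev m))"
    by (intro tendsto_ennrealI tendsto_mult tendsto_const LIMSEQ_realpow_zero) auto
  ultimately have "?\<mu> {z \<in> lev m. \<forall>n\<in>S. z \<in> inc_set n (a n)} \<le> ennreal (0 * measure chacon_measure (lev m))"
    by (intro LIMSEQ_le_const) auto
  then show ?thesis by simp
qed

text \<open>The positions at k contribute at most h_k - 1 and the digits at most 2 h_k + 1. Two such
  differences sum to at most 6 h_k, just below \<open>chacon_h (Suc k)\<close>.\<close>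

lemma pos_diff_lev:
  assumes "x \<in> lev k" "y \<in> lev k"
  shows "\<bar>pos (Suc k) x - pos (Suc k) y\<bar> \<le> 3 * chacon_h k"
  using pos_in_F[OF assms(1)] pos_in_F[OF assms(2)] inc_cases[OF assms(1)] inc_cases[OF assms(2)]
  unfolding mem_chacon_F pos_Suc by (auto simp: order_trans[OF zero_le_one chacon_h_ge_1])

text \<open>Points of \<open>X\<^sub>k\<close> occupy less than half of \<open>F\<^sub>k\<^sub>+\<^sub>1\<close>, so the position differences before the
  digit \<open>k + 1\<close> cannot compensate a change in the pattern of digits.\<close>

lemma pattern_rigid:
  assumes x: "x \<in> levJ J k" and y: "y \<in> levJ J k"
    and eq: "\<And>i j. i \<in> J \<Longrightarrow> j \<in> J \<Longrightarrow>
      pos (Suc (Suc k)) (x i) - pos (Suc (Suc k)) (x j) = pos (Suc (Suc k)) (y i) - pos (Suc (Suc k)) (y j)"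
    and px: "const_pattern J (Suc k) x \<or> spread J (Suc k) x" and py: "const_pattern J (Suc k) y \<or> spread J (Suc k) y"
  shows "const_pattern J (Suc k) x \<and> const_pattern J (Suc k) y \<or> (\<forall>i\<in>J. inc (Suc k) (x i) = inc (Suc k) (y i))"
    and "\<And>i j. i \<in> J \<Longrightarrow> j \<in> J \<Longrightarrow> pos (Suc k) (x i) - pos (Suc k) (x j) = pos (Suc k) (y i) - pos (Suc k) (y j)"
proof -
  define h where "h = chacon_h (Suc k)"
  let ?a = "\<lambda>i. inc (Suc k) (x i)" and ?b = "\<lambda>i. inc (Suc k) (y i)"
  have h1: "h \<ge> 1" unfolding h_def by (rule chacon_h_ge_1)
  have close: "\<bar>(?a i - ?a j) - (?b i - ?b j)\<bar> < h" if "i \<in> J" "j \<in> J" for i j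
  proof -
    have "\<bar>pos (Suc k) (x i) - pos (Suc k) (x j)\<bar> \<le> 3 * chacon_h k" "\<bar>pos (Suc k) (y i) - pos (Suc k) (y j)\<bar> \<le> 3 * chacon_h k"
      using pos_diff_lev x y that by (auto simp: PiE_iff)
    then show ?thesis
      using eq[OF that] chacon_h_ge_1[of k] unfolding h_def pos_Suc[of "Suc k"] by simp
  qed
  have val: "?a i = - h \<or> ?a i = 0 \<or> ?a i = h + 1" "?b i = - h \<or> ?b i = 0 \<or> ?b i = h + 1" if "i \<in> J" for i
    unfolding h_def using inc_cases[OF lev_Suc[OF PiE_mem[OF x that]]] inc_cases[OF lev_Suc[OF PiE_mem[OF y that]]] .
  have *: "spread J (Suc k) u \<Longrightarrow> \<exists>i\<in>J. \<exists>j\<in>J. inc (Suc k) (u i) = - h \<and> inc (Suc k) (u j) = h + 1" for u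
    by (auto simp: spread_def inc_set_def h_def)
  have **: "const_pattern J (Suc k) u \<Longrightarrow> i \<in> J \<Longrightarrow> j \<in> J \<Longrightarrow> inc (Suc k) (u i) = inc (Suc k) (u j)" for u i j
    by (auto simp: const_pattern_def inc_set_def)
  have main: "const_pattern J (Suc k) x \<and> const_pattern J (Suc k) y \<or> (\<forall>i\<in>J. ?a i = ?b i)"
  proof -
    consider "const_pattern J (Suc k) x" "const_pattern J (Suc k) y" | "const_pattern J (Suc k) x" "spread J (Suc k) y"
      | "spread J (Suc k) x" "const_pattern J (Suc k) y" | "spread J (Suc k) x" "spread J (Suc k) y"
      using px py by blast
    then show ?thesis
    proof cases
      case 2
      then obtain i j where ij: "i \<in> J" "j \<in> J" "?b i = - h" "?b j = h + 1" using * by blast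
      have False using close[OF ij(1,2)] **[OF 2(1) ij(1,2)] ij h1 by simp
      then show ?thesis ..
    next
      case 3
      then obtain i j where ij: "i \<in> J" "j \<in> J" "?a i = - h" "?a j = h + 1" using * by blast
      have False using close[OF ij(1,2)] **[OF 3(2) ij(1,2)] ij h1 by simp
      then show ?thesis ..
    next
      case 4
      then obtain i j where ij: "i \<in> J" "j \<in> J" "?a i = - h" "?a j = h + 1" using * by blast
      \<comment> \<open>The difference of the digits at i and j is - (2 h + 1). The nearest other
        difference of two digits, - (h + 1), is off by exactly h, which the strict bound
        \<open>close\<close> excludes. With i as anchor, the same bound then fixes all other
        digits.\<close>
      have b: "?b i = - h" using close[OF ij(1,2)] val(2)[OF ij(1)] val(2)[OF ij(2)] ij h1 by linarith
      have "?a l = ?b l" if l: "l \<in> J" for l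
        using close[OF l ij(1)] val[OF l] ij(3) b h1 by linarith
      then show ?thesis by blast
    qed blast
  qed
  then show "const_pattern J (Suc k) x \<and> const_pattern J (Suc k) y \<or> (\<forall>i\<in>J. inc (Suc k) (x i) = inc (Suc k) (y i))" .
  show "pos (Suc k) (x i) - pos (Suc k) (x j) = pos (Suc k) (y i) - pos (Suc k) (y j)" if "i \<in> J" "j \<in> J" for i j
    using main eq[OF that] **[OF _ that, of x] **[OF _ that, of y] that unfolding pos_Suc[of "Suc k"] by auto
qed

context joining
begin

text \<open>Beyond some level the shift g cancels from all differences of positions, and
  \<open>pattern_rigid\<close> carries the equality of differences down one level at a time. It
  reads the pattern at \<open>Suc k\<close> from points of X_k, whence the bound
  \<open>Suc m\<close>.\<close>

lemma tame_patterns_agree: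
  assumes x: "tame m x" and y: "tame m (pshift J J g x)" and n: "n \<ge> Suc m"
  shows "const_pattern J n x \<and> const_pattern J n (pshift J J g x) \<or> (\<forall>i\<in>J. inc n (x i) = inc n (pshift J J g x i))"
proof -
  let ?y = "pshift J J g x"
  have "\<forall>i. \<exists>N. \<forall>k\<ge>N. pos k (chacon_T g (x i)) = pos k (x i) + g" using T_eventually by blast
  then obtain N where N: "\<And>i k. k \<ge> N i \<Longrightarrow> pos k (chacon_T g (x i)) = pos k (x i) + g" by metis
  define K where "K = Suc (max n (Max (N ` J)))"
  have K: "pos K (?y i) = pos K (x i) + g" if "i \<in> J" for i
  proof -
    have "N i \<le> K" using that fin_J unfolding K_def by (intro le_SucI max.coboundedI2 Max_ge) auto
    then show ?thesis using N that by (simp add: pshift_apply)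
  qed
  have lev: "x \<in> levJ J k" "?y \<in> levJ J k" if "k \<ge> m" for k
    using x y levJ_mono[OF that, of J] unfolding tame_def by blast+
  have pat: "const_pattern J k x \<or> spread J k x" "const_pattern J k ?y \<or> spread J k ?y" if "k \<ge> m" for k
    using x y that unfolding tame_def by blast+
  have "Suc n \<le> K" by (simp add: K_def)
  then have eq: "\<forall>i\<in>J. \<forall>j\<in>J. pos (Suc n) (x i) - pos (Suc n) (x j) = pos (Suc n) (?y i) - pos (Suc n) (?y j)"
  proof (induction rule: inc_induct)
    case base
    then show ?case using K by simp
  next
    case (step l)
    then have l: "l \<ge> Suc m" using n by simp
    then obtain k where k: "l = Suc k" "m \<le> k" by (cases l) auto
    show ?case
      using pattern_rigid(2)[OF lev[OF k(2)]] pat[of l] step.IH k l by auto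
  qed
  obtain k where k: "n = Suc k" "m \<le> k" using n by (cases n) auto
  show ?thesis
    using pattern_rigid(1)[OF lev[OF k(2)]] pat[of n] eq k n by auto
qed

lemma tame_const_eventually:
  assumes m: "\<not> (AE x in \<theta>. \<not> tame m x)"
  shows "\<exists>M\<ge>m. AE x in \<theta>. tame m x \<longrightarrow> (\<forall>n\<ge>M. const_pattern J n x)"
proof -
  have [measurable]: "Measurable.pred \<theta> (const_pattern J n)" for n
    using pattern_measurable[OF fin_J] sets_th measurable_cong_sets by blast
  have one: "\<exists>e. AE x in \<theta>. tame m x \<longrightarrow> (\<forall>i\<in>J. x i \<in> inc_set n (e i))"
    if n: "n \<ge> Suc m" and nc: "\<not> (AE x in \<theta>. tame m x \<longrightarrow> const_pattern J n x)" for n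
  proof -
    let ?B = "\<lambda>e x. tame m x \<and> \<not> const_pattern J n x \<and> (\<forall>i\<in>J. x i \<in> inc_set n (e i))"
    have [measurable]: "Measurable.pred \<theta> (?B e)" for e
    proof -
      have "Measurable.pred (XJ J) (\<lambda>x. \<forall>i\<in>J. x i \<in> inc_set n (e i))"
        by (intro pred_intros_finite fin_J pred_coord inc_set_measurable)
      then have [measurable]: "Measurable.pred \<theta> (\<lambda>x. \<forall>i\<in>J. x i \<in> inc_set n (e i))"
        using sets_th measurable_cong_sets by blast
      show ?thesis by measurable
    qed
    have "\<exists>e\<in>Pi\<^sub>E J (\<lambda>_. chacon_C (Suc n)). \<not> (AE x in \<theta>. \<not> ?B e x)"
    proof (rule ccontr)
      assume "\<not> (\<exists>e\<in>Pi\<^sub>E J (\<lambda>_. chacon_C (Suc n)). \<not> (AE x in \<theta>. \<not> ?B e x))"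
      moreover have "finite (Pi\<^sub>E J (\<lambda>_. chacon_C (Suc n)))"
        using fin_J card_chacon_C by (intro finite_PiE) auto
      ultimately have "AE x in \<theta>. \<forall>e\<in>Pi\<^sub>E J (\<lambda>_. chacon_C (Suc n)). \<not> ?B e x"
        by (intro AE_finite_allI) auto
      then have "AE x in \<theta>. tame m x \<longrightarrow> const_pattern J n x"
      proof eventually_elim
        case (elim x)
        show ?case
        proof (rule impI, rule ccontr)
          assume t: "tame m x" and c: "\<not> const_pattern J n x"
          then have "x \<in> levJ J n" using levJ_mono[of m n J] n unfolding tame_def by auto
          then have "?B (\<lambda>i\<in>J. inc n (x i)) x" "(\<lambda>i\<in>J. inc n (x i)) \<in> Pi\<^sub>E J (\<lambda>_. chacon_C (Suc n))"
            using t c inc_in_C by (auto simp: inc_set_def PiE_iff)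
          then show False using elim by blast
        qed
      qed
      then show False using nc by blast
    qed
    then obtain e where e: "\<not> (AE x in \<theta>. \<not> ?B e x)" by blast
    \<comment> \<open>The orbit saturation of a set of positive measure is invariant, hence conull:
      almost every point has a tame point with the nonconstant pattern e on its orbit.\<close>
    have "(AE x in \<theta>. \<exists>g. ?B e (pshift J J g x)) \<or> (AE x in \<theta>. \<not> (\<exists>g. ?B e (pshift J J g x)))"
    proof (rule AE_invariant)
      show "Measurable.pred \<theta> (\<lambda>x. \<exists>g. ?B e (pshift J J g x))" by measurable
      fix x assume x: "x \<in> space \<theta>"
      show "(\<exists>g. ?B e (pshift J J g (pshift J J 1 x))) \<longleftrightarrow> (\<exists>g. ?B e (pshift J J g x))"
        unfolding pshift_add by (metis diff_add_cancel)
    qed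
    moreover have "\<not> (AE x in \<theta>. \<not> (\<exists>g. ?B e (pshift J J g x)))"
    proof
      assume "AE x in \<theta>. \<not> (\<exists>g. ?B e (pshift J J g x))"
      then have "AE x in \<theta>. \<not> ?B e x"
        using AE_space by eventually_elim (metis pshift_0 space_th)
      then show False using e by blast
    qed
    ultimately have "AE x in \<theta>. \<exists>g. ?B e (pshift J J g x)" by blast
    then have "AE x in \<theta>. tame m x \<longrightarrow> (\<forall>i\<in>J. x i \<in> inc_set n (e i))"
    proof eventually_elim
      case (elim x)
      show ?case
      proof
        assume t: "tame m x"
        obtain g where g: "?B e (pshift J J g x)" using elim by blast
        \<comment> \<open>The alternative of two constant patterns is excluded, since the point on
          the orbit was chosen with a nonconstant one.\<close>
        have "\<forall>i\<in>J. inc n (x i) = inc n (pshift J J g x i)"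
          using tame_patterns_agree[OF t _ n, of g] g by blast
        moreover have "x \<in> levJ J n" using t levJ_mono[of m n J] n unfolding tame_def by auto
        ultimately show "\<forall>i\<in>J. x i \<in> inc_set n (e i)"
          using g by (auto simp: inc_set_def PiE_iff)
      qed
    qed
    then show ?thesis by blast
  qed
  define S where "S = {n. n \<ge> Suc m \<and> \<not> (AE x in \<theta>. tame m x \<longrightarrow> const_pattern J n x)}"
  have "\<exists>e. n \<in> S \<longrightarrow> (AE x in \<theta>. tame m x \<longrightarrow> (\<forall>i\<in>J. x i \<in> inc_set n (e i)))" for n
  proof (cases "n \<in> S")
    case True
    then show ?thesis using one[of n] by (simp add: S_def)
  qed simp
  then have "\<forall>n. \<exists>e. n \<in> S \<longrightarrow> (AE x in \<theta>. tame m x \<longrightarrow> (\<forall>i\<in>J. x i \<in> inc_set n (e i)))" ..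
  from choice[OF this] obtain e where
    e: "\<And>n. n \<in> S \<Longrightarrow> AE x in \<theta>. tame m x \<longrightarrow> (\<forall>i\<in>J. x i \<in> inc_set n (e n i))" by auto
  have "finite S"
  proof (rule ccontr)
    assume "infinite S"
    obtain i where i: "i \<in> J" using ne_J by blast
    \<comment> \<open>For infinite S, a single coordinate of a tame point would have infinitely many
      prescribed digits, a null event for \<mu> and hence for \<theta>.\<close>
    let ?Z = "{z \<in> lev m. \<forall>n\<in>S. z \<in> inc_set n (e n i)}"
    have "emeasure chacon_measure ?Z = 0"
      by (rule inc_prescribed_null[OF \<open>infinite S\<close>]) (auto simp: S_def)
    then have "emeasure \<theta> {x \<in> spJ J. x i \<in> ?Z} = 0"
      by (rule marg[OF i inc_prescribed_sets, THEN iffD2])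
    moreover have "{x \<in> spJ J. x i \<in> ?Z} \<in> sets \<theta>"
      using pred_coord[OF i inc_prescribed_sets[of m S "\<lambda>n. e n i"]] sets_th by (simp add: pred_def space_PiM)
    ultimately have "AE x in \<theta>. x \<notin> {x \<in> spJ J. x i \<in> ?Z}" by (simp only: AE_eq_null)
    moreover have "AE x in \<theta>. \<forall>n\<in>S. tame m x \<longrightarrow> (\<forall>i\<in>J. x i \<in> inc_set n (e n i))"
      using e by (intro AE_ball_countable[THEN iffD2]) auto
    ultimately have "AE x in \<theta>. \<not> tame m x"
      using AE_space
    proof eventually_elim
      case (elim x)
      then show ?case using i by (auto simp: tame_def space_th PiE_iff)
    qed
    then show False using m by blast
  qed
  then obtain M where M: "\<forall>n\<in>S. n < M" using finite_nat_set_iff_bounded[of S] by auto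
  have "AE x in \<theta>. tame m x \<longrightarrow> const_pattern J n x" if "n \<ge> max M (Suc m)" for n
  proof -
    have "n \<notin> S" using M that by force
    then show ?thesis using that by (simp add: S_def)
  qed
  then have "AE x in \<theta>. \<forall>n\<in>{max M (Suc m)..}. tame m x \<longrightarrow> const_pattern J n x"
    by (intro AE_ball_countable[THEN iffD2]) auto
  then have "AE x in \<theta>. tame m x \<longrightarrow> (\<forall>n\<ge>max M (Suc m). const_pattern J n x)"
    by eventually_elim auto
  then show ?thesis by (intro exI[of _ "max M (Suc m)"]) auto
qed

text \<open>The shifts k can be read off as differences of positions once the patterns are constant.
  There are countably many choices of k, so one has positive measure, and being on its graph is an
  invariant condition.\<close>

lemma tame_graph:
  assumes m: "\<not> (AE x in \<theta>. \<not> tame m x)" and i0: "i0 \<in> J"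
  shows "\<exists>k. AE x in \<theta>. \<forall>i\<in>J. x i = chacon_T (k i) (x i0)"
proof -
  obtain M where M: "M \<ge> m" "AE x in \<theta>. tame m x \<longrightarrow> (\<forall>n\<ge>M. const_pattern J n x)"
    using tame_const_eventually[OF m] by blast
  let ?G = "\<lambda>k x. \<forall>i\<in>J. x i = chacon_T (k i) (x i0)"
  have level_alg: "Measurable.pred \<theta> (?G k)" for k
  proof -
    have "Measurable.pred (XJ J) (?G k)"
    proof (intro pred_intros_finite fin_J pred_chacon_eq)
      fix i assume "i \<in> J"
      then show "(\<lambda>x. x i) \<in> borel_measurable (XJ J)" by measurable
      show "(\<lambda>x. chacon_T (k i) (x i0)) \<in> borel_measurable (XJ J)"
        using i0 by (intro measurable_compose[OF _ T_measurable]) measurable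
    qed
    then show ?thesis using sets_th measurable_cong_sets by blast
  qed
  have "\<exists>k\<in>Pi\<^sub>E J (\<lambda>_. UNIV). \<not> (AE x in \<theta>. \<not> ?G k x)"
  proof (rule ccontr)
    assume "\<not> (\<exists>k\<in>Pi\<^sub>E J (\<lambda>_. UNIV). \<not> (AE x in \<theta>. \<not> ?G k x))"
    moreover have "countable (Pi\<^sub>E J (\<lambda>_. UNIV :: int set))" using fin_J by (intro countable_PiE) auto
    ultimately have "AE x in \<theta>. \<forall>k\<in>Pi\<^sub>E J (\<lambda>_. UNIV). \<not> ?G k x" by (subst AE_ball_countable) auto
    with M(2) have "AE x in \<theta>. \<not> tame m x"
    proof eventually_elim
      case (elim x)
      show ?case
      proof
        assume t: "tame m x"
        define k where "k = (\<lambda>i\<in>J. pos M (x i) - pos M (x i0))"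
        have l: "x i \<in> lev M" if "i \<in> J" for i using t levJ_mono[OF M(1), of J] that unfolding tame_def by blast
        have "x i = chacon_T (k i) (x i0)" if "i \<in> J" for i
        proof -
          have "inc n (x i0) = inc n (x i)" if "M \<le> n" for n
          proof -
            have "const_pattern J n x" using elim(1) t that by blast
            then show ?thesis using \<open>i \<in> J\<close> i0 by (auto simp: const_pattern_def inc_set_def)
          qed
          then show ?thesis using T_eqI[OF l[OF i0] l[OF that]] that by (simp add: k_def)
        qed
        moreover have "k \<in> Pi\<^sub>E J (\<lambda>_. UNIV)" by (simp add: k_def)
        ultimately show False using elim(2) by blast
      qed
    qed
    then show False using m by blast
  qed
  then obtain k where k: "\<not> (AE x in \<theta>. \<not> ?G k x)" by blast
  have "(AE x in \<theta>. ?G k x) \<or> (AE x in \<theta>. \<not> ?G k x)"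
  proof (rule AE_invariant[OF level_alg])
    fix x assume "x \<in> space \<theta>"
    have "chacon_T 1 (x i) = chacon_T (k i) (chacon_T 1 (x i0)) \<longleftrightarrow> x i = chacon_T (k i) (x i0)" for i
      by (metis T_add T_uminus(1) add.commute)
    then show "?G k (pshift J J 1 x) \<longleftrightarrow> ?G k x" using i0 by (simp add: pshift_apply)
  qed
  then show ?thesis using k by blast
qed

text \<open>On a graph one coordinate determines the others, so its marginal is finite on X_0, and
  uniqueness of the invariant measure applies to it.\<close>

lemma graph_measure:
  assumes i0: "i0 \<in> J" and k: "AE x in \<theta>. \<forall>i\<in>J. x i = chacon_T (k i) (x i0)"
  obtains c where "0 < c" "c < \<infinity>"
    "\<And>A. A \<in> sets (XJ J) \<Longrightarrow> emeasure \<theta> A = c * emeasure chacon_measure {z. (\<lambda>i\<in>J. chacon_T (k i) z) \<in> A}"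
proof -
  have pr: "(\<lambda>x. x i0) \<in> measurable \<theta> borel"
    using measurable_component_singleton[OF i0, of "\<lambda>_. borel"] sets_th measurable_cong_sets by blast
  define \<nu> where "\<nu> = distr \<theta> borel (\<lambda>x. x i0)"
  have nu: "emeasure \<nu> B = emeasure \<theta> {x \<in> spJ J. x i0 \<in> B}" if "B \<in> sets borel" for B
    unfolding \<nu>_def using that pr by (simp add: emeasure_distr space_th vimage_def Int_def conj_commute)
  have nu_fin: "emeasure \<nu> (lev 0) < \<infinity>"
  proof -
    \<comment> \<open>The shifts k are bounded by h_N, so all coordinates lie in X_(N+1) as soon as
      the one at i0 lies in X_0.\<close>
    define N where "N = Max (insert 0 ((\<lambda>i. nat \<bar>k i\<bar>) ` J))"
    have "\<bar>k i\<bar> \<le> chacon_h N" if "i \<in> J" for i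
    proof -
      have "nat \<bar>k i\<bar> \<le> N" using fin_J that unfolding N_def by (intro Max_ge) auto
      then show ?thesis using chacon_h_ge[of N] by linarith
    qed
    note kN = this
    have "emeasure \<nu> (lev 0) = emeasure \<theta> {x \<in> spJ J. x i0 \<in> lev 0}" by (rule nu) simp
    also have "\<dots> \<le> emeasure \<theta> (levJ J (Suc N))"
    proof (rule emeasure_mono_AE)
      show "AE x in \<theta>. x \<in> {x \<in> spJ J. x i0 \<in> lev 0} \<longrightarrow> x \<in> levJ J (Suc N)"
        using k
      proof eventually_elim
        case (elim x)
        have "x i \<in> lev (Suc N)" if "x i0 \<in> lev 0" "i \<in> J" for i
          using T_in_lev_Suc[OF lev_le[OF that(1)] kN[OF that(2)]] elim that(2) by auto
        then show ?case by (auto simp: PiE_iff)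
      qed
      show "levJ J (Suc N) \<in> sets \<theta>" using levJ_measurable[OF fin_J] sets_th by simp
    qed
    also have "\<dots> < \<infinity>" by (rule fin_th)
    finally show "emeasure \<nu> (lev 0) < \<infinity>" .
  qed
  have "\<nu> = scale_measure (emeasure \<nu> (lev 0)) chacon_measure"
  proof (rule invariant_measure_unique)
    fix g and B :: "chacon set" assume B: "B \<in> sets borel"
    have TB: "chacon_T g -` B \<in> sets borel" using measurable_sets[OF T_measurable B, of g] by simp
    have S: "{x \<in> spJ J. x i0 \<in> B} \<in> sets \<theta>"
      using measurable_sets[OF pr B] by (simp add: space_th vimage_def Int_def conj_commute)
    have "{x \<in> spJ J. x i0 \<in> chacon_T g -` B} = pshift J J g -` {x \<in> spJ J. x i0 \<in> B} \<inter> space \<theta>"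
      using i0 by (auto simp: space_th pshift_apply)
    then show "emeasure \<nu> (chacon_T g -` B) = emeasure \<nu> B"
      using inv[OF S, of g] nu[OF B] nu[OF TB] by simp
  qed (use nu_fin in \<open>auto simp: \<nu>_def\<close>)
  then have nuc: "emeasure \<nu> B = emeasure \<nu> (lev 0) * emeasure chacon_measure B" for B
    by (metis emeasure_scale_measure)
  define \<gamma> where "\<gamma> z = (\<lambda>i\<in>J. chacon_T (k i) z)" for z
  have gm: "\<gamma> \<in> measurable borel (XJ J)"
    unfolding \<gamma>_def[abs_def] by (rule measurable_restrict) simp
  show thesis
  proof (rule that[of "emeasure \<nu> (lev 0)"])
    show "emeasure \<nu> (lev 0) < \<infinity>" by fact
    show "0 < emeasure \<nu> (lev 0)"
    proof (rule ccontr)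
      assume "\<not> 0 < emeasure \<nu> (lev 0)"
      then have "emeasure \<nu> UNIV = 0" using nuc[of UNIV] by simp
      then show False using nu[of UNIV] nonzero by simp
    qed
    fix A assume A: "A \<in> sets (XJ J)"
    have gA: "\<gamma> -` A \<in> sets borel" using measurable_sets[OF gm A] by simp
    have S: "{x \<in> spJ J. x i0 \<in> \<gamma> -` A} \<in> sets \<theta>"
      using measurable_sets[OF pr gA] by (simp add: space_th vimage_def Int_def conj_commute)
    have "emeasure \<theta> A = emeasure \<theta> {x \<in> spJ J. x i0 \<in> \<gamma> -` A}"
    proof (rule emeasure_eq_AE)
      show "AE x in \<theta>. x \<in> A \<longleftrightarrow> x \<in> {x \<in> spJ J. x i0 \<in> \<gamma> -` A}"
        using k AE_space
      proof eventually_elim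
        case (elim x)
        then have "\<gamma> (x i0) = x" by (auto simp: \<gamma>_def fun_eq_iff space_th PiE_iff extensional_def)
        then show ?case using elim(2) by (simp add: space_th)
      qed
    qed (use A S sets_th in auto)
    also have "\<dots> = emeasure \<nu> (\<gamma> -` A)" using nu[OF gA] by simp
    finally show "emeasure \<theta> A = emeasure \<nu> (lev 0) * emeasure chacon_measure {z. (\<lambda>i\<in>J. chacon_T (k i) z) \<in> A}"
      using nuc[of "\<gamma> -` A"] by (simp add: \<gamma>_def vimage_def)
  qed
qed

end

section \<open>Adjacent patterns: partial shifts\<close>

definition lbox :: "nat set \<Rightarrow> nat \<Rightarrow> (nat \<Rightarrow> int) \<Rightarrow> (nat \<Rightarrow> chacon) set" where
  "lbox J n f = {x \<in> spJ J. \<forall>i\<in>J. x i \<in> cyl n (f i)}"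

lemma lbox_sets: "finite J \<Longrightarrow> lbox J n f \<in> sets (XJ J)"
proof -
  assume "finite J"
  then have "Measurable.pred (XJ J) (\<lambda>x. \<forall>i\<in>J. x i \<in> cyl n (f i))"
    by (intro pred_intros_finite pred_coord cyl_measurable)
  then show ?thesis by (simp add: lbox_def pred_def space_PiM)
qed

lemma vimage_pshift_lbox:
  assumes "\<And>i. i \<in> J \<Longrightarrow> f i \<in> chacon_F n" "\<And>i. i \<in> J \<Longrightarrow> i \<in> I \<Longrightarrow> f i - g \<in> chacon_F n"
  shows "pshift J I g -` lbox J n f \<inter> spJ J = lbox J n (\<lambda>i. if i \<in> I then f i - g else f i)"
proof -
  have "chacon_T g z \<in> cyl n (f i) \<longleftrightarrow> z \<in> cyl n (f i - g)" if "i \<in> J" "i \<in> I" for i z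
    using vimage_T_cyl[of "f i - g" n g] assms(1)[OF that(1)] assms(2)[OF that] by auto
  then show ?thesis by (auto simp: lbox_def pshift_apply)
qed

text \<open>The hypothesis on e makes the position at n+1 after the shift equal to that of
  \<open>chacon_T (- s) x\<close> at n plus the digit e. As this splitting is unique, the image has
  below n the positions of \<open>chacon_T (- s) x\<close>, and e is its new digit.\<close>

lemma shift_digit:
  assumes mn: "m \<le> n" and x: "x \<in> lev m" and f: "pos m x - s \<in> chacon_F m"
    and g: "\<bar>g\<bar> \<le> chacon_h n" and e: "inc n x + g = e - s" "e \<in> chacon_C (Suc n)"
  defines "y \<equiv> chacon_T g x"
  shows "y \<in> lev m" "pos m y = pos m x - s" "inc n y = e" "\<And>k. m \<le> k \<Longrightarrow> k < n \<Longrightarrow> inc k y = inc k x"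
proof -
  define z where "z = chacon_T (- s) x"
  have z: "z \<in> lev m" "\<And>k. m \<le> k \<Longrightarrow> pos k z = pos k x - s"
    using T_in_lev[OF x, of "- s"] pos_T[OF x, of "- s"] f by (auto simp: z_def)
  have xn: "x \<in> lev n" "z \<in> lev n" using lev_le[OF _ mn] x z by auto
  have y: "y \<in> lev (Suc n)" "pos (Suc n) y = pos n z + e"
    using T_in_lev_Suc[OF xn(1) g] pos_T_Suc[OF xn(1) g] e(1) z(2)[OF mn] by (auto simp: y_def pos_Suc)
  note d = lev_Suc_decompose[OF y pos_in_F[OF xn(2)] e(2)]
  note a = lev_agree[OF mn d(1) z(1) d(2)]
  show "y \<in> lev m" using a by blast
  show "pos m y = pos m x - s" using a mn z(2)[of m] by auto
  show "inc n y = e" by (rule d(3))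
  show "inc k y = inc k x" if "m \<le> k" "k < n" for k
    using a that z(2)[of k] z(2)[of "Suc k"] unfolding inc_def by auto
qed

definition adj :: "nat set \<Rightarrow> nat set \<Rightarrow> nat \<Rightarrow> (nat \<Rightarrow> chacon) \<Rightarrow> bool" where
  "adj J I n x \<longleftrightarrow> adj0 J I n x \<or> adj1 J I n x"

definition first_adj :: "nat set \<Rightarrow> nat set \<Rightarrow> nat \<Rightarrow> nat \<Rightarrow> (nat \<Rightarrow> chacon) \<Rightarrow> bool" where
  "first_adj J I m n x \<longleftrightarrow> m \<le> n \<and> adj J I n x \<and> (\<forall>k\<in>{m..<n}. \<not> adj J I k x)"

text \<open>At the first time \<open>n\<close> at which the pattern on \<open>I\<close> and on \<open>J - I\<close> is adjacent, the power
  \<open>\<plusminus> h\<^sub>n\<close> of the diagonal action moves the block on \<open>I\<close> across the spacer, i.e. it acts on the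
  coordinates up to \<open>n\<close> as the partial shift by \<open>\<mp> 1\<close> on \<open>I\<close>.\<close>

lemma shift_first_adj:
  assumes x: "x \<in> lbox J m f" and fa: "first_adj J I m n x"
    and f: "\<And>i. i \<in> J \<Longrightarrow> i \<in> I \<Longrightarrow> f i - s \<in> chacon_F m"
    and s: "s = 1 \<and> adj0 J I n x \<and> g = chacon_h n \<or> s = -1 \<and> adj1 J I n x \<and> g = - chacon_h n"
  shows "pshift J J g x \<in> lbox J m (\<lambda>i. if i \<in> I then f i - s else f i) \<and> first_adj J I m n (pshift J J g x)"
proof -
  let ?y = "pshift J J g x"
  \<comment> \<open>These are the digits after the shift. Off I the shift by h_n moves - h_n exactly
    to 0, while on I it falls one short of moving 0 to h_n + 1; this deficit is s. For s = -1
    everything is reversed.\<close>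
  let ?e = "\<lambda>i. if s = 1 then (if i \<in> I then chacon_h n + 1 else 0) else (if i \<in> I then 0 else - chacon_h n)"
  have mn: "m \<le> n" using fa by (simp add: first_adj_def)
  have "?y i \<in> lev m \<and> pos m (?y i) = pos m (x i) - (if i \<in> I then s else 0) \<and> inc n (?y i) = ?e i \<and>
     (\<forall>k. m \<le> k \<longrightarrow> k < n \<longrightarrow> inc k (?y i) = inc k (x i))" if i: "i \<in> J" for i
  proof -
    have xi: "x i \<in> lev m" "pos m (x i) = f i" using x i by (auto simp: lbox_def cyl_def)
    have c: "inc n (x i) + g = ?e i - (if i \<in> I then s else 0)"
      using s i by (auto simp: adj0_def adj1_def inc_set_def)
    have "pos m (x i) - (if i \<in> I then s else 0) \<in> chacon_F m"
      using f[OF i] xi pos_in_F[OF xi(1)] by auto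
    moreover have "\<bar>g\<bar> \<le> chacon_h n" using s chacon_h_ge_1[of n] by auto
    moreover have "?e i \<in> chacon_C (Suc n)" by (auto simp: mem_chacon_C)
    ultimately show ?thesis
      using shift_digit[OF mn xi(1) _ _ c] i by (simp add: pshift_apply)
  qed
  note y = this
  have ylev: "?y i \<in> lev k" "x i \<in> lev k" if "i \<in> J" "m \<le> k" for i k
    using y[OF that(1)] lev_le[OF _ that(2)] x that by (auto simp: lbox_def cyl_def)
  have yb: "?y \<in> lbox J m (\<lambda>i. if i \<in> I then f i - s else f i)"
    using y x by (auto simp: lbox_def cyl_def)
  have same: "?y i \<in> inc_set k c \<longleftrightarrow> x i \<in> inc_set k c" if "i \<in> J" "m \<le> k" "k < n" for i k c
    using y[OF that(1)] ylev[OF that(1,2)] that by (auto simp: inc_set_def)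
  \<comment> \<open>The digits before n do not change, so n is also the first adjacent time of the
    image; images belonging to different n will therefore be disjoint.\<close>
  have adj_eq: "adj J I k ?y \<longleftrightarrow> adj J I k x" if "m \<le> k" "k < n" for k
    unfolding adj_def adj0_def adj1_def using same[OF _ that] by simp
  have D: "?y i \<in> inc_set n (?e i)" if "i \<in> J" for i
    using y[OF that] ylev[OF that mn] by (simp add: inc_set_def)
  have adjn: "adj J I n ?y"
  proof (cases "s = 1")
    case True
    then have "adj1 J I n ?y" unfolding adj1_def using D by simp
    then show ?thesis by (simp add: adj_def)
  next
    case False
    then have "adj0 J I n ?y" unfolding adj0_def using D by simp
    then show ?thesis by (simp add: adj_def)
  qed
  have "first_adj J I m n ?y"
    using fa adjn adj_eq unfolding first_adj_def by simp
  with yb show ?thesis ..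
qed

lemma generate_XJ:
  assumes J: "finite J" and G: "G \<subseteq> sets (XJ J)"
    and gen: "\<And>i C. i \<in> J \<Longrightarrow> C \<in> cyls \<Longrightarrow> {x \<in> spJ J. x i \<in> C} \<in> sigma_sets (spJ J) G"
  shows "sets (XJ J) = sigma_sets (spJ J) G"
proof
  have GP: "G \<subseteq> Pow (spJ J)" using subset_trans[OF G sets.space_closed] by (simp add: space_PiM)
  show "sigma_sets (spJ J) G \<subseteq> sets (XJ J)"
    using sets.sigma_sets_subset[OF G] by (simp add: space_PiM)
  have "sets (XJ J) \<subseteq> sets (sigma (spJ J) G)"
  proof (rule sets_PiM_in_sets)
    fix i and A :: "chacon set" assume i: "i \<in> J" "A \<in> sets borel"
    have "(\<lambda>x. x i) \<in> measurable (sigma (spJ J) G) borel"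
      by (rule measurable_cylsI) (use gen[OF i(1)] GP in \<open>simp add: space_measure_of vimage_def Int_def conj_commute\<close>)
    from measurable_sets[OF this i(2)] show "{x \<in> space (sigma (spJ J) G). x i \<in> A} \<in> sets (sigma (spJ J) G)"
      by (simp add: vimage_def Int_def conj_commute)
  qed (simp add: space_measure_of[OF GP])
  then show "sets (XJ J) \<subseteq> sigma_sets (spJ J) G" by (simp add: GP)
qed

text \<open>Only the trace on \<open>levJ J m\<close> has to be decided by the positions at one
  level; off this set V is any measurable set. That makes the family an algebra on the whole power.
  The bound \<open>Suc m\<close> leaves room for shifts by 1 and -1.\<close>

definition level_alg :: "nat set \<Rightarrow> nat \<Rightarrow> (nat \<Rightarrow> chacon) set set" where
  "level_alg J m = {V \<in> sets (XJ J). \<exists>n\<ge>Suc m. \<forall>x\<in>levJ J m. \<forall>y\<in>levJ J m.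
     (\<forall>i\<in>J. pos n (x i) = pos n (y i)) \<longrightarrow> (x \<in> V \<longleftrightarrow> y \<in> V)}"

lemma level_algI:
  assumes "V \<in> sets (XJ J)" "Suc m \<le> n"
    "\<And>x y. x \<in> levJ J m \<Longrightarrow> y \<in> levJ J m \<Longrightarrow> \<forall>i\<in>J. pos n (x i) = pos n (y i) \<Longrightarrow> x \<in> V \<longleftrightarrow> y \<in> V"
  shows "V \<in> level_alg J m"
  unfolding level_alg_def
proof (intro CollectI conjI exI[of _ n] assms(1,2))
  show "\<forall>x\<in>levJ J m. \<forall>y\<in>levJ J m. (\<forall>i\<in>J. pos n (x i) = pos n (y i)) \<longrightarrow> (x \<in> V \<longleftrightarrow> y \<in> V)"
  proof (intro ballI[of "levJ J m"] impI)
    fix x y assume "x \<in> levJ J m" "y \<in> levJ J m" "\<forall>i\<in>J. pos n (x i) = pos n (y i)"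
    then show "x \<in> V \<longleftrightarrow> y \<in> V" by (rule assms(3))
  qed
qed

lemma level_algE:
  assumes "V \<in> level_alg J m"
  obtains n where "V \<in> sets (XJ J)" "Suc m \<le> n"
    "\<And>x y. x \<in> levJ J m \<Longrightarrow> y \<in> levJ J m \<Longrightarrow> \<forall>i\<in>J. pos n (x i) = pos n (y i) \<Longrightarrow> x \<in> V \<longleftrightarrow> y \<in> V"
proof -
  from assms obtain n where "V \<in> sets (XJ J)" "n \<ge> Suc m" "\<forall>x\<in>levJ J m. \<forall>y\<in>levJ J m.
     (\<forall>i\<in>J. pos n (x i) = pos n (y i)) \<longrightarrow> (x \<in> V \<longleftrightarrow> y \<in> V)" unfolding level_alg_def by (elim CollectE conjE exE)
  note n = this
  show ?thesis
  proof (rule that[OF n(1,2)])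
    fix x y assume a: "x \<in> levJ J m" "y \<in> levJ J m" "\<forall>i\<in>J. pos n (x i) = pos n (y i)"
    show "x \<in> V \<longleftrightarrow> y \<in> V" by (rule n(3)[THEN bspec, OF a(1), THEN bspec, OF a(2), THEN mp, OF a(3)])
  qed
qed

lemma level_alg_sets: "V \<in> level_alg J m \<Longrightarrow> V \<in> sets (XJ J)"
  by (simp add: level_alg_def)

lemma lev_agree_levJ:
  assumes "m \<le> n" "n \<le> n'" "x \<in> levJ J m" "y \<in> levJ J m" "\<forall>i\<in>J. pos n' (x i) = pos n' (y i)"
  shows "\<forall>i\<in>J. pos n (x i) = pos n (y i)"
proof
  fix i assume i: "i \<in> J"
  then have "x i \<in> lev m" "y i \<in> lev m" "pos n' (x i) = pos n' (y i)" using assms by auto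
  then show "pos n (x i) = pos n (y i)"
    using lev_agree[of m n' "x i" "y i"] lev_le[of "x i" m n'] assms(1,2) by auto
qed

lemma algebra_level_alg: "algebra (spJ J) (level_alg J m)"
  unfolding algebra_iff_Un
proof (intro conjI ballI)
  show "level_alg J m \<subseteq> Pow (spJ J)"
  proof -
    have "level_alg J m \<subseteq> sets (XJ J)" by (auto simp: level_alg_def)
    from subset_trans[OF this sets.space_closed] show ?thesis by (simp add: space_PiM)
  qed
  show "{} \<in> level_alg J m" by (rule level_algI[of _ _ _ "Suc m"]) auto
  show "spJ J - V \<in> level_alg J m" if VG: "V \<in> level_alg J m" for V
  proof (rule level_algE[OF VG], rule level_algI)
    show "spJ J - V \<in> sets (XJ J)" using sets.compl_sets[OF level_alg_sets[OF VG]] by (simp add: space_PiM)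
    have sub: "x \<in> spJ J" if "x \<in> levJ J m" for x using that by (auto simp: PiE_iff)
    fix n x y assume "\<And>x y. x \<in> levJ J m \<Longrightarrow> y \<in> levJ J m \<Longrightarrow> \<forall>i\<in>J. pos n (x i) = pos n (y i) \<Longrightarrow> x \<in> V \<longleftrightarrow> y \<in> V"
      and xy: "x \<in> levJ J m" "y \<in> levJ J m" "\<forall>i\<in>J. pos n (x i) = pos n (y i)"
    from this(1)[OF xy] show "x \<in> spJ J - V \<longleftrightarrow> y \<in> spJ J - V" using sub[OF xy(1)] sub[OF xy(2)] by simp
  qed
  show "V \<union> W \<in> level_alg J m" if VG: "V \<in> level_alg J m" and WG: "W \<in> level_alg J m" for V W
  proof -
    obtain n where V: "V \<in> sets (XJ J)" "Suc m \<le> n"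
      "\<And>x y. x \<in> levJ J m \<Longrightarrow> y \<in> levJ J m \<Longrightarrow> \<forall>i\<in>J. pos n (x i) = pos n (y i) \<Longrightarrow> x \<in> V \<longleftrightarrow> y \<in> V"
      by (rule level_algE[OF VG]) (rule that; assumption)
    obtain n' where W: "W \<in> sets (XJ J)" "Suc m \<le> n'"
      "\<And>x y. x \<in> levJ J m \<Longrightarrow> y \<in> levJ J m \<Longrightarrow> \<forall>i\<in>J. pos n' (x i) = pos n' (y i) \<Longrightarrow> x \<in> W \<longleftrightarrow> y \<in> W"
      by (rule level_algE[OF WG]) (rule that; assumption)
    show ?thesis
    proof (rule level_algI[of _ _ _ "max n n'"])
      show "V \<union> W \<in> sets (XJ J)" using V(1) W(1) by (rule sets.Un)
      show "Suc m \<le> max n n'" using V(2) by simp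
      fix x y assume xy: "x \<in> levJ J m" "y \<in> levJ J m" "\<forall>i\<in>J. pos (max n n') (x i) = pos (max n n') (y i)"
      have "\<forall>i\<in>J. pos n (x i) = pos n (y i)" "\<forall>i\<in>J. pos n' (x i) = pos n' (y i)"
        using lev_agree_levJ[OF _ _ xy] V(2) W(2) by auto
      then show "x \<in> V \<union> W \<longleftrightarrow> y \<in> V \<union> W" using V(3)[OF xy(1,2)] W(3)[OF xy(1,2)] by simp
    qed
  qed
qed

lemma sets_level_alg:
  assumes J: "finite J"
  shows "sets (XJ J) = sigma_sets (spJ J) (level_alg J m)"
proof (rule generate_XJ[OF J])
  show "level_alg J m \<subseteq> sets (XJ J)" by (auto simp: level_alg_def)
  fix i C assume i: "i \<in> J" and "C \<in> cyls"
  then consider "C = {}" | n f where "C = cyl n f" by (auto simp: cyls_def)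
  then have "{x \<in> spJ J. x i \<in> C} \<in> level_alg J m"
  proof cases
    case 1
    then show ?thesis by (intro level_algI[of _ _ _ "Suc m"]) auto
  next
    case (2 n f)
    have a: "{x \<in> spJ J. x i \<in> C} \<in> sets (XJ J)"
      using pred_coord[OF i, of C] 2 by (simp add: pred_def space_PiM)
    have "x i \<in> C \<longleftrightarrow> y i \<in> C"
      if "x \<in> levJ J m" "y \<in> levJ J m" "\<forall>i\<in>J. pos (max n (Suc m)) (x i) = pos (max n (Suc m)) (y i)" for x y
    proof -
      have *: "w \<in> C" if "z \<in> C" "z \<in> lev m" "w \<in> lev m" "pos (max n (Suc m)) w = pos (max n (Suc m)) z" for w z
        using lev_agree[of n "max n (Suc m)" w z] that lev_le[of w m "max n (Suc m)"] unfolding 2 cyl_def by auto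
      have "x i \<in> lev m" "y i \<in> lev m" using that i by auto
      then show ?thesis using * that(3) i by metis
    qed
    note b = this
    show ?thesis
    proof (rule level_algI[OF a max.cobounded2])
      fix x y assume xy: "x \<in> levJ J m" "y \<in> levJ J m" "\<forall>i\<in>J. pos (max n (Suc m)) (x i) = pos (max n (Suc m)) (y i)"
      have "x \<in> spJ J" "y \<in> spJ J" using xy(1,2) by (auto simp: PiE_iff)
      then show "x \<in> {x \<in> spJ J. x i \<in> C} \<longleftrightarrow> y \<in> {x \<in> spJ J. x i \<in> C}" using b[OF xy] by simp
    qed
  qed
  then show "{x \<in> spJ J. x i \<in> C} \<in> sigma_sets (spJ J) (level_alg J m)" by (rule sigma_sets.Basic)
qed

text \<open>The boxes are given by the positions at n of points of X_m with m < n, and such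
  positions keep a margin to the ends of F_n.\<close>

lemma level_alg_decompose:
  assumes J: "finite J" and V: "V \<in> level_alg J m"
  obtains n Fs where "finite Fs" "V \<inter> levJ J m = (\<Union>f\<in>Fs. lbox J n f)" "disjoint_family_on (lbox J n) Fs"
    "\<And>f i. f \<in> Fs \<Longrightarrow> i \<in> J \<Longrightarrow> f i \<in> chacon_F n \<and> f i - 1 \<in> chacon_F n \<and> f i + 1 \<in> chacon_F n"
proof -
  obtain n where n: "Suc m \<le> n" "\<And>x y. x \<in> levJ J m \<Longrightarrow> y \<in> levJ J m \<Longrightarrow>
      \<forall>i\<in>J. pos n (x i) = pos n (y i) \<Longrightarrow> x \<in> V \<longleftrightarrow> y \<in> V"
    by (rule level_algE[OF V]) (rule that; assumption)
  have mn: "m \<le> n" using n(1) by simp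
  define Fs where "Fs = (\<lambda>x. \<lambda>i\<in>J. pos n (x i)) ` (V \<inter> levJ J m)"
  have "Fs \<subseteq> Pi\<^sub>E J (\<lambda>_. chacon_F n)"
  proof (unfold Fs_def, intro image_subsetI PiE_I)
    fix x i assume x: "x \<in> V \<inter> levJ J m" and i: "i \<in> J"
    then have "x i \<in> lev n" using lev_le[OF _ mn] by auto
    then show "(\<lambda>i\<in>J. pos n (x i)) i \<in> chacon_F n" using i pos_in_F by simp
  qed simp
  then have "finite Fs" by (rule finite_subset) (intro finite_PiE J finite_chacon_F)
  moreover have "V \<inter> levJ J m = (\<Union>f\<in>Fs. lbox J n f)"
  proof (intro equalityI subsetI)
    fix x assume x: "x \<in> V \<inter> levJ J m"
    then have "x \<in> lbox J n (\<lambda>i\<in>J. pos n (x i))"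
      using lev_le[OF _ mn] by (auto simp: lbox_def cyl_def PiE_iff)
    then show "x \<in> (\<Union>f\<in>Fs. lbox J n f)" using x unfolding Fs_def by blast
  next
    fix y assume "y \<in> (\<Union>f\<in>Fs. lbox J n f)"
    then obtain x where x: "x \<in> V" "x \<in> levJ J m" and y: "y \<in> lbox J n (\<lambda>i\<in>J. pos n (x i))"
      unfolding Fs_def by blast
    have "y i \<in> lev m" "pos n (y i) = pos n (x i)" if "i \<in> J" for i
      using lev_agree[OF mn, of "y i" "x i"] y x that by (auto simp: lbox_def cyl_def)
    then have "y \<in> levJ J m" "\<forall>i\<in>J. pos n (x i) = pos n (y i)" using y by (auto simp: lbox_def PiE_iff)
    then show "y \<in> V \<inter> levJ J m" using n(2)[OF x(2)] x(1) by blast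
  qed
  moreover have "disjoint_family_on (lbox J n) Fs"
  proof (unfold disjoint_family_on_def, intro ballI impI)
    fix f g assume "f \<in> Fs" "g \<in> Fs" "f \<noteq> g"
    then obtain i where "i \<in> J" "f i \<noteq> g i" unfolding Fs_def by (auto simp: restrict_def fun_eq_iff split: if_splits)
    then show "lbox J n f \<inter> lbox J n g = {}" by (auto simp: lbox_def cyl_def)
  qed
  moreover have "f i \<in> chacon_F n \<and> f i - 1 \<in> chacon_F n \<and> f i + 1 \<in> chacon_F n" if fi: "f \<in> Fs" "i \<in> J" for f i
  proof -
    obtain x where x: "x \<in> levJ J m" "f i = pos n (x i)" using fi by (auto simp: Fs_def)
    obtain l where l: "n = Suc l" "m \<le> l" using n(1) by (cases n) auto
    have xl: "x i \<in> lev l" using x(1) fi lev_le[OF _ l(2)] by auto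
    show ?thesis
      using pos_Suc_margin[OF xl, of 0] pos_Suc_margin[OF xl, of 1] pos_Suc_margin[OF xl, of "-1"]
        chacon_h_ge_1[of l] x(2) l(1) by simp
  qed
  ultimately show ?thesis using that by blast
qed

section \<open>The two-sided inequality for the partial shift\<close>

context joining
begin

lemma pshift_measurable_th[measurable]: "pshift J I g \<in> measurable \<theta> \<theta>"
  using pshift_measurable sets_th measurable_cong_sets by blast

lemma vimage_pshift_sets: "A \<in> sets (XJ J) \<Longrightarrow> pshift J I g -` A \<inter> spJ J \<in> sets (XJ J)"
  using measurable_sets[OF pshift_measurable, of A J I g] by (simp add: space_PiM)

lemma inv_tau: "A \<in> sets (XJ J) \<Longrightarrow> emeasure \<theta> (pshift J J g -` A \<inter> spJ J) = emeasure \<theta> A"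
  using inv[of A g] by (simp add: sets_th space_th)

lemma vimage_levJ_finite: "\<bar>g\<bar> \<le> chacon_h m \<Longrightarrow> emeasure \<theta> (pshift J I' g -` levJ J m \<inter> spJ J) < \<infinity>"
proof -
  assume g: "\<bar>g\<bar> \<le> chacon_h m"
  have "pshift J I' g -` levJ J m \<inter> spJ J \<subseteq> levJ J (Suc m)"
  proof
    fix x assume x: "x \<in> pshift J I' g -` levJ J m \<inter> spJ J"
    then have "pshift J I' (- g) (pshift J I' g x) \<in> levJ J (Suc m)" using g by (intro pshift_levJ) auto
    then show "x \<in> levJ J (Suc m)" using x by (simp add: pshift_inverse)
  qed
  then have "emeasure \<theta> (pshift J I' g -` levJ J m \<inter> spJ J) \<le> emeasure \<theta> (levJ J (Suc m))"
    by (rule emeasure_mono) (use levJ_measurable[OF fin_J] sets_th in simp)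
  then show ?thesis using fin_th[of "Suc m"] by (rule le_less_trans)
qed

context
  fixes I assumes I: "I \<noteq> {}" "I \<subset> J" and freq: "AE x in \<theta>. freq_adj I x"
begin

lemma first_adj_sets: "{x \<in> lbox J m f. first_adj J I m n x} \<in> sets (XJ J)"
  "{x \<in> lbox J m f. first_adj J I m n x \<and> adj0 J I n x} \<in> sets (XJ J)"
  "{x \<in> lbox J m f. first_adj J I m n x \<and> adj1 J I n x} \<in> sets (XJ J)"
proof -
  have l: "Measurable.pred (XJ J) (\<lambda>x. x \<in> lbox J m f)"
    using lbox_sets[OF fin_J, of m f] by simp
  note [measurable] = l pattern_measurable(1,2)[OF fin_J]
  have [measurable]: "Measurable.pred (XJ J) (first_adj J I m n)"
    unfolding first_adj_def[abs_def] adj_def[abs_def] by measurable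
  have *: "{x \<in> lbox J m f. Q x} = {x \<in> space (XJ J). x \<in> lbox J m f \<and> Q x}" for Q
    by (auto simp: lbox_def space_PiM)
  show "{x \<in> lbox J m f. first_adj J I m n x} \<in> sets (XJ J)"
    "{x \<in> lbox J m f. first_adj J I m n x \<and> adj0 J I n x} \<in> sets (XJ J)"
    "{x \<in> lbox J m f. first_adj J I m n x \<and> adj1 J I n x} \<in> sets (XJ J)"
    unfolding * by measurable
qed

text \<open>Almost every point of the box has a first adjacent time n. If the pattern is
  \<open>adj0\<close>, the diagonal power h_n takes the point to one shifted box, if it is
  \<open>adj1\<close>, the power - h_n takes it to the other one. These powers preserve \<theta>,
  and in each target box the parts for different n are disjoint, so their measures sum to at most
  that of the box.\<close>

lemma lbox_le:
  assumes f: "\<And>i. i \<in> J \<Longrightarrow> f i \<in> chacon_F m \<and> f i - 1 \<in> chacon_F m \<and> f i + 1 \<in> chacon_F m"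
  shows "emeasure \<theta> (lbox J m f) \<le> emeasure \<theta> (pshift J I 1 -` lbox J m f \<inter> spJ J) + emeasure \<theta> (pshift J I (-1) -` lbox J m f \<inter> spJ J)"
proof -
  define f1 where "f1 s = (\<lambda>i. if i \<in> I then f i - s else f i)" for s
  define E where "E f' n = {x \<in> lbox J m f'. first_adj J I m n x}" for f' n
  let ?E0 = "\<lambda>n. {x \<in> lbox J m f. first_adj J I m n x \<and> adj0 J I n x}"
  let ?E1 = "\<lambda>n. {x \<in> lbox J m f. first_adj J I m n x \<and> adj1 J I n x}"
  have disj: "disjoint_family (E f')" for f'
  proof -
    have lt: "E f' n \<inter> E f' n' = {}" if "n < n'" for n n'
      unfolding E_def first_adj_def using that by (auto dest: bspec[of _ _ n])
    then show ?thesis unfolding disjoint_family_on_def by (metis Int_commute linorder_neqE_nat)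
  qed
  have sE: "E f' n \<in> sets \<theta>" "?E0 n \<in> sets \<theta>" "?E1 n \<in> sets \<theta>" for f' n
    unfolding sets_th E_def by (rule first_adj_sets)+
  have sb: "lbox J m f' \<in> sets \<theta>" for f' unfolding sets_th by (rule lbox_sets[OF fin_J])
  have shift: "emeasure \<theta> B \<le> emeasure \<theta> (E (f1 s) n)"
    if "B \<subseteq> pshift J J g -` E (f1 s) n \<inter> spJ J" for B s g n
  proof -
    have "emeasure \<theta> B \<le> emeasure \<theta> (pshift J J g -` E (f1 s) n \<inter> spJ J)"
      by (rule emeasure_mono[OF that]) (use vimage_pshift_sets[OF first_adj_sets(1)] sets_th in \<open>auto simp: E_def\<close>)
    then show ?thesis using inv_tau[OF first_adj_sets(1)] by (simp add: E_def)
  qed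
  have e0: "emeasure \<theta> (?E0 n) \<le> emeasure \<theta> (E (f1 1) n)" for n
    by (rule shift[of _ "chacon_h n"])
       (use shift_first_adj[of _ J m f I n 1 "chacon_h n"] f in \<open>auto simp: f1_def E_def, auto simp: lbox_def\<close>)
  have e1: "emeasure \<theta> (?E1 n) \<le> emeasure \<theta> (E (f1 (-1)) n)" for n
    by (rule shift[of _ "- chacon_h n"])
       (use shift_first_adj[of _ J m f I n "-1" "- chacon_h n"] f in \<open>auto simp: f1_def E_def, auto simp: lbox_def\<close>)
  have Esum: "(\<Sum>n. emeasure \<theta> (E f' n)) \<le> emeasure \<theta> (lbox J m f')" for f'
  proof -
    have "(\<Sum>n. emeasure \<theta> (E f' n)) = emeasure \<theta> (\<Union>n. E f' n)"
      by (intro suminf_emeasure image_subsetI sE(1) disj)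
    also have "\<dots> \<le> emeasure \<theta> (lbox J m f')" by (rule emeasure_mono) (use sb in \<open>auto simp: E_def\<close>)
    finally show ?thesis .
  qed
  have c1: "emeasure \<theta> (lbox J m f) \<le> emeasure \<theta> (\<Union>n. E f n)"
  proof (rule emeasure_mono_AE)
    show "AE x in \<theta>. x \<in> lbox J m f \<longrightarrow> x \<in> (\<Union>n. E f n)"
      using freq
    proof eventually_elim
      case (elim x)
      show ?case
      proof
        assume x: "x \<in> lbox J m f"
        have ex: "\<exists>n. n \<ge> m \<and> adj J I n x" using elim unfolding freq_adj_def adj_def by blast
        define n where "n = (LEAST n. n \<ge> m \<and> adj J I n x)"
        have "n \<ge> m \<and> adj J I n x" unfolding n_def by (rule LeastI_ex[OF ex])
        moreover have "\<not> adj J I k x" if "k \<in> {m..<n}" for k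
          using not_less_Least[of k "\<lambda>n. n \<ge> m \<and> adj J I n x"] that unfolding n_def by auto
        ultimately have "first_adj J I m n x" by (simp add: first_adj_def)
        then show "x \<in> (\<Union>n. E f n)" using x by (auto simp: E_def)
      qed
    qed
    show "(\<Union>n. E f n) \<in> sets \<theta>" by (intro sets.countable_UN image_subsetI sE(1))
  qed
  have c2: "emeasure \<theta> (\<Union>n. E f n) \<le> (\<Sum>n. emeasure \<theta> (E f n))"
    by (intro emeasure_subadditive_countably image_subsetI sE(1))
  have "emeasure \<theta> (E f n) \<le> emeasure \<theta> (E (f1 1) n) + emeasure \<theta> (E (f1 (-1)) n)" for n
  proof -
    have "E f n \<subseteq> ?E0 n \<union> ?E1 n" by (auto simp: first_adj_def adj_def E_def)
    then have "emeasure \<theta> (E f n) \<le> emeasure \<theta> (?E0 n \<union> ?E1 n)"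
      by (intro emeasure_mono sets.Un sE)
    also have "\<dots> \<le> emeasure \<theta> (?E0 n) + emeasure \<theta> (?E1 n)" by (intro emeasure_subadditive sE)
    also have "\<dots> \<le> emeasure \<theta> (E (f1 1) n) + emeasure \<theta> (E (f1 (-1)) n)" by (intro add_mono e0 e1)
    finally show ?thesis .
  qed
  then have c3: "(\<Sum>n. emeasure \<theta> (E f n)) \<le> (\<Sum>n. emeasure \<theta> (E (f1 1) n) + emeasure \<theta> (E (f1 (-1)) n))"
    by (intro suminf_le summableI)
  have c4: "(\<Sum>n. emeasure \<theta> (E (f1 1) n) + emeasure \<theta> (E (f1 (-1)) n)) =
      (\<Sum>n. emeasure \<theta> (E (f1 1) n)) + (\<Sum>n. emeasure \<theta> (E (f1 (-1)) n))"
    by (intro suminf_add[symmetric] summableI)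
  have c5: "(\<Sum>n. emeasure \<theta> (E (f1 1) n)) + (\<Sum>n. emeasure \<theta> (E (f1 (-1)) n)) \<le>
      emeasure \<theta> (lbox J m (f1 1)) + emeasure \<theta> (lbox J m (f1 (-1)))"
    by (intro add_mono Esum)
  have "lbox J m (f1 1) = pshift J I 1 -` lbox J m f \<inter> spJ J"
    "lbox J m (f1 (-1)) = pshift J I (-1) -` lbox J m f \<inter> spJ J"
    unfolding f1_def by (rule vimage_pshift_lbox[symmetric]; use f in auto)+
  then show ?thesis
    using order_trans[OF c1 order_trans[OF c2 order_trans[OF c3 c5[folded c4]]]] by (simp only:)
qed

lemma level_alg_le:
  assumes V: "V \<in> level_alg J m"
  shows "emeasure \<theta> (V \<inter> levJ J m) \<le>
    emeasure \<theta> (pshift J I 1 -` (V \<inter> levJ J m) \<inter> spJ J) + emeasure \<theta> (pshift J I (-1) -` (V \<inter> levJ J m) \<inter> spJ J)"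
proof -
  obtain n Fs where F: "finite Fs" "V \<inter> levJ J m = (\<Union>f\<in>Fs. lbox J n f)" "disjoint_family_on (lbox J n) Fs"
    "\<And>f i. f \<in> Fs \<Longrightarrow> i \<in> J \<Longrightarrow> f i \<in> chacon_F n \<and> f i - 1 \<in> chacon_F n \<and> f i + 1 \<in> chacon_F n"
    using level_alg_decompose[OF fin_J V] by metis
  have s: "(\<Sum>f\<in>Fs. emeasure \<theta> (pshift J I g -` lbox J n f \<inter> spJ J)) = emeasure \<theta> (pshift J I g -` (V \<inter> levJ J m) \<inter> spJ J)" for g
  proof -
    have "pshift J I g -` (V \<inter> levJ J m) \<inter> spJ J = (\<Union>f\<in>Fs. pshift J I g -` lbox J n f \<inter> spJ J)"
      unfolding F(2) by blast
    moreover have "disjoint_family_on (\<lambda>f. pshift J I g -` lbox J n f \<inter> spJ J) Fs"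
      using F(3) unfolding disjoint_family_on_def by blast
    ultimately show ?thesis
      using F(1) vimage_pshift_sets[OF lbox_sets[OF fin_J]] sets_th by (simp add: sum_emeasure image_subset_iff)
  qed
  have "emeasure \<theta> (V \<inter> levJ J m) = (\<Sum>f\<in>Fs. emeasure \<theta> (lbox J n f))"
    unfolding F(2) using F(1,3) lbox_sets[OF fin_J] sets_th by (intro sum_emeasure[symmetric]) auto
  also have "\<dots> \<le> (\<Sum>f\<in>Fs. emeasure \<theta> (pshift J I 1 -` lbox J n f \<inter> spJ J) + emeasure \<theta> (pshift J I (-1) -` lbox J n f \<inter> spJ J))"
    using F(4) by (intro sum_mono lbox_le) blast
  also have "\<dots> = emeasure \<theta> (pshift J I 1 -` (V \<inter> levJ J m) \<inter> spJ J) + emeasure \<theta> (pshift J I (-1) -` (V \<inter> levJ J m) \<inter> spJ J)"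
    by (simp only: sum.distrib s)
  finally show ?thesis .
qed

text \<open>All three terms are finite measures in A; \<open>finite_measures_approx\<close> extends
  the inequality from \<open>level_alg\<close> to all measurable sets.\<close>

lemma levJ_le:
  assumes A: "A \<in> sets (XJ J)"
  shows "emeasure \<theta> (A \<inter> levJ J m) \<le>
    emeasure \<theta> (pshift J I 1 -` (A \<inter> levJ J m) \<inter> spJ J) + emeasure \<theta> (pshift J I (-1) -` (A \<inter> levJ J m) \<inter> spJ J)"
proof -
  define R where "R g = pshift J I g -` levJ J m \<inter> spJ J" for g
  have Rs: "R g \<in> sets \<theta>" for g
    unfolding R_def sets_th by (intro vimage_pshift_sets levJ_measurable fin_J)
  define M where "M g = distr (density \<theta> (indicator (R g))) (XJ J) (pshift J I g)" for g
  have meas: "pshift J I g \<in> measurable (density \<theta> (indicator (R g))) (XJ J)" for g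
    using pshift_measurable[of J I g] sets_th by (simp cong: measurable_cong_sets)
  have em: "emeasure (M g) B = emeasure \<theta> (pshift J I g -` (B \<inter> levJ J m) \<inter> spJ J)" if "B \<in> sets (XJ J)" for g B
  proof -
    have "emeasure (M g) B = emeasure (density \<theta> (indicator (R g))) (pshift J I g -` B \<inter> spJ J)"
      unfolding M_def using that meas by (simp add: emeasure_distr space_th)
    also have "\<dots> = emeasure \<theta> (R g \<inter> (pshift J I g -` B \<inter> spJ J))"
      using Rs vimage_pshift_sets[OF that] sets_th by (simp add: emeasure_density flip: indicator_inter_arith)
    also have "R g \<inter> (pshift J I g -` B \<inter> spJ J) = pshift J I g -` (B \<inter> levJ J m) \<inter> spJ J"
      unfolding R_def by blast
    finally show ?thesis .
  qed
  have sM: "sets (M g) = sigma_sets (spJ J) (level_alg J m)" for g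
    unfolding M_def sets_distr by (rule sets_level_alg[OF fin_J])
  have fM: "finite_measure (M g)" if "g \<in> {0, 1, -1}" for g
  proof
    have "space (M g) = spJ J" by (simp add: M_def space_PiM)
    then have "emeasure (M g) (space (M g)) = emeasure \<theta> (R g)"
      using em[of "spJ J" g] sets.top[of "XJ J"] by (simp add: space_PiM R_def PiE_mono Int_absorb1)
    also have "\<dots> < \<infinity>" unfolding R_def using that chacon_h_ge_1[of m] by (intro vimage_levJ_finite) auto
    finally show "emeasure (M g) (space (M g)) \<noteq> \<infinity>" by simp
  qed
  interpret m0: finite_measure "M 0" using fM by simp
  interpret m1: finite_measure "M 1" using fM by simp
  interpret m2: finite_measure "M (-1)" using fM by simp
  have e0: "emeasure (M 0) B = emeasure \<theta> (B \<inter> levJ J m)" if "B \<in> sets (XJ J)" for B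
  proof -
    have "pshift J I 0 -` (B \<inter> levJ J m) \<inter> spJ J = B \<inter> levJ J m"
    proof (rule set_eqI)
      fix x show "x \<in> pshift J I 0 -` (B \<inter> levJ J m) \<inter> spJ J \<longleftrightarrow> x \<in> B \<inter> levJ J m"
        by (cases "x \<in> spJ J") (auto simp: pshift_0 PiE_iff)
    qed
    then show ?thesis using em[OF that, of 0] by simp
  qed
  have GV: "measure (M 0) V \<le> measure (M 1) V + measure (M (-1)) V" if V: "V \<in> level_alg J m" for V
  proof -
    have s: "V \<in> sets (XJ J)" using V by (simp add: level_alg_def)
    have "emeasure (M 0) V \<le> emeasure (M 1) V + emeasure (M (-1)) V"
      using level_alg_le[OF V] em[OF s] e0[OF s] by simp
    then show ?thesis
      by (simp add: m0.emeasure_eq_measure m1.emeasure_eq_measure m2.emeasure_eq_measure flip: ennreal_plus)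
  qed
  have "measure (M 0) A \<le> measure (M 1) A + measure (M (-1)) A"
  proof (rule field_le_epsilon)
    fix e :: real assume "e > 0"
    then have "\<exists>V\<in>level_alg J m. \<forall>g\<in>{0, 1, -1}. measure (M g) (sym_diff A V) < e / 3"
      using A sets_level_alg[OF fin_J, of m] by (intro finite_measures_approx[where M = M and \<Omega> = "spJ J"] fM sM algebra_level_alg) auto
    then obtain V where V: "V \<in> level_alg J m" "\<And>g. g \<in> {0, 1, -1} \<Longrightarrow> measure (M g) (sym_diff A V) < e / 3" by blast
    have Vs: "V \<in> sets (M g)" "A \<in> sets (M g)" for g using V(1) A by (simp_all add: level_alg_def M_def)
    have d: "\<bar>measure (M g) A - measure (M g) V\<bar> < e / 3" if g: "g \<in> {0, 1, -1}" for g
    proof -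
      interpret finite_measure "M g" by (rule fM[OF g])
      have "measure (M g) A \<le> measure (M g) (V \<union> sym_diff A V)" using Vs by (intro finite_measure_mono) auto
      also have "\<dots> \<le> measure (M g) V + measure (M g) (sym_diff A V)" using Vs by (intro measure_Un_le) auto
      finally have 1: "measure (M g) A \<le> measure (M g) V + measure (M g) (sym_diff A V)" .
      have "measure (M g) V \<le> measure (M g) (A \<union> sym_diff A V)" using Vs by (intro finite_measure_mono) auto
      also have "\<dots> \<le> measure (M g) A + measure (M g) (sym_diff A V)" using Vs by (intro measure_Un_le) auto
      finally show ?thesis using 1 V(2)[OF g] by linarith
    qed
    have "\<bar>measure (M 0) A - measure (M 0) V\<bar> < e / 3" "\<bar>measure (M 1) A - measure (M 1) V\<bar> < e / 3"
      "\<bar>measure (M (-1)) A - measure (M (-1)) V\<bar> < e / 3" by (rule d, simp)+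
    with GV[OF V(1)] show "measure (M 0) A \<le> measure (M 1) A + measure (M (-1)) A + e" by linarith
  qed
  then have "emeasure (M 0) A \<le> emeasure (M 1) A + emeasure (M (-1)) A"
    by (simp add: m0.emeasure_eq_measure m1.emeasure_eq_measure m2.emeasure_eq_measure flip: ennreal_plus)
  then show ?thesis using em[OF A] e0[OF A] by simp
qed

end

end

text \<open>If the shift merely exchanges the digit at n for another one, the position at n is
  untouched, and by \<open>lev_agree\<close> so is membership in X_m.\<close>

lemma shift_same_level:
  assumes "m \<le> n" "x \<in> lev m" "inc n x + g \<in> chacon_C (Suc n)"
  shows "chacon_T g x \<in> lev m"
proof -
  have xn: "x \<in> lev n" using lev_le assms by blast
  have p: "pos (Suc n) x + g = pos n x + (inc n x + g)" by (simp add: pos_Suc)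
  have F: "pos (Suc n) x + g \<in> chacon_F (Suc n)"
    unfolding p by (rule chacon_F_add_C[OF pos_in_F[OF xn] assms(3)])
  have y: "chacon_T g x \<in> lev (Suc n)" "pos (Suc n) (chacon_T g x) = pos n x + (inc n x + g)"
    using T_in_lev[OF lev_Suc[OF xn] F] pos_T[OF lev_Suc[OF xn] F order_refl] unfolding p .
  note d = lev_Suc_decompose[OF y pos_in_F[OF xn] assms(3)]
  then show ?thesis using lev_agree[OF assms(1) d(1) assms(2) d(2)] by blast
qed

lemma pshift_complement:
  assumes "I \<subseteq> J"
  shows "pshift J (J - I) g x = pshift J I (- g) (pshift J J g x)"
  using assms by (auto simp: pshift_def fun_eq_iff)

lemma levJ_spJ: "x \<in> levJ J m \<Longrightarrow> x \<in> spJ J"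
  by (simp add: PiE_iff)

definition rect :: "nat set \<Rightarrow> nat set \<Rightarrow> (nat \<Rightarrow> chacon) set \<Rightarrow> (nat \<Rightarrow> chacon) set \<Rightarrow> (nat \<Rightarrow> chacon) set" where
  "rect J I A B = {x \<in> spJ J. restrict x I \<in> A \<and> restrict x (J - I) \<in> B}"

lemma restrict_measurable: "I \<subseteq> J \<Longrightarrow> (\<lambda>x. restrict x I) \<in> measurable (XJ J) (XJ I)"
  by (rule measurable_restrict_subset)

lemma rect_sets:
  assumes "I \<subseteq> J" "A \<in> sets (XJ I)" "B \<in> sets (XJ (J - I))"
  shows "rect J I A B \<in> sets (XJ J)"
proof -
  have "(\<lambda>x. restrict x I) -` A \<inter> space (XJ J) \<in> sets (XJ J)" "(\<lambda>x. restrict x (J - I)) -` B \<inter> space (XJ J) \<in> sets (XJ J)"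
    using restrict_measurable[of I J] restrict_measurable[of "J - I" J] assms by (auto intro: measurable_sets)
  then have "((\<lambda>x. restrict x I) -` A \<inter> space (XJ J)) \<inter> ((\<lambda>x. restrict x (J - I)) -` B \<inter> space (XJ J)) \<in> sets (XJ J)"
    by (rule sets.Int)
  also have "((\<lambda>x. restrict x I) -` A \<inter> space (XJ J)) \<inter> ((\<lambda>x. restrict x (J - I)) -` B \<inter> space (XJ J)) = rect J I A B"
    by (auto simp: rect_def space_PiM)
  finally show ?thesis .
qed

lemma rect_swap: "I \<subseteq> J \<Longrightarrow> rect J (J - I) B A = rect J I A B"
  by (auto simp: rect_def double_diff)

lemma rect_levJ: "I \<subseteq> J \<Longrightarrow> rect J I (levJ I m) (levJ (J - I) m) = levJ J m"
  by (rule set_eqI) (unfold rect_def mem_Collect_eq restrict_PiE_iff PiE_iff, auto)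

lemma vimage_pshift_rect:
  assumes "I \<subseteq> J"
  shows "pshift J I g -` rect J I A B \<inter> spJ J = rect J I (pshift I I g -` A \<inter> spJ I) B"
proof -
  have "restrict (pshift J I g x) I = pshift I I g (restrict x I)" "restrict (pshift J I g x) (J - I) = restrict x (J - I)" for x
    using assms by (auto simp: pshift_def restrict_def fun_eq_iff)
  then show ?thesis by (auto simp: rect_def)
qed

section \<open>Partial shifts: from null sets to a scaling factor and to invariance\<close>

context joining
begin

lemma ex_levJ_pos: "\<exists>m. 0 < emeasure \<theta> (levJ J m)"
proof (rule ccontr)
  assume "\<nexists>m. 0 < emeasure \<theta> (levJ J m)"
  then have "AE x in \<theta>. x \<notin> levJ J m" for m
    using AE_eq_null[of "levJ J m" \<theta>] levJ_measurable[OF fin_J] sets_th by simp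
  then have "AE x in \<theta>. \<forall>m. x \<notin> levJ J m" unfolding AE_all_countable by blast
  then have "AE x in \<theta>. False"
    using AE_space
  proof eventually_elim
    case (elim x)
    then have "x \<in> (\<Union>m. levJ J m)" using UN_levJ[OF fin_J] by (simp only: space_th)
    then show False using elim(1) by blast
  qed
  then show False using not_AE_False by blast
qed

lemma scaling_factor_pos: "emeasure \<theta> (spJ J) = r * emeasure \<theta> (spJ J) \<Longrightarrow> 0 < r"
  using nonzero by (cases "r = 0") (auto simp: zero_less_iff_neq_zero)

lemma null_or_conull:
  assumes A: "A \<in> sets (XJ J)" "pshift J J 1 -` A \<inter> spJ J = A"
  shows "emeasure \<theta> A = 0 \<or> emeasure \<theta> (spJ J - A) = 0"
  using ergodicD[of A] A by (auto simp: sets_th space_th)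

text \<open>If the shift takes the null set \<open>B\<close> to a conull set \<open>W\<close>, then both translates of \<open>W - B\<close> are null,
  which contradicts the inequality of \<open>levJ_le\<close>.\<close>

lemma partial_shift_null:
  assumes I: "I \<noteq> {}" "I \<subset> J" and freq: "AE x in \<theta>. freq_adj I x"
    and B: "B \<in> sets (XJ J)" "emeasure \<theta> B = 0"
  shows "emeasure \<theta> (pshift J I 1 -` B \<inter> spJ J) = 0"
proof (rule ccontr)
  assume nz: "emeasure \<theta> (pshift J I 1 -` B \<inter> spJ J) \<noteq> 0"
  \<comment> \<open>B is replaced by its orbit saturation, so that its preimage W becomes invariant
    and ergodicity applies to it.\<close>
  define S where "S = (\<Union>g. pshift J J g -` B \<inter> space \<theta>)"
  have Bth: "B \<in> sets \<theta>" using B sets_th by simp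
  have S: "S \<in> sets (XJ J)" "B \<subseteq> S" "\<And>h. pshift J J h -` S \<inter> spJ J = S" "emeasure \<theta> S = 0"
    using saturate[OF Bth] B Bth unfolding S_def[symmetric] by (auto simp: sets_th space_th null_sets_def)
  define W where "W = pshift J I 1 -` S \<inter> spJ J"
  have vimage_comm: "pshift J J h -` (pshift J I g -` A \<inter> spJ J) \<inter> spJ J = pshift J I g -` (pshift J J h -` A \<inter> spJ J) \<inter> spJ J" for g h A
    by (auto simp: pshift_commute)
  have W: "W \<in> sets (XJ J)" "pshift J J h -` W \<inter> spJ J = W" for h
    unfolding W_def vimage_comm S(3) by (simp_all add: vimage_pshift_sets[OF S(1)])
  have "emeasure \<theta> W \<noteq> 0"
  proof
    assume "emeasure \<theta> W = 0"
    moreover have "pshift J I 1 -` B \<inter> spJ J \<subseteq> W" using S(2) by (auto simp: W_def)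
    ultimately show False using nz W(1) sets_th by (metis emeasure_eq_0)
  qed
  then have Wc: "emeasure \<theta> (spJ J - W) = 0" using null_or_conull[OF W(1,2)] by blast
  define W' where "W' = W - S"
  have W': "W' \<in> sets (XJ J)" "pshift J J h -` W' \<inter> spJ J = W'" for h
  proof -
    show "W' \<in> sets (XJ J)" unfolding W'_def by (rule sets.Diff[OF W(1) S(1)])
    have "pshift J J h -` W' \<inter> spJ J = (pshift J J h -` W \<inter> spJ J) - (pshift J J h -` S \<inter> spJ J)"
      unfolding W'_def by blast
    then show "pshift J J h -` W' \<inter> spJ J = W'" by (simp only: W(2) S(3) W'_def)
  qed
  have aeW': "AE x in \<theta>. x \<in> W'"
  proof -
    have "AE x in \<theta>. x \<notin> spJ J - W" "AE x in \<theta>. x \<notin> S"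
      using Wc S W(1) sets_th sets.compl_sets[of W \<theta>] AE_eq_null[of "spJ J - W" \<theta>] AE_eq_null[of S \<theta>] by (auto simp: space_th)
    then show ?thesis using AE_space by eventually_elim (auto simp: W'_def space_th)
  qed
  have n2: "emeasure \<theta> (pshift J I (-1) -` W' \<inter> spJ J) = 0"
  proof -
    have "pshift J I (-1) -` W' \<inter> spJ J \<subseteq> S"
      by (auto simp: W'_def W_def pshift_add pshift_0)
    then show ?thesis using S(1,4) sets_th by (metis emeasure_eq_0)
  qed
  \<comment> \<open>Otherwise this invariant set would be conull. But a point x of W is shifted into
    S, which is disjoint from W'.\<close>
  have n1: "emeasure \<theta> (pshift J I 1 -` W' \<inter> spJ J) = 0"
  proof (rule ccontr)
    assume c: "emeasure \<theta> (pshift J I 1 -` W' \<inter> spJ J) \<noteq> 0"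
    have m: "pshift J I 1 -` W' \<inter> spJ J \<in> sets (XJ J)" by (rule vimage_pshift_sets[OF W'(1)])
    have "pshift J J 1 -` (pshift J I 1 -` W' \<inter> spJ J) \<inter> spJ J = pshift J I 1 -` W' \<inter> spJ J"
      unfolding vimage_comm W'(2) ..
    then have "emeasure \<theta> (spJ J - (pshift J I 1 -` W' \<inter> spJ J)) = 0"
      using null_or_conull[OF m] c by blast
    moreover have "spJ J - (pshift J I 1 -` W' \<inter> spJ J) \<in> sets \<theta>"
      using sets.compl_sets[OF m] sets_th by (simp add: space_PiM)
    ultimately have "AE x in \<theta>. x \<notin> spJ J - (pshift J I 1 -` W' \<inter> spJ J)" by (simp only: AE_eq_null)
    then have "AE x in \<theta>. False"
      using aeW' AE_space
    proof eventually_elim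
      case (elim x)
      then have "pshift J I 1 x \<in> W'" "x \<in> W" by (auto simp: space_th W'_def)
      then show False by (auto simp: W'_def W_def)
    qed
    then show False using not_AE_False by blast
  qed
  have z: "emeasure \<theta> (W' \<inter> levJ J m) = 0" for m
  proof -
    have "emeasure \<theta> (pshift J I g -` (W' \<inter> levJ J m) \<inter> spJ J) \<le> emeasure \<theta> (pshift J I g -` W' \<inter> spJ J)" for g
      using vimage_pshift_sets[OF W'(1)] sets_th by (intro emeasure_mono) auto
    then show ?thesis
      using levJ_le[OF I freq W'(1), of m] n1 n2 by (metis add_0 le_zero_eq)
  qed
  have e: "emeasure \<theta> (levJ J m) = emeasure \<theta> (W' \<inter> levJ J m)" for m
    by (rule emeasure_eq_AE) (use aeW' W'(1) sets_th levJ_measurable[OF fin_J] in auto)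
  obtain m where "0 < emeasure \<theta> (levJ J m)" using ex_levJ_pos by blast
  then show False unfolding trans[OF e z] by simp
qed

text \<open>The image of \<theta> under the partial shift is invariant, because partial and diagonal
  shifts commute, and by \<open>partial_shift_null\<close> it is absolutely continuous. Ergodicity
  makes it a multiple of \<theta>.\<close>

lemma partial_shift_scales:
  assumes I: "I \<noteq> {}" "I \<subset> J" and freq: "AE x in \<theta>. freq_adj I x"
  obtains r where "0 < r" "r < \<infinity>" "\<And>A. A \<in> sets (XJ J) \<Longrightarrow> emeasure \<theta> (pshift J I 1 -` A \<inter> spJ J) = r * emeasure \<theta> A"
proof -
  define N where "N = distr \<theta> (XJ J) (pshift J I 1)"
  have em: "emeasure N A = emeasure \<theta> (pshift J I 1 -` A \<inter> spJ J)" if "A \<in> sets (XJ J)" for A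
    unfolding N_def using that pshift_measurable[of J I 1] sets_th by (simp add: emeasure_distr space_th cong: measurable_cong_sets)
  obtain r where r: "r < \<infinity>" "\<And>A. A \<in> sets \<theta> \<Longrightarrow> emeasure N A = r * emeasure \<theta> A"
  proof (rule invariant_abs_cont_proportional[of N])
    show "sigma_finite_measure \<theta>" by (rule sigma_finite_th)
    show "sets N = sets \<theta>" by (simp add: N_def sets_th)
    show "sigma_finite_measure N"
    proof (rule sigma_finite_levJ[OF fin_J])
      show "emeasure N (levJ J n) < \<infinity>" for n
        using vimage_levJ_finite[where g = 1 and m = n and I' = I] chacon_h_ge_1[of n] em[OF levJ_measurable[OF fin_J]] by simp
    qed (simp add: N_def)
    show "absolutely_continuous \<theta> N"
      unfolding absolutely_continuous_def null_sets_def
      using partial_shift_null[OF I freq] em by (auto simp: sets_th N_def)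
    fix A g assume A: "A \<in> sets \<theta>"
    then have A': "A \<in> sets (XJ J)" by (simp add: sets_th)
    have c: "pshift J I 1 -` (pshift J J g -` A \<inter> spJ J) \<inter> spJ J = pshift J J g -` (pshift J I 1 -` A \<inter> spJ J) \<inter> spJ J"
      by (auto simp: pshift_commute)
    show "emeasure N (pshift J J g -` A \<inter> space \<theta>) = emeasure N A"
      unfolding space_th em[OF vimage_pshift_sets[OF A']] em[OF A'] c by (rule inv_tau[OF vimage_pshift_sets[OF A']])
  qed blast
  have r': "emeasure \<theta> (pshift J I 1 -` A \<inter> spJ J) = r * emeasure \<theta> A" if "A \<in> sets (XJ J)" for A
    using r(2)[of A] em[OF that] that by (simp add: sets_th)
  have "spJ J \<in> sets (XJ J)" using sets.top[of "XJ J"] by (simp add: space_PiM)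
  moreover have "pshift J I 1 -` spJ J \<inter> spJ J = spJ J" by auto
  ultimately have "emeasure \<theta> (spJ J) = r * emeasure \<theta> (spJ J)" using r'[of "spJ J"] by simp
  then have "0 < r" by (rule scaling_factor_pos)
  then show ?thesis using that r(1) r' by blast
qed

text \<open>For negative powers the factor stands on the left, which avoids division in
  \<open>ennreal\<close>.\<close>

lemma partial_shift_power:
  assumes r: "\<And>A. A \<in> sets (XJ J) \<Longrightarrow> emeasure \<theta> (pshift J I 1 -` A \<inter> spJ J) = r * emeasure \<theta> A"
    and A: "A \<in> sets (XJ J)"
  shows "emeasure \<theta> (pshift J I (int k) -` A \<inter> spJ J) = r ^ k * emeasure \<theta> A"
    and "r ^ k * emeasure \<theta> (pshift J I (- int k) -` A \<inter> spJ J) = emeasure \<theta> A"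
proof -
  have *: "emeasure \<theta> (pshift J I (int k) -` A \<inter> spJ J) = r ^ k * emeasure \<theta> A" if "A \<in> sets (XJ J)" for A
    using that
  proof (induction k arbitrary: A)
    case 0
    have "pshift J I 0 -` A \<inter> spJ J = A \<inter> spJ J" using pshift_0 by auto
    moreover have "A \<subseteq> spJ J" using sets.sets_into_space[OF 0] by (simp add: space_PiM)
    ultimately show ?case by (simp add: Int_absorb2)
  next
    case (Suc k)
    have e: "pshift J I (int (Suc k)) -` A \<inter> spJ J = pshift J I (int k) -` (pshift J I 1 -` A \<inter> spJ J) \<inter> spJ J"
      by (auto simp: pshift_add add.commute)
    show ?case unfolding e Suc.IH[OF vimage_pshift_sets[OF Suc.prems]] r[OF Suc.prems] by (simp add: ac_simps)
  qed
  show "emeasure \<theta> (pshift J I (int k) -` A \<inter> spJ J) = r ^ k * emeasure \<theta> A" by (rule *[OF A])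
  have "pshift J I (int k) -` (pshift J I (- int k) -` A \<inter> spJ J) \<inter> spJ J = A"
    using sets.sets_into_space[OF A] by (auto simp: pshift_add pshift_0 space_PiM)
  then show "r ^ k * emeasure \<theta> (pshift J I (- int k) -` A \<inter> spJ J) = emeasure \<theta> A"
    using *[OF vimage_pshift_sets[OF A], of I "- int k"] by simp
qed

text \<open>Shifting J - I by g is the diagonal shift by g followed by the shift of I by - g, and
  the diagonal shift preserves \<theta>. So J - I scales by the inverse factor.\<close>

lemma vimage_complement_shift:
  assumes "I \<subseteq> J" "A \<in> sets (XJ J)"
  shows "emeasure \<theta> (pshift J (J - I) g -` A \<inter> spJ J) = emeasure \<theta> (pshift J I (- g) -` A \<inter> spJ J)"
proof -
  have "pshift J (J - I) g -` A \<inter> spJ J = pshift J J g -` (pshift J I (- g) -` A \<inter> spJ J) \<inter> spJ J"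
    by (auto simp: pshift_complement[OF assms(1)])
  then show ?thesis using inv_tau[OF vimage_pshift_sets[OF assms(2)]] by simp
qed

text \<open>If the scaling factor \<open>r\<close> were not \<open>1\<close>, shifts by \<open>- h\<^sub>n\<close> and \<open>h\<^sub>n + 1\<close> that keep the point in \<open>X\<^sub>m\<close>
  would make the adjacent patterns at \<open>n\<close> exponentially unlikely, and by Borel--Cantelli they would
  occur only finitely often.\<close>

lemma partial_shift_invariant:
  assumes I: "I \<noteq> {}" "I \<subset> J" and freq: "AE x in \<theta>. freq_adj I x" and A: "A \<in> sets (XJ J)"
  shows "emeasure \<theta> (pshift J I g -` A \<inter> spJ J) = emeasure \<theta> A"
proof -
  obtain r where r: "0 < r" "r < \<infinity>" "\<And>A. A \<in> sets (XJ J) \<Longrightarrow> emeasure \<theta> (pshift J I 1 -` A \<inter> spJ J) = r * emeasure \<theta> A"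
    using partial_shift_scales[OF I freq] by blast
  have pw: "emeasure \<theta> (pshift J I (int k) -` A \<inter> spJ J) = r ^ k * emeasure \<theta> A"
    "r ^ k * emeasure \<theta> (pshift J I (- int k) -` A \<inter> spJ J) = emeasure \<theta> A" if "A \<in> sets (XJ J)" for A k
    by (rule partial_shift_power[OF _ that], rule r(3), assumption)+
  define R where "R = enn2real r"
  have R: "r = ennreal R" "R > 0" using r(1,2) by (auto simp: R_def enn2real_positive_iff less_top)
  have "R = 1"
  proof (rule ccontr)
    assume R1: "R \<noteq> 1"
    define \<rho> where "\<rho> = (if R < 1 then R else 1 / R)"
    have \<rho>: "0 < \<rho>" "\<rho> < 1" using R(2) R1 by (auto simp: \<rho>_def)
    obtain m where m: "0 < emeasure \<theta> (levJ J m)" using ex_levJ_pos by blast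
    let ?L = "levJ J m"
    have Ls: "?L \<in> sets (XJ J)" by (rule levJ_measurable[OF fin_J])
    have Lfin: "emeasure \<theta> ?L \<noteq> \<infinity>" using fin_th[of m] by simp
    define l where "l = measure \<theta> ?L"
    have l: "emeasure \<theta> ?L = ennreal l" "l \<ge> 0" using Lfin by (auto simp: l_def emeasure_eq_ennreal_measure)
    \<comment> \<open>One of the two shifts bounds the measure by a power of R times l, the other by
      a power of 1 / R times l. Whichever base is below 1 is used; the exponents are at least h_n,
      hence at least n.\<close>
    have bound: "measure \<theta> {x \<in> ?L. P x} \<le> \<rho> ^ n * l"
      if P: "Measurable.pred (XJ J) P" "\<And>x. x \<in> ?L \<Longrightarrow> P x \<Longrightarrow> pshift J K (- chacon_h n) x \<in> ?L"
        "\<And>x. x \<in> ?L \<Longrightarrow> P x \<Longrightarrow> pshift J K (chacon_h n + 1) x \<in> ?L"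
        and K: "K = I \<or> K = J - I" for P n K
    proof -
      let ?Q = "{x \<in> ?L. P x}"
      have Qs: "?Q \<in> sets \<theta>"
      proof -
        have "?Q = {x \<in> space (XJ J). P x} \<inter> ?L" unfolding space_PiM using levJ_spJ by auto
        moreover have "{x \<in> space (XJ J). P x} \<in> sets (XJ J)" using P(1) by (simp add: pred_def)
        ultimately show ?thesis using Ls sets_th by auto
      qed
      have Qfin: "emeasure \<theta> ?Q = ennreal (measure \<theta> ?Q)"
      proof -
        have "emeasure \<theta> ?Q \<le> emeasure \<theta> ?L" by (rule emeasure_mono) (use Ls sets_th in auto)
        then show ?thesis using Lfin by (intro emeasure_eq_ennreal_measure) (auto simp: top_unique)
      qed
      have sub: "emeasure \<theta> ?Q \<le> emeasure \<theta> (pshift J K g -` ?L \<inter> spJ J)"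
        if "\<And>x. x \<in> ?L \<Longrightarrow> P x \<Longrightarrow> pshift J K g x \<in> ?L" for g
      proof (rule emeasure_mono)
        show "?Q \<subseteq> pshift J K g -` ?L \<inter> spJ J" using that levJ_spJ by blast
        show "pshift J K g -` ?L \<inter> spJ J \<in> sets \<theta>" using vimage_pshift_sets[OF Ls] sets_th by simp
      qed
      obtain h where h: "chacon_h n = int h" using chacon_h_ge_1[of n] by (metis nonneg_int_cases order_trans zero_le_one)
      have "n \<le> h" using chacon_h_ge[of n] h by simp
      have a: "pshift J K' (chacon_h n + 1) = pshift J K' (int (Suc h))" "pshift J K' (- chacon_h n) = pshift J K' (- int h)" for K'
        by (simp_all add: h add.commute)
      have le: "\<rho> ^ k * l \<le> \<rho> ^ n * l" if "n \<le> k" for k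
        using \<rho> l(2) that by (intro mult_right_mono power_decreasing) auto
      have up: "measure \<theta> ?Q \<le> R ^ k * l" if "emeasure \<theta> ?Q \<le> r ^ k * emeasure \<theta> ?L" for k
        using that l(2) R Qfin by (simp add: l(1) ennreal_power flip: ennreal_mult)
      have dn: "R ^ k * measure \<theta> ?Q \<le> l" if "r ^ k * emeasure \<theta> ?Q \<le> emeasure \<theta> ?L" for k
        using that l R Qfin by (simp add: ennreal_power flip: ennreal_mult)
      have key: "(\<exists>k\<ge>n. measure \<theta> ?Q \<le> R ^ k * l) \<and> (\<exists>k\<ge>n. R ^ k * measure \<theta> ?Q \<le> l)"
        using K
      proof
        assume K: "K = I"
        have "emeasure \<theta> ?Q \<le> r ^ Suc h * emeasure \<theta> ?L"
          using sub[OF P(3)] unfolding a K pw(1)[OF Ls] by simp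
        moreover have "r ^ h * emeasure \<theta> ?Q \<le> r ^ h * emeasure \<theta> (pshift J I (- int h) -` ?L \<inter> spJ J)"
          using sub[OF P(2)] unfolding a K by (intro mult_left_mono) auto
        then have "r ^ h * emeasure \<theta> ?Q \<le> emeasure \<theta> ?L" unfolding pw(2)[OF Ls] .
        ultimately show ?thesis using up[of "Suc h"] dn[of h] \<open>n \<le> h\<close> le_SucI by blast
      next
        assume K: "K = J - I"
        have IJ: "I \<subseteq> J" using I by blast
        have "emeasure \<theta> ?Q \<le> r ^ h * emeasure \<theta> ?L"
          using sub[OF P(2)] unfolding a K vimage_complement_shift[OF IJ Ls] by (simp add: pw(1)[OF Ls])
        moreover have "r ^ Suc h * emeasure \<theta> ?Q \<le> r ^ Suc h * emeasure \<theta> (pshift J I (- int (Suc h)) -` ?L \<inter> spJ J)"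
          using sub[OF P(3)] unfolding a K vimage_complement_shift[OF IJ Ls] by (intro mult_left_mono) auto
        then have "r ^ Suc h * emeasure \<theta> ?Q \<le> emeasure \<theta> ?L" unfolding pw(2)[OF Ls] .
        ultimately show ?thesis using up[of h] dn[of "Suc h"] \<open>n \<le> h\<close> le_SucI by blast
      qed
      show ?thesis
      proof (cases "R < 1")
        case True
        then have "\<rho> = R" by (simp add: \<rho>_def)
        then show ?thesis using key le order_trans by blast
      next
        case False
        then have "\<rho> = 1 / R" by (simp add: \<rho>_def)
        obtain k where k: "k \<ge> n" "R ^ k * measure \<theta> ?Q \<le> l" using key by blast
        have "measure \<theta> ?Q \<le> \<rho> ^ k * l"
          using k(2) R(2) by (simp add: \<open>\<rho> = 1 / R\<close> power_one_over field_simps)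
        then show ?thesis using le[OF k(1)] by linarith
      qed
    qed
    define Q where "Q n = {x \<in> ?L. n \<ge> m \<and> adj J I n x}" for n
    have Qs: "Q n \<in> sets \<theta>" for n
    proof -
      have "Q n = (if n \<ge> m then {x \<in> space \<theta>. adj0 J I n x \<or> adj1 J I n x} \<inter> ?L else {})"
        by (auto simp: Q_def adj_def space_th intro: levJ_spJ)
      moreover have "{x \<in> space \<theta>. adj0 J I n x \<or> adj1 J I n x} \<in> sets \<theta>" by measurable
      ultimately show ?thesis using Ls sets_th by auto
    qed
    have Qb: "measure \<theta> (Q n) \<le> 2 * (\<rho> ^ n * l)" for n
    proof (cases "n \<ge> m")
      case True
      have lm: "x i \<in> lev m" if "x \<in> ?L" "i \<in> J" for x i using that by auto
      have sh: "pshift J K g x \<in> ?L"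
        if x: "x \<in> ?L" and "\<And>i. i \<in> J \<Longrightarrow> i \<in> K \<Longrightarrow> inc n (x i) + g \<in> chacon_C (Suc n)" for x K g
      proof -
        have "pshift J K g x i \<in> lev m" if "i \<in> J" for i
          using shift_same_level[OF True lm[OF x that]] lm[OF x that] that \<open>\<And>i. i \<in> J \<Longrightarrow> i \<in> K \<Longrightarrow> _\<close>[OF that] by (simp add: pshift_apply)
        then show ?thesis by (simp add: PiE_iff pshift_def)
      qed
      \<comment> \<open>Only from the digit 0 do both - h_n and h_n + 1 lead to another digit. In
        \<open>adj0\<close> the zeros are on I, in \<open>adj1\<close> they are on J - I.\<close>
      have b0: "measure \<theta> {x \<in> ?L. adj0 J I n x} \<le> \<rho> ^ n * l"
        by (rule bound[OF pattern_measurable(1)[OF fin_J], where K = I]; (rule sh)?)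
           (auto simp: adj0_def inc_set_def mem_chacon_C)
      have b1: "measure \<theta> {x \<in> ?L. adj1 J I n x} \<le> \<rho> ^ n * l"
        by (rule bound[OF pattern_measurable(2)[OF fin_J], where K = "J - I"]; (rule sh)?)
           (auto simp: adj1_def inc_set_def mem_chacon_C)
      have s: "{x \<in> ?L. adj0 J I n x} \<in> sets \<theta>" "{x \<in> ?L. adj1 J I n x} \<in> sets \<theta>"
      proof -
        have "{x \<in> ?L. P x} = {x \<in> space \<theta>. P x} \<inter> ?L" for P using levJ_spJ by (auto simp: space_th)
        moreover have "{x \<in> space \<theta>. adj0 J I n x} \<in> sets \<theta>" "{x \<in> space \<theta>. adj1 J I n x} \<in> sets \<theta>" by measurable
        ultimately show "{x \<in> ?L. adj0 J I n x} \<in> sets \<theta>" "{x \<in> ?L. adj1 J I n x} \<in> sets \<theta>"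
          using Ls sets_th by auto
      qed
      have "Q n = {x \<in> ?L. adj0 J I n x} \<union> {x \<in> ?L. adj1 J I n x}" using True by (auto simp: Q_def adj_def)
      then have "measure \<theta> (Q n) \<le> measure \<theta> {x \<in> ?L. adj0 J I n x} + measure \<theta> {x \<in> ?L. adj1 J I n x}"
        using measure_Un_le[OF s] by simp
      then show ?thesis using b0 b1 by linarith
    next
      case False
      then have "Q n = {}" by (auto simp: Q_def)
      then show ?thesis using \<rho> l by simp
    qed
    have "AE x in \<theta>. \<forall>\<^sub>F n in sequentially. x \<in> space \<theta> - Q n"
    proof (rule borel_cantelli_AE1)
      show "Q n \<in> sets \<theta>" for n by (rule Qs)
      show "emeasure \<theta> (Q n) < \<infinity>" for n
      proof -
        have "emeasure \<theta> (Q n) \<le> emeasure \<theta> ?L" by (rule emeasure_mono) (use Ls sets_th in \<open>auto simp: Q_def\<close>)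
        then show ?thesis using fin_th[of m] by (rule le_less_trans)
      qed
      show "summable (\<lambda>n. measure \<theta> (Q n))"
      proof (rule summable_comparison_test'[where N = 0])
        show "summable (\<lambda>n. 2 * (\<rho> ^ n * l))" using \<rho> by (intro summable_mult summable_mult2 summable_geometric) simp
        show "norm (measure \<theta> (Q n)) \<le> 2 * (\<rho> ^ n * l)" for n using Qb[of n] by simp
      qed
    qed
    then have "AE x in \<theta>. x \<notin> ?L"
      using freq
    proof eventually_elim
      case (elim x)
      show ?case
      proof
        assume x: "x \<in> ?L"
        obtain N where N: "\<And>n. n \<ge> N \<Longrightarrow> x \<notin> Q n" using elim(1) unfolding eventually_sequentially by blast
        obtain n where "n \<ge> max N m" "adj J I n x" using elim(2) unfolding freq_adj_def adj_def by blast
        then show False using N[of n] x by (simp add: Q_def)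
      qed
    qed
    then have "emeasure \<theta> ?L = 0" using AE_eq_null[of ?L \<theta>] Ls sets_th by simp
    then show False using m by simp
  qed
  then have pw1: "emeasure \<theta> (pshift J I (int k) -` A \<inter> spJ J) = emeasure \<theta> A" "emeasure \<theta> (pshift J I (- int k) -` A \<inter> spJ J) = emeasure \<theta> A" for k
    using pw[OF A, of k] R(1) by simp_all
  show ?thesis
  proof (cases "g \<ge> 0")
    case True
    then show ?thesis using pw1(1)[of "nat g"] by simp
  next
    case False
    then show ?thesis using pw1(2)[of "nat (- g)"] by simp
  qed
qed

end

section \<open>Splitting and induction\<close>

lemma vimage_diag_rect:
  assumes "I \<subseteq> J"
  shows "pshift J J g -` rect J I A B \<inter> spJ J =
    rect J I (pshift I I g -` A \<inter> spJ I) (pshift (J - I) (J - I) g -` B \<inter> spJ (J - I))"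
proof -
  have "restrict (pshift J J g x) I = pshift I I g (restrict x I)"
    "restrict (pshift J J g x) (J - I) = pshift (J - I) (J - I) g (restrict x (J - I))" for x
    using assms by (auto simp: pshift_def restrict_def fun_eq_iff)
  then show ?thesis by (auto simp: rect_def)
qed

lemma rect_mono: "A \<subseteq> A' \<Longrightarrow> B \<subseteq> B' \<Longrightarrow> rect J I A B \<subseteq> rect J I A' B'"
  unfolding rect_def by blast

lemma levJ_subset_spJ: "levJ J m \<subseteq> spJ J"
  by (rule subsetI) (rule levJ_spJ)

lemma spJ_sets: "spJ I \<in> sets (XJ I)"
  using sets.top[of "XJ I"] by (simp add: space_PiM)

context joining
begin

definition partially_invariant :: "nat set \<Rightarrow> bool" where
  "partially_invariant I \<longleftrightarrow> (\<forall>g. \<forall>A\<in>sets (XJ J). emeasure \<theta> (pshift J I g -` A \<inter> spJ J) = emeasure \<theta> A)"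

text \<open>This is the marginal on I after confining the other coordinates to B. For B inside some
  \<open>levJ (J - I) m\<close> it is finite on each \<open>levJ I n\<close>, unlike the full
  projection.\<close>

definition slice :: "nat set \<Rightarrow> (nat \<Rightarrow> chacon) set \<Rightarrow> (nat \<Rightarrow> chacon) measure" where
  "slice I B = distr (density \<theta> (indicator (rect J I (spJ I) B))) (XJ I) (\<lambda>x. restrict x I)"

lemma sets_slice[simp]: "sets (slice I B) = sets (XJ I)"
  by (simp add: slice_def)

lemma space_slice: "space (slice I B) = spJ I"
  using sets_eq_imp_space_eq[OF sets_slice] by (simp add: space_PiM)

lemma emeasure_slice:
  assumes I: "I \<subseteq> J" and A: "A \<in> sets (XJ I)" and B: "B \<in> sets (XJ (J - I))"
  shows "emeasure (slice I B) A = emeasure \<theta> (rect J I A B)"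
proof -
  have m: "(\<lambda>x. restrict x I) \<in> measurable (density \<theta> (indicator (rect J I (spJ I) B))) (XJ I)"
    using restrict_measurable[OF I] sets_th by (simp cong: measurable_cong_sets)
  have R: "rect J I (spJ I) B \<in> sets \<theta>" using rect_sets[OF I spJ_sets B] sets_th by simp
  have A': "(\<lambda>x. restrict x I) -` A \<inter> spJ J \<in> sets \<theta>"
    using measurable_sets[OF restrict_measurable[OF I] A] sets_th by (simp add: space_PiM)
  have "emeasure (slice I B) A = emeasure (density \<theta> (indicator (rect J I (spJ I) B))) ((\<lambda>x. restrict x I) -` A \<inter> spJ J)"
    unfolding slice_def using m A by (simp add: emeasure_distr space_th)
  also have "\<dots> = emeasure \<theta> (rect J I (spJ I) B \<inter> ((\<lambda>x. restrict x I) -` A \<inter> spJ J))"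
    using R A' by (simp add: emeasure_density flip: indicator_inter_arith)
  also have "rect J I (spJ I) B \<inter> ((\<lambda>x. restrict x I) -` A \<inter> spJ J) = rect J I A B"
    unfolding rect_def by auto
  finally show ?thesis .
qed

lemma slice_invariant:
  assumes I: "I \<subseteq> J" "partially_invariant I" and A: "A \<in> sets (XJ I)" and B: "B \<in> sets (XJ (J - I))"
  shows "emeasure (slice I B) (pshift I I g -` A \<inter> spJ I) = emeasure (slice I B) A"
proof -
  have A': "pshift I I g -` A \<inter> spJ I \<in> sets (XJ I)"
    using measurable_sets[OF pshift_measurable A, of I g] by (simp add: space_PiM)
  show ?thesis
    unfolding emeasure_slice[OF I(1) A' B] emeasure_slice[OF I(1) A B] vimage_pshift_rect[OF I(1), symmetric]
    using I(2) rect_sets[OF I(1) A B] unfolding partially_invariant_def by blast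
qed

text \<open>Leaving the other coordinates free turns an invariant set of the I-coordinates into one
  for the diagonal action, to which ergodicity of \<theta> applies.\<close>

lemma slice_ergodic:
  assumes I: "I \<subseteq> J" and B: "B \<in> sets (XJ (J - I))"
  shows "ergodic_under (pshift I I 1) (slice I B)"
  unfolding ergodic_under_def space_slice sets_slice
proof (intro ballI impI)
  fix A assume A: "A \<in> sets (XJ I)" and inv: "pshift I I 1 -` A \<inter> spJ I = A"
  let ?U = "spJ (J - I)"
  have Ac: "spJ I - A \<in> sets (XJ I)" using A spJ_sets by auto
  have "pshift J J 1 -` rect J I A ?U \<inter> spJ J = rect J I A ?U"
  proof -
    have "pshift (J - I) (J - I) 1 -` ?U \<inter> ?U = ?U" by auto
    then show ?thesis unfolding vimage_diag_rect[OF I] inv by (simp only:)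
  qed
  from null_or_conull[OF rect_sets[OF I A spJ_sets] this]
  show "A \<in> null_sets (slice I B) \<or> spJ I - A \<in> null_sets (slice I B)"
  proof
    have sub: "rect J I A B \<subseteq> rect J I A ?U" by (auto simp: rect_def)
    assume "emeasure \<theta> (rect J I A ?U) = 0"
    then have "emeasure \<theta> (rect J I A B) = 0"
      using sub rect_sets[OF I A spJ_sets] sets_th by (metis emeasure_eq_0)
    then show ?thesis using A emeasure_slice[OF I A B] by (simp add: null_sets_def)
  next
    have sub: "rect J I (spJ I - A) B \<subseteq> spJ J - rect J I A ?U" by (auto simp: rect_def)
    assume "emeasure \<theta> (spJ J - rect J I A ?U) = 0"
    moreover have "spJ J - rect J I A ?U \<in> sets \<theta>"
      using rect_sets[OF I A spJ_sets] spJ_sets[of J] sets_th by auto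
    ultimately have "emeasure \<theta> (rect J I (spJ I - A) B) = 0"
      using sub by (metis emeasure_eq_0)
    then show ?thesis using Ac emeasure_slice[OF I Ac B] by (simp add: null_sets_def)
  qed
qed

lemma slice_finite:
  assumes I: "I \<subseteq> J" and B: "B \<in> sets (XJ (J - I))" "B \<subseteq> levJ (J - I) m"
  shows "emeasure (slice I B) (levJ I n) < \<infinity>"
proof -
  have fI: "finite I" using I fin_J finite_subset by blast
  have "rect J I (levJ I n) B \<subseteq> rect J I (levJ I (max n m)) (levJ (J - I) (max n m))"
  proof -
    have "levJ I n \<subseteq> levJ I (max n m)" by (rule levJ_mono) simp
    moreover have "B \<subseteq> levJ (J - I) (max n m)" by (rule order_trans[OF B(2) levJ_mono]) simp
    ultimately show ?thesis by (rule rect_mono)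
  qed
  then have "emeasure \<theta> (rect J I (levJ I n) B) \<le> emeasure \<theta> (levJ J (max n m))"
    unfolding rect_levJ[OF I] by (rule emeasure_mono) (simp add: sets_th levJ_measurable[OF fin_J])
  then show ?thesis
    unfolding emeasure_slice[OF I levJ_measurable[OF fI] B(1)] using fin_th[of "max n m"] by (rule le_less_trans)
qed

lemma sec_action:
  assumes I: "I \<subseteq> J" "partially_invariant I" and B: "B \<in> sets (XJ (J - I))"
  shows "ergodic_int_action (slice I B) (pshift I I)"
proof
  show "pshift I I g \<in> measurable (slice I B) (slice I B)" for g
    using pshift_measurable[of I I g] by (simp cong: measurable_cong_sets)
  show "ergodic_under (pshift I I 1) (slice I B)" by (rule slice_ergodic[OF I(1) B])
  show "emeasure (slice I B) (pshift I I 1 -` A \<inter> space (slice I B)) = emeasure (slice I B) A" if "A \<in> sets (slice I B)" for A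
    using slice_invariant[OF I _ B] that by (simp add: space_slice)
qed (auto simp: space_slice pshift_add pshift_0)

text \<open>Both slices are invariant under the shift of I, the larger one is ergodic and dominates
  the smaller one, so they are proportional as measures in A.\<close>

lemma sec_proportional:
  assumes I: "I \<subseteq> J" "partially_invariant I"
    and B: "B \<in> sets (XJ (J - I))" "B' \<in> sets (XJ (J - I))" "B \<subseteq> B'" "B' \<subseteq> levJ (J - I) m"
  obtains c where "c < \<infinity>" "\<And>A. A \<in> sets (XJ I) \<Longrightarrow> emeasure \<theta> (rect J I A B) = c * emeasure \<theta> (rect J I A B')"
proof -
  have fI: "finite I" using I fin_J finite_subset by blast
  interpret S: ergodic_int_action "slice I B'" "pshift I I" by (rule sec_action[OF I B(2)])
  obtain c where c: "c < \<infinity>" "\<And>A. A \<in> sets (slice I B') \<Longrightarrow> emeasure (slice I B) A = c * emeasure (slice I B') A"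
  proof (rule S.invariant_abs_cont_proportional[of "slice I B"])
    show "sigma_finite_measure (slice I B')"
      by (rule sigma_finite_levJ[OF fI sets_slice slice_finite[OF I(1) B(2,4)]])
    show "sigma_finite_measure (slice I B)"
      by (rule sigma_finite_levJ[OF fI sets_slice slice_finite[OF I(1) B(1) order_trans[OF B(3,4)]]])
    show "sets (slice I B) = sets (slice I B')" by simp
    show "absolutely_continuous (slice I B') (slice I B)"
      unfolding absolutely_continuous_def
    proof
      fix A assume "A \<in> null_sets (slice I B')"
      then have A: "A \<in> sets (XJ I)" "emeasure (slice I B') A = 0" by (auto simp: null_sets_def)
      have "rect J I A B \<subseteq> rect J I A B'" using B(3) by (intro rect_mono subset_refl)
      then have "emeasure \<theta> (rect J I A B) = 0"
        using A(2) rect_sets[OF I(1) A(1) B(2)] sets_th unfolding emeasure_slice[OF I(1) A(1) B(2)] by (metis emeasure_eq_0)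
      then show "A \<in> null_sets (slice I B)" using A(1) emeasure_slice[OF I(1) A(1) B(1)] by (simp add: null_sets_def)
    qed
    show "emeasure (slice I B) (pshift I I g -` A \<inter> space (slice I B')) = emeasure (slice I B) A" if "A \<in> sets (slice I B')" for A g
      using slice_invariant[OF I _ B(1)] that by (simp add: space_slice)
  qed blast
  show ?thesis
    using that[OF c(1)] c(2) emeasure_slice[OF I(1) _ B(1)] emeasure_slice[OF I(1) _ B(2)] by simp
qed

text \<open>The slices over B and over level m are both proportional to the slice over the larger
  level m + n; multiplying crosswise cancels the constants without division. An unbounded B is
  exhausted by its bounded parts.\<close>

lemma rect_product:
  assumes I: "I \<subseteq> J" "partially_invariant I" and A: "A \<in> sets (XJ I)" and B: "B \<in> sets (XJ (J - I))"
  shows "emeasure \<theta> (levJ J m) * emeasure \<theta> (rect J I A B) =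
    emeasure \<theta> (rect J I A (levJ (J - I) m)) * emeasure \<theta> (rect J I (levJ I m) B)"
proof -
  have fI: "finite I" "finite (J - I)" using I fin_J finite_subset by auto
  have lI: "levJ I n \<in> sets (XJ I)" "levJ (J - I) n \<in> sets (XJ (J - I))" for n
    using fI by (simp_all add: levJ_measurable)
  have bd: "emeasure \<theta> (levJ J m) * emeasure \<theta> (rect J I A B) =
      emeasure \<theta> (rect J I A (levJ (J - I) m)) * emeasure \<theta> (rect J I (levJ I m) B)"
    if B: "B \<in> sets (XJ (J - I))" "B \<subseteq> levJ (J - I) (m + n)" for B n
  proof -
    obtain c where c: "\<And>A. A \<in> sets (XJ I) \<Longrightarrow> emeasure \<theta> (rect J I A B) = c * emeasure \<theta> (rect J I A (levJ (J - I) (m + n)))"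
      by (rule sec_proportional[OF I B(1) lI(2) B(2) subset_refl]) (rule that; assumption)
    obtain c' where c': "\<And>A. A \<in> sets (XJ I) \<Longrightarrow> emeasure \<theta> (rect J I A (levJ (J - I) m)) = c' * emeasure \<theta> (rect J I A (levJ (J - I) (m + n)))"
      by (rule sec_proportional[OF I lI(2) lI(2) levJ_mono[OF le_add1] subset_refl]) (rule that; assumption)
    show ?thesis
      unfolding rect_levJ[OF I(1), symmetric] c[OF A] c[OF lI(1)] c'[OF A] c'[OF lI(1)] by (simp only: ac_simps)
  qed
  define Bn where "Bn n = B \<inter> levJ (J - I) (m + n)" for n
  have Bn: "Bn n \<in> sets (XJ (J - I))" for n unfolding Bn_def by (intro sets.Int B lI(2))
  have lim: "emeasure \<theta> (rect J I C B) = (SUP n. emeasure \<theta> (rect J I C (Bn n)))" if C: "C \<in> sets (XJ I)" for C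
  proof -
    have "rect J I C B = (\<Union>n. rect J I C (Bn n))"
    proof (intro equalityI subsetI)
      fix x assume x: "x \<in> rect J I C B"
      then have "restrict x (J - I) \<in> (\<Union>n. levJ (J - I) n)"
        unfolding UN_levJ[OF fI(2)] by simp
      then obtain n where "restrict x (J - I) \<in> levJ (J - I) n" by blast
      then have "restrict x (J - I) \<in> levJ (J - I) (m + n)" using levJ_mono[OF le_add2, of "J - I" n m] by (rule rev_subsetD)
      then show "x \<in> (\<Union>n. rect J I C (Bn n))" using x unfolding rect_def Bn_def by blast
    qed (auto simp: rect_def Bn_def)
    moreover have "incseq (\<lambda>n. rect J I C (Bn n))"
    proof (rule incseq_SucI, rule rect_mono[OF subset_refl])
      fix n
      have "levJ (J - I) (m + n) \<subseteq> levJ (J - I) (m + Suc n)" by (rule levJ_mono) simp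
      then show "Bn n \<subseteq> Bn (Suc n)" unfolding Bn_def by (rule Int_mono[OF subset_refl])
    qed
    ultimately show ?thesis
      using rect_sets[OF I(1) C Bn] sets_th by (simp add: SUP_emeasure_incseq image_subset_iff)
  qed
  show ?thesis
    unfolding lim[OF A] lim[OF lI(1)] SUP_mult_left_ennreal
  proof (rule SUP_cong[OF refl])
    fix n
    have "Bn n \<subseteq> levJ (J - I) (m + n)" by (simp add: Bn_def)
    from bd[OF Bn this]
    show "emeasure \<theta> (levJ J m) * emeasure \<theta> (rect J I A (Bn n)) =
      emeasure \<theta> (rect J I A (levJ (J - I) m)) * emeasure \<theta> (rect J I (levJ I m) (Bn n))" .
  qed
qed

lemma slice_joining:
  assumes I: "I \<noteq> {}" "I \<subseteq> J" "partially_invariant I" and m: "0 < emeasure \<theta> (levJ J m)"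
  shows "joining I (slice I (levJ (J - I) m))"
proof -
  have fI: "finite I" "finite (J - I)" using I fin_J finite_subset by auto
  have lB: "levJ (J - I) m \<in> sets (XJ (J - I))" using fI by (simp add: levJ_measurable)
  show ?thesis
  proof
    show "emeasure (slice I (levJ (J - I) m)) (levJ I n) < \<infinity>" for n
      by (rule slice_finite[OF I(2) lB subset_refl])
    show "emeasure (slice I (levJ (J - I) m)) (pshift I I 1 -` A \<inter> spJ I) = emeasure (slice I (levJ (J - I) m)) A"
      if "A \<in> sets (XJ I)" for A by (rule slice_invariant[OF I(2,3) that lB])
    show "ergodic_under (pshift I I 1) (slice I (levJ (J - I) m))" by (rule slice_ergodic[OF I(2) lB])
    fix i and C :: "chacon set" assume i: "i \<in> I" and C: "C \<in> sets borel"
    let ?A = "{y \<in> spJ I. y i \<in> C}"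
    have iJ: "i \<in> J" using i I by blast
    have A: "?A \<in> sets (XJ I)" using pred_coord[OF i C] by (simp add: pred_def space_PiM)
    have e: "rect J I ?A (spJ (J - I)) = {x \<in> spJ J. x i \<in> C}" using i by (auto simp: rect_def)
    have em: "emeasure (slice I (levJ (J - I) m)) ?A = emeasure \<theta> (rect J I ?A (levJ (J - I) m))"
      by (rule emeasure_slice[OF I(2) A lB])
    show "emeasure (slice I (levJ (J - I) m)) ?A = 0 \<longleftrightarrow> emeasure chacon_measure C = 0"
      unfolding em marg[OF iJ C, symmetric] e[symmetric]
    proof
      \<comment> \<open>In \<open>rect_product\<close> with the full second factor the right-hand
        side vanishes, and the positive measure of \<open>levJ J m\<close> can be cancelled.\<close>
      assume "emeasure \<theta> (rect J I ?A (levJ (J - I) m)) = 0"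
      then show "emeasure \<theta> (rect J I ?A (spJ (J - I))) = 0"
        using rect_product[OF I(2,3) A spJ_sets, of m] m by (auto simp: zero_less_iff_neq_zero)
    next
      have sub: "rect J I ?A (levJ (J - I) m) \<subseteq> rect J I ?A (spJ (J - I))"
        by (rule rect_mono[OF subset_refl levJ_subset_spJ])
      have N: "rect J I ?A (spJ (J - I)) \<in> sets \<theta>"
        using rect_sets[OF I(2) A spJ_sets] sets_th by simp
      assume "emeasure \<theta> (rect J I ?A (spJ (J - I))) = 0"
      then show "emeasure \<theta> (rect J I ?A (levJ (J - I) m)) = 0"
        by (rule emeasure_eq_0[OF N _ sub])
    qed
  qed (use fI I in auto)
qed

lemma adjacent_split:
  assumes I: "I \<noteq> {}" "I \<subset> J" and freq: "AE x in \<theta>. freq_adj I x"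
  obtains \<alpha> \<beta> \<kappa> where "joining I \<alpha>" "joining (J - I) \<beta>" "0 < \<kappa>" "\<kappa> < \<infinity>"
    "\<And>A B. A \<in> sets (XJ I) \<Longrightarrow> B \<in> sets (XJ (J - I)) \<Longrightarrow> \<kappa> * emeasure \<theta> (rect J I A B) = emeasure \<alpha> A * emeasure \<beta> B"
proof -
  have IJ: "I \<subseteq> J" "J - I \<subseteq> J" "J - I \<noteq> {}" "J - (J - I) = I" using I by auto
  have p1: "partially_invariant I"
    unfolding partially_invariant_def using partial_shift_invariant[OF I freq] by blast
  have p2: "partially_invariant (J - I)"
    unfolding partially_invariant_def using vimage_complement_shift[OF IJ(1)] partial_shift_invariant[OF I freq] by simp
  obtain m where m: "0 < emeasure \<theta> (levJ J m)" using ex_levJ_pos by blast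
  have fI: "finite I" "finite (J - I)" using IJ fin_J finite_subset by auto
  show ?thesis
  proof (rule that)
    show "joining I (slice I (levJ (J - I) m))" by (rule slice_joining[OF I(1) IJ(1) p1 m])
    show "joining (J - I) (slice (J - I) (levJ I m))" using slice_joining[OF IJ(3,2) p2 m] unfolding IJ(4) .
    show "0 < emeasure \<theta> (levJ J m)" by (rule m)
    show "emeasure \<theta> (levJ J m) < \<infinity>" by (rule fin_th)
    fix A B assume A: "A \<in> sets (XJ I)" and B: "B \<in> sets (XJ (J - I))"
    have "emeasure (slice (J - I) (levJ I m)) B = emeasure \<theta> (rect J I (levJ I m) B)"
      using emeasure_slice[OF IJ(2) B, of "levJ I m"] rect_swap[OF IJ(1)] levJ_measurable[OF fI(1)] unfolding IJ(4) by simp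
    then show "emeasure \<theta> (levJ J m) * emeasure \<theta> (rect J I A B) =
        emeasure (slice I (levJ (J - I) m)) A * emeasure (slice (J - I) (levJ I m)) B"
      using rect_product[OF IJ(1) p1 A B, of m] emeasure_slice[OF IJ(1) A levJ_measurable[OF fI(2)]] by simp
  qed
qed

end

section \<open>Products of graph measures and the induction on the number of coordinates\<close>

definition graph_map :: "nat set \<Rightarrow> (nat \<Rightarrow> int) \<Rightarrow> chacon \<Rightarrow> nat \<Rightarrow> chacon" where
  "graph_map K k z = (\<lambda>i\<in>K. chacon_T (k i) z)"

lemma graph_map_measurable: "graph_map K k \<in> measurable borel (XJ K)"
  unfolding graph_map_def[abs_def] by (rule measurable_restrict) simp

text \<open>One function k serves all blocks and one constant c absorbs all scalars, so that gluing
  two products only means to unite partitions and patch k. Inside a block only differences of k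
  matter, as the measure is invariant.\<close>

definition graph_product :: "nat set \<Rightarrow> (nat \<Rightarrow> chacon) measure \<Rightarrow> nat set set \<Rightarrow> (nat \<Rightarrow> int) \<Rightarrow> ennreal \<Rightarrow> bool" where
  "graph_product J \<theta> P k c \<longleftrightarrow> partition_on J P \<and> 0 < c \<and> c < \<infinity> \<and>
    (\<forall>A. (\<forall>K\<in>P. A K \<in> sets (XJ K)) \<longrightarrow>
      emeasure \<theta> {x \<in> spJ J. \<forall>K\<in>P. restrict x K \<in> A K} = c * (\<Prod>K\<in>P. emeasure chacon_measure (graph_map K k -` A K)))"

lemma graph_product_Un:
  assumes J: "finite J" "I \<subseteq> J" and \<kappa>: "0 < \<kappa>" "\<kappa> < \<infinity>"
    and prod: "\<And>A B. A \<in> sets (XJ I) \<Longrightarrow> B \<in> sets (XJ (J - I)) \<Longrightarrow> \<kappa> * emeasure \<theta> (rect J I A B) = emeasure \<alpha> A * emeasure \<beta> B"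
    and a: "graph_product I \<alpha> P1 k1 c1" and b: "graph_product (J - I) \<beta> P2 k2 c2"
  shows "graph_product J \<theta> (P1 \<union> P2) (\<lambda>i. if i \<in> I then k1 i else k2 i) (c1 * c2 / \<kappa>)"
proof -
  let ?k = "\<lambda>i. if i \<in> I then k1 i else k2 i"
  have P: "partition_on I P1" "partition_on (J - I) P2" using a b by (auto simp: graph_product_def)
  have c: "0 < c1" "c1 < \<infinity>" "0 < c2" "c2 < \<infinity>" using a b by (auto simp: graph_product_def)
  have sub: "K \<subseteq> I" "K \<noteq> {}" if "K \<in> P1" for K using P(1) that by (auto simp: partition_on_def)
  have sub': "K \<subseteq> J - I" "K \<noteq> {}" if "K \<in> P2" for K using P(2) that by (auto simp: partition_on_def)
  have fin: "finite P1" "finite P2"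
    using finite_elements[OF _ P(1)] finite_elements[OF _ P(2)] finite_subset[OF J(2,1)] J by auto
  have disj: "P1 \<inter> P2 = {}" using sub sub' by blast
  have part: "partition_on J (P1 \<union> P2)"
    unfolding partition_on_def
  proof (intro conjI)
    show "\<Union>(P1 \<union> P2) = J" using P J(2) by (auto simp: partition_on_def)
    show "{} \<notin> P1 \<union> P2" using sub sub' by blast
    have d1: "p \<inter> q = {}" if "p \<in> P1" "q \<in> P1" "p \<noteq> q" for p q
      using P(1) that by (auto simp: partition_on_def disjoint_def)
    have d2: "p \<inter> q = {}" if "p \<in> P2" "q \<in> P2" "p \<noteq> q" for p q
      using P(2) that by (auto simp: partition_on_def disjoint_def)
    have d3: "p \<inter> q = {}" if "p \<in> P1" "q \<in> P2" for p q
      using sub(1)[OF that(1)] sub'(1)[OF that(2)] by blast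
    show "disjoint (P1 \<union> P2)"
      unfolding disjoint_def
    proof (intro ballI impI)
      fix p q assume pq: "p \<in> P1 \<union> P2" "q \<in> P1 \<union> P2" "p \<noteq> q"
      from pq(1,2) consider "p \<in> P1" "q \<in> P1" | "p \<in> P1" "q \<in> P2" | "q \<in> P1" "p \<in> P2" | "p \<in> P2" "q \<in> P2"
        by (elim UnE)
      then show "p \<inter> q = {}"
      proof cases
        case 1 then show ?thesis by (rule d1[OF _ _ pq(3)])
      next
        case 2 then show ?thesis by (rule d3)
      next
        case 3 then show ?thesis by (subst Int_commute) (rule d3)
      next
        case 4 then show ?thesis by (rule d2[OF _ _ pq(3)])
      qed
    qed
  qed
  have "emeasure \<theta> {x \<in> spJ J. \<forall>K\<in>P1 \<union> P2. restrict x K \<in> A K} =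
      c1 * c2 / \<kappa> * (\<Prod>K\<in>P1 \<union> P2. emeasure chacon_measure (graph_map K ?k -` A K))"
    if A: "\<forall>K\<in>P1 \<union> P2. A K \<in> sets (XJ K)" for A
  proof -
    let ?A = "{y \<in> spJ I. \<forall>K\<in>P1. restrict y K \<in> A K}" and ?B = "{y \<in> spJ (J - I). \<forall>K\<in>P2. restrict y K \<in> A K}"
    have ms: "{y \<in> spJ L. \<forall>K\<in>Q. restrict y K \<in> A K} \<in> sets (XJ L)"
      if "finite Q" "\<And>K. K \<in> Q \<Longrightarrow> K \<subseteq> L" "\<And>K. K \<in> Q \<Longrightarrow> A K \<in> sets (XJ K)" for L Q
    proof -
      have "{y \<in> space (XJ L). \<forall>K\<in>Q. restrict y K \<in> A K} \<in> sets (XJ L)"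
      proof (rule sets.sets_Collect_finite_All[OF _ that(1)])
        fix K assume K: "K \<in> Q"
        have "(\<lambda>y. restrict y K) -` A K \<inter> space (XJ L) \<in> sets (XJ L)"
          by (rule measurable_sets[OF restrict_measurable[OF that(2)[OF K]] that(3)[OF K]])
        then show "{y \<in> space (XJ L). restrict y K \<in> A K} \<in> sets (XJ L)" by (simp add: vimage_def Int_def conj_commute)
      qed
      then show ?thesis by (simp add: space_PiM)
    qed
    have mA: "?A \<in> sets (XJ I)" by (rule ms) (use fin sub A in auto)
    have mB: "?B \<in> sets (XJ (J - I))" by (rule ms) (use fin sub' A in auto)
    have "{x \<in> spJ J. \<forall>K\<in>P1 \<union> P2. restrict x K \<in> A K} = rect J I ?A ?B"
    proof -
      have "restrict (restrict x I) K = restrict x K" if "K \<in> P1" for x :: "nat \<Rightarrow> chacon" and K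
        using sub(1)[OF that] by (simp add: Int_absorb1)
      moreover have "restrict (restrict x (J - I)) K = restrict x K" if "K \<in> P2" for x :: "nat \<Rightarrow> chacon" and K
        using sub'(1)[OF that] by (simp add: Int_absorb1)
      ultimately show ?thesis by (auto simp: rect_def simp del: restrict_restrict)
    qed
    then have "\<kappa> * emeasure \<theta> {x \<in> spJ J. \<forall>K\<in>P1 \<union> P2. restrict x K \<in> A K} = emeasure \<alpha> ?A * emeasure \<beta> ?B"
      using prod[OF mA mB] by simp
    also have "emeasure \<alpha> ?A = c1 * (\<Prod>K\<in>P1. emeasure chacon_measure (graph_map K k1 -` A K))"
      using a A unfolding graph_product_def by blast
    also have "\<dots> = c1 * (\<Prod>K\<in>P1. emeasure chacon_measure (graph_map K ?k -` A K))"
    proof -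
      have "graph_map K k1 = graph_map K ?k" if "K \<in> P1" for K using sub(1)[OF that] by (auto simp: graph_map_def fun_eq_iff)
      then show ?thesis by simp
    qed
    also have "emeasure \<beta> ?B = c2 * (\<Prod>K\<in>P2. emeasure chacon_measure (graph_map K k2 -` A K))"
      using b A unfolding graph_product_def by blast
    also have "\<dots> = c2 * (\<Prod>K\<in>P2. emeasure chacon_measure (graph_map K ?k -` A K))"
    proof -
      have "graph_map K k2 = graph_map K ?k" if "K \<in> P2" for K using sub'(1)[OF that] by (auto simp: graph_map_def fun_eq_iff)
      then show ?thesis by simp
    qed
    finally have eq: "\<kappa> * emeasure \<theta> {x \<in> spJ J. \<forall>K\<in>P1 \<union> P2. restrict x K \<in> A K} =
        c1 * c2 * (\<Prod>K\<in>P1 \<union> P2. emeasure chacon_measure (graph_map K ?k -` A K))"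
      by (simp only: prod.union_disjoint[OF fin disj] ac_simps)
    have "emeasure \<theta> {x \<in> spJ J. \<forall>K\<in>P1 \<union> P2. restrict x K \<in> A K} =
        emeasure \<theta> {x \<in> spJ J. \<forall>K\<in>P1 \<union> P2. restrict x K \<in> A K} * \<kappa> / \<kappa>"
      using \<kappa> by (simp add: mult_divide_eq_ennreal)
    then show ?thesis
      using eq by (simp add: divide_ennreal_def ac_simps)
  qed
  moreover have "0 < c1 * c2 / \<kappa>"
    using c \<kappa> by (auto simp: ennreal_zero_less_divide ennreal_zero_less_mult_iff)
  moreover have "c1 * c2 / \<kappa> < \<infinity>"
  proof -
    have "c1 * c2 \<noteq> \<top>" using c by (auto simp: ennreal_mult_eq_top_iff)
    then have "c1 * c2 / \<kappa> \<noteq> \<top>" using \<kappa> by (auto simp: ennreal_divide_eq_top_iff)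
    then show ?thesis by (simp add: less_top)
  qed
  ultimately show ?thesis using part unfolding graph_product_def by blast
qed

theorem joining_graph_product:
  assumes "joining J \<theta>"
  shows "\<exists>P k c. graph_product J \<theta> P k c"
  using assms
proof (induction "card J" arbitrary: J \<theta> rule: less_induct)
  case less
  interpret joining J \<theta> by (rule less.prems)
  show ?case
  proof (cases rule: dichotomy)
    case (adjacent I)
    obtain \<alpha> \<beta> \<kappa> where s: "joining I \<alpha>" "joining (J - I) \<beta>" "0 < \<kappa>" "\<kappa> < \<infinity>"
      "\<And>A B. A \<in> sets (XJ I) \<Longrightarrow> B \<in> sets (XJ (J - I)) \<Longrightarrow> \<kappa> * emeasure \<theta> (rect J I A B) = emeasure \<alpha> A * emeasure \<beta> B"
      by (rule adjacent_split[OF adjacent]) (rule that; assumption)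
    have "card I < card J" "card (J - I) < card J"
      using adjacent(1,2) fin_J by (auto intro!: psubset_card_mono)
    with less.hyps s(1,2) obtain P1 k1 c1 P2 k2 c2 where
      "graph_product I \<alpha> P1 k1 c1" "graph_product (J - I) \<beta> P2 k2 c2" by metis
    from graph_product_Un[OF fin_J _ s(3,4,5) this] adjacent(2) show ?thesis by blast
  next
    case (tame m)
    obtain i0 where i0: "i0 \<in> J" using ne_J by blast
    obtain k where k: "AE x in \<theta>. \<forall>i\<in>J. x i = chacon_T (k i) (x i0)" using tame_graph[OF tame i0] by blast
    obtain c where c: "0 < c" "c < \<infinity>"
      "\<And>A. A \<in> sets (XJ J) \<Longrightarrow> emeasure \<theta> A = c * emeasure chacon_measure {z. (\<lambda>i\<in>J. chacon_T (k i) z) \<in> A}"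
      by (rule graph_measure[OF i0 k]) (rule that; assumption)
    have "emeasure \<theta> {x \<in> spJ J. restrict x J \<in> A} = c * emeasure chacon_measure (graph_map J k -` A)" if A: "A \<in> sets (XJ J)" for A
    proof -
      have "{x \<in> spJ J. restrict x J \<in> A} = A"
        using sets.sets_into_space[OF A] by (auto simp: space_PiM PiE_restrict)
      then show ?thesis using c(3)[OF A] by (simp add: graph_map_def vimage_def)
    qed
    then have "graph_product J \<theta> {J} k c"
      using c ne_J by (simp add: graph_product_def partition_on_space)
    then show ?thesis by blast
  qed
qed

section \<open>Graph joinings and the centralizer\<close>

lemma emeasure_graph_map_levJ:
  assumes "i \<in> K" "finite K"
  shows "emeasure chacon_measure (graph_map K k -` levJ K n) < \<infinity>"
proof -
  have "graph_map K k -` levJ K n \<subseteq> chacon_T (k i) -` lev n" using assms(1) by (auto simp: graph_map_def PiE_iff)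
  moreover have "chacon_T (k i) -` lev n \<in> sets chacon_measure"
    using measurable_sets[OF T_measurable lev_measurable, of "k i" n] by simp
  ultimately have "emeasure chacon_measure (graph_map K k -` levJ K n) \<le> emeasure chacon_measure (chacon_T (k i) -` lev n)"
    by (rule emeasure_mono)
  then show ?thesis using emeasure_T[OF lev_measurable, of "k i" n] emeasure_lev_finite[of n] by simp
qed

definition graph_measure_on :: "nat set \<Rightarrow> (nat \<Rightarrow> int) \<Rightarrow> (nat \<Rightarrow> chacon) measure" where
  "graph_measure_on K k = distr chacon_measure (XJ K) (graph_map K k)"

lemma sets_graph_measure_on[simp]: "sets (graph_measure_on K k) = sets (XJ K)"
  by (simp add: graph_measure_on_def)

lemma emeasure_graph_measure_on:
  "A \<in> sets (XJ K) \<Longrightarrow> emeasure (graph_measure_on K k) A = emeasure chacon_measure (graph_map K k -` A)"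
  unfolding graph_measure_on_def using graph_map_measurable[of K k]
  by (simp add: emeasure_distr cong: measurable_cong_sets)

lemma T_measure_preserving: "distr chacon_measure chacon_measure (chacon_T g) = chacon_measure"
  by (rule measure_eqI) (auto simp: emeasure_distr emeasure_T)

lemma T_centralizer: "chacon_T n \<in> centralizer chacon_measure (chacon_T 1)"
  unfolding centralizer_def invertible_nonsingular_def
proof (intro CollectI conjI)
  show m: "chacon_T g \<in> measurable chacon_measure chacon_measure" for g
    using T_measurable by (simp cong: measurable_cong_sets)
  show "\<exists>R\<in>chacon_measure \<rightarrow>\<^sub>M chacon_measure.
      (AE x in chacon_measure. R (chacon_T n x) = x) \<and> (AE x in chacon_measure. chacon_T n (R x) = x)"
    by (intro bexI[of _ "chacon_T (- n)"] m) simp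
  show "null_sets (distr chacon_measure chacon_measure (chacon_T n)) = null_sets chacon_measure"
    by (simp only: T_measure_preserving)
  show "AE x in chacon_measure. chacon_T n (chacon_T 1 x) = chacon_T 1 (chacon_T n x)"
    by (rule AE_I2) (simp add: T_add add.commute)
qed

text \<open>A graph joining has the identity at the least index. Pulling out the common shift by
  \<open>k (Min K)\<close>, which preserves the measure, leaves the differences of k as the maps
  S.\<close>

lemma graph_joining_graph_measure_on:
  assumes K: "finite K" "K \<noteq> {}"
  shows "graph_joining K chacon_measure (chacon_T 1) (graph_measure_on K k)"
proof -
  define S where "S j = (if j = Min K then id else chacon_T (k j - k (Min K)))" for j
  have S: "S j = chacon_T (k j - k (Min K))" for j by (auto simp: S_def)
  have "emeasure (graph_measure_on K k) (Pi\<^sub>E K A) = emeasure chacon_measure (\<Inter>j\<in>K. S j -` A j \<inter> space chacon_measure)"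
    if A: "A \<in> K \<rightarrow> sets chacon_measure" for A
  proof -
    have PA: "Pi\<^sub>E K A \<in> sets (XJ K)" using A by (intro sets_PiM_I_finite K) auto
    have m: "(\<Inter>j\<in>K. S j -` A j) \<in> sets borel"
    proof (rule sets.finite_INT[OF K])
      fix j assume "j \<in> K"
      then have "A j \<in> sets borel" using A by auto
      then show "S j -` A j \<in> sets borel" unfolding S using measurable_sets[OF T_measurable] by fastforce
    qed
    have "graph_map K k -` Pi\<^sub>E K A = chacon_T (k (Min K)) -` (\<Inter>j\<in>K. S j -` A j)"
      by (auto simp: graph_map_def S T_add PiE_iff)
    then show ?thesis using emeasure_T[OF m, of "k (Min K)"] emeasure_graph_measure_on[OF PA, of k] by simp
  qed
  moreover have "S (Min K) = id" by (simp add: S_def)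
  moreover have "S j \<in> centralizer chacon_measure (chacon_T 1)" for j unfolding S by (rule T_centralizer)
  moreover have "sets (graph_measure_on K k) = sets (borel_of (pow_top K))" by (simp add: sets_borel_of_pow_top K)
  ultimately show ?thesis
    unfolding graph_joining_def by blast
qed

lemma graph_product_imp_product_of_graph_joinings:
  assumes d: "d \<ge> 1" and th: "sets \<theta> = sets (XJ {1..d})" and g: "graph_product {1..d} \<theta> P k c"
  shows "product_of_graph_joinings d chacon_measure (chacon_T 1) \<theta>"
proof -
  have P: "partition_on {1..d} P" and c: "0 < c" "c < \<infinity>" using g by (auto simp: graph_product_def)
  have K: "K \<subseteq> {1..d}" "K \<noteq> {}" "finite K" if "K \<in> P" for K
  proof -
    show s: "K \<subseteq> {1..d}" using P that by (auto simp: partition_on_def)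
    show "K \<noteq> {}" using P that by (auto simp: partition_on_def)
    show "finite K" using s finite_subset by blast
  qed
  have fP: "finite P" using finite_elements[OF _ P] by simp
  have "P \<noteq> {}" using P d by (auto simp: partition_on_def)
  then obtain K0 where K0: "K0 \<in> P" by blast
  \<comment> \<open>The single constant c is charged to one block; the other blocks get 1.\<close>
  define cc where "cc K = (if K = K0 then c else 1)" for K
  have cc: "0 < cc K" "cc K < \<infinity>" for K using c by (auto simp: cc_def)
  \<comment> \<open>The null measure off P is a filler: \<open>product_sigma_finite\<close> asks for
    sigma-finiteness at every index.\<close>
  define \<nu> where "\<nu> K = (if K \<in> P then scale_measure (cc K) (graph_measure_on K k) else null_measure (XJ K))" for K
  have snu: "sets (\<nu> K) = sets (XJ K)" for K by (simp add: \<nu>_def)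
  have sf: "sigma_finite_measure (\<nu> K)" for K
  proof (cases "K \<in> P")
    case True
    obtain i where i: "i \<in> K" using K(2)[OF True] by blast
    show ?thesis
    proof (rule sigma_finite_levJ[OF K(3)[OF True] snu])
      show "emeasure (\<nu> K) (levJ K n) < \<infinity>" for n
        using emeasure_graph_map_levJ[OF i K(3)[OF True], of k n] cc(2)[of K] True
        by (simp add: \<nu>_def emeasure_graph_measure_on levJ_measurable K(3) ennreal_mult_less_top)
    qed
  next
    case False
    interpret finite_measure "\<nu> K" using False by (intro finite_measureI) (simp add: \<nu>_def)
    show ?thesis by unfold_locales
  qed
  interpret product_sigma_finite \<nu> by (rule product_sigma_finite.intro) (rule sf)
  let ?g = "\<lambda>x. \<lambda>K\<in>P. restrict x K"
  have gm: "?g \<in> measurable \<theta> (Pi\<^sub>M P \<nu>)"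
  proof (rule measurable_restrict)
    fix L assume "L \<in> P"
    then have "(\<lambda>x. restrict x L) \<in> measurable (XJ {1..d}) (XJ L)" using restrict_measurable K(1) by blast
    then show "(\<lambda>x. restrict x L) \<in> measurable \<theta> (\<nu> L)" using th snu measurable_cong_sets by blast
  qed
  have sp: "space \<theta> = spJ {1..d}" using sets_eq_imp_space_eq[OF th] by (simp add: space_PiM)
  have "distr \<theta> (Pi\<^sub>M P \<nu>) ?g = Pi\<^sub>M P \<nu>"
  proof (rule PiM_eqI[OF fP])
    fix A assume A: "\<And>K. K \<in> P \<Longrightarrow> A K \<in> sets (\<nu> K)"
    then have A': "\<And>K. K \<in> P \<Longrightarrow> A K \<in> sets (XJ K)" by (simp add: snu)
    have "emeasure (distr \<theta> (Pi\<^sub>M P \<nu>) ?g) (Pi\<^sub>E P A) = emeasure \<theta> (?g -` Pi\<^sub>E P A \<inter> space \<theta>)"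
      by (rule emeasure_distr[OF gm]) (rule sets_PiM_I_finite[OF fP A])
    also have "?g -` Pi\<^sub>E P A \<inter> space \<theta> = {x \<in> spJ {1..d}. \<forall>K\<in>P. restrict x K \<in> A K}"
      unfolding sp by (rule set_eqI) (simp only: vimage_eq Int_iff restrict_PiE_iff mem_Collect_eq, blast)
    also have "emeasure \<theta> \<dots> = c * (\<Prod>K\<in>P. emeasure chacon_measure (graph_map K k -` A K))"
      using g A' unfolding graph_product_def by blast
    also have "c = (\<Prod>K\<in>P. cc K)" unfolding cc_def using K0 fP by simp
    also have "(\<Prod>K\<in>P. cc K) * (\<Prod>K\<in>P. emeasure chacon_measure (graph_map K k -` A K)) = (\<Prod>K\<in>P. emeasure (\<nu> K) (A K))"
      unfolding prod.distrib[symmetric] by (intro prod.cong refl) (simp add: \<nu>_def emeasure_graph_measure_on A')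
    finally show "emeasure (distr \<theta> (Pi\<^sub>M P \<nu>) ?g) (Pi\<^sub>E P A) = (\<Prod>K\<in>P. emeasure (\<nu> K) (A K))" .
  qed simp
  moreover have "sets (\<nu> K) = sets (borel_of (pow_top K)) \<and>
      (\<exists>c::ennreal. 0 < c \<and> c < \<infinity> \<and>
        (if card K > 1 then \<exists>\<kappa>. graph_joining K chacon_measure (chacon_T 1) \<kappa> \<and> \<nu> K = scale_measure c \<kappa>
         else \<forall>i\<in>K. distr (\<nu> K) chacon_measure (\<lambda>x. x i) = scale_measure c chacon_measure))" if KP: "K \<in> P" for K
  proof (intro conjI exI[of _ "cc K"] cc)
    show "sets (\<nu> K) = sets (borel_of (pow_top K))" using snu sets_borel_of_pow_top[OF K(3)[OF KP]] by simp
    have nu: "\<nu> K = scale_measure (cc K) (graph_measure_on K k)" using KP by (simp add: \<nu>_def)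
    have "distr (\<nu> K) chacon_measure (\<lambda>x. x i) = scale_measure (cc K) chacon_measure" if i: "i \<in> K" for i
    proof (rule measure_eqI)
      fix A assume "A \<in> sets (distr (\<nu> K) chacon_measure (\<lambda>x. x i))"
      then have A: "A \<in> sets borel" by simp
      have m: "(\<lambda>x. x i) \<in> measurable (\<nu> K) chacon_measure"
        using measurable_component_singleton[OF i, of "\<lambda>_. borel :: chacon measure"] snu
        by (simp cong: measurable_cong_sets)
      have spn: "space (\<nu> K) = spJ K" using sets_eq_imp_space_eq[OF snu] by (simp add: space_PiM)
      have S: "{x \<in> spJ K. x i \<in> A} \<in> sets (XJ K)" using pred_coord[OF i A] by (simp add: pred_def space_PiM)
      have "emeasure (distr (\<nu> K) chacon_measure (\<lambda>x. x i)) A = emeasure (\<nu> K) {x \<in> spJ K. x i \<in> A}"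
        using A m by (simp add: emeasure_distr spn vimage_def Int_def conj_commute)
      also have "\<dots> = cc K * emeasure chacon_measure (graph_map K k -` {x \<in> spJ K. x i \<in> A})"
        unfolding nu by (simp add: emeasure_graph_measure_on[OF S])
      also have "graph_map K k -` {x \<in> spJ K. x i \<in> A} = chacon_T (k i) -` A" using i by (auto simp: graph_map_def)
      finally show "emeasure (distr (\<nu> K) chacon_measure (\<lambda>x. x i)) A = emeasure (scale_measure (cc K) chacon_measure) A"
        by (simp add: emeasure_T[OF A])
    qed simp
    then show "if card K > 1 then \<exists>\<kappa>. graph_joining K chacon_measure (chacon_T 1) \<kappa> \<and> \<nu> K = scale_measure (cc K) \<kappa>
         else \<forall>i\<in>K. distr (\<nu> K) chacon_measure (\<lambda>x. x i) = scale_measure (cc K) chacon_measure"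
      using graph_joining_graph_measure_on[OF K(3,2)[OF KP], of k] nu by auto
  qed
  ultimately show ?thesis
    unfolding product_of_graph_joinings_def using P by blast
qed

lemma joiningI:
  assumes d: "d \<ge> 1" and th: "\<theta> \<in> ergodic_radon_self_joinings d chacon_measure (chacon_T 1)"
  shows "joining {1..d} \<theta>"
proof -
  have r: "sets \<theta> = sets (XJ {1..d})" "\<And>n. emeasure \<theta> (levJ {1..d} n) < \<infinity>"
    "invariant_under (pshift {1..d} {1..d} 1) \<theta>" "ergodic_under (pshift {1..d} {1..d} 1) \<theta>"
    "\<And>i. i \<in> {1..d} \<Longrightarrow> null_sets (distr \<theta> chacon_measure (\<lambda>x. x i)) = null_sets chacon_measure"
    using th unfolding ergodic_radon_self_joinings_def radon_self_joining_def pshift_diag[symmetric]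
    by (auto simp: radon_on_iff)
  have sp: "space \<theta> = spJ {1..d}" using sets_eq_imp_space_eq[OF r(1)] by (simp add: space_PiM)
  show ?thesis
  proof
    show "emeasure \<theta> (pshift {1..d} {1..d} 1 -` A \<inter> spJ {1..d}) = emeasure \<theta> A" if "A \<in> sets (XJ {1..d})" for A
      using r(3) that by (simp add: invariant_under_def r(1) sp)
    fix i and A :: "chacon set" assume i: "i \<in> {1..d}" and A: "A \<in> sets borel"
    have m: "(\<lambda>x. x i) \<in> measurable \<theta> chacon_measure"
      using measurable_component_singleton[OF i, of "\<lambda>_. borel :: chacon measure"] r(1)
      by (simp cong: measurable_cong_sets)
    have "emeasure \<theta> {x \<in> spJ {1..d}. x i \<in> A} = 0 \<longleftrightarrow> A \<in> null_sets (distr \<theta> chacon_measure (\<lambda>x. x i))"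
      using m A by (simp add: null_sets_def emeasure_distr sp vimage_def Int_def conj_commute)
    also have "\<dots> \<longleftrightarrow> emeasure chacon_measure A = 0"
      unfolding r(5)[OF i] using A by (simp add: null_sets_def)
    finally show "emeasure \<theta> {x \<in> spJ {1..d}. x i \<in> A} = 0 \<longleftrightarrow> emeasure chacon_measure A = 0" .
  qed (use r d in auto)
qed

section \<open>The centralizer\<close>

lemma AE_T:
  assumes "AE x in chacon_measure. P x"
  shows "AE x in chacon_measure. P (chacon_T g x)"
proof -
  have "AE x in distr chacon_measure chacon_measure (chacon_T g). P x"
    unfolding T_measure_preserving by (rule assms)
  then show ?thesis
    using T_measurable by (intro AE_distrD[of _ chacon_measure chacon_measure]) (simp_all cong: measurable_cong_sets)
qed

lemma chacon_measure_ergodic_T1: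
  assumes A: "A \<in> sets borel" "AE x in chacon_measure. chacon_T 1 x \<in> A \<longleftrightarrow> x \<in> A"
  shows "emeasure chacon_measure A = 0 \<or> emeasure chacon_measure (- A) = 0"
proof (rule chacon_measure_ergodic[OF A(1)])
  fix g
  have "AE x in chacon_measure. \<forall>h. chacon_T (1 + h) x \<in> A \<longleftrightarrow> chacon_T h x \<in> A"
    unfolding AE_all_countable using AE_T[OF A(2)] by (simp add: T_add)
  then show "AE x in chacon_measure. chacon_T g x \<in> A \<longleftrightarrow> x \<in> A"
  proof eventually_elim
    case (elim x)
    show ?case
    proof (induction g rule: int_induct[where k = 0])
      case (step1 i)
      then show ?case using elim[rule_format, of i] by (simp add: add.commute)
    next
      case (step2 i)
      then show ?case using elim[rule_format, of "i - 1"] by simp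
    qed simp
  qed
qed

text \<open>The image of the measure on the graph of S is a joining of two coordinates, so it is a
  product of graph measures. A single block makes S a power; two blocks give a product measure,
  which cannot live on a graph.\<close>

lemma centralizer_is_power:
  assumes S: "S \<in> centralizer chacon_measure (chacon_T 1)"
  shows "\<exists>n. AE x in chacon_measure. S x = chacon_T n x"
proof -
  let ?J = "{1, 2 :: nat}"
  have Sm: "S \<in> borel_measurable borel"
    using S by (simp add: centralizer_def invertible_nonsingular_def cong: measurable_cong_sets)
  have Sn: "emeasure chacon_measure (S -` A) = 0 \<longleftrightarrow> emeasure chacon_measure A = 0" if A: "A \<in> sets borel" for A
  proof -
    have "A \<in> null_sets (distr chacon_measure chacon_measure S) \<longleftrightarrow> A \<in> null_sets chacon_measure"
      using S by (simp add: centralizer_def invertible_nonsingular_def)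
    then show ?thesis using A Sm by (simp add: null_sets_def emeasure_distr cong: measurable_cong_sets)
  qed
  have ST: "AE x in chacon_measure. S (chacon_T 1 x) = chacon_T 1 (S x)" using S by (simp add: centralizer_def)
  have SA: "S -` A \<in> sets borel" if "A \<in> sets borel" for A using measurable_sets[OF Sm that] by simp
  define \<phi> where "\<phi> x = (\<lambda>i\<in>?J. if i = 1 then x else S x)" for x
  have \<phi>m: "\<phi> \<in> measurable borel (XJ ?J)"
    unfolding \<phi>_def[abs_def] by (rule measurable_restrict) (use Sm in auto)
  have \<phi>s: "\<phi> -` A \<in> sets borel" if "A \<in> sets (XJ ?J)" for A using measurable_sets[OF \<phi>m that] by simp
  define \<theta> where "\<theta> = distr chacon_measure (XJ ?J) \<phi>"
  have em: "emeasure \<theta> A = emeasure chacon_measure (\<phi> -` A)" if "A \<in> sets (XJ ?J)" for A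
    unfolding \<theta>_def using \<phi>m that by (simp add: emeasure_distr cong: measurable_cong_sets)
  have \<phi>T: "AE x in chacon_measure. pshift ?J ?J 1 (\<phi> x) = \<phi> (chacon_T 1 x)"
    using ST by eventually_elim (auto simp: pshift_def \<phi>_def fun_eq_iff)
  have \<phi>sp: "\<phi> x \<in> spJ ?J" for x by (simp add: \<phi>_def)
  have sth: "sets \<theta> = sets (XJ ?J)" by (simp add: \<theta>_def)
  have "joining ?J \<theta>"
  proof
    show "emeasure \<theta> (levJ ?J n) < \<infinity>" for n
    proof -
      have fJ: "finite ?J" by simp
      have "\<phi> -` levJ ?J n \<subseteq> lev n" by (auto simp: \<phi>_def PiE_iff)
      then have "emeasure \<theta> (levJ ?J n) \<le> emeasure chacon_measure (lev n)"
        unfolding em[OF levJ_measurable[OF fJ]] by (rule emeasure_mono) simp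
      then show ?thesis using emeasure_lev_finite[of n] by (rule le_less_trans)
    qed
    have pre: "pshift ?J ?J 1 -` A \<inter> spJ ?J \<in> sets (XJ ?J)" if "A \<in> sets (XJ ?J)" for A
      using measurable_sets[OF pshift_measurable that, of ?J 1] by (simp add: space_PiM)
    show "emeasure \<theta> (pshift ?J ?J 1 -` A \<inter> spJ ?J) = emeasure \<theta> A" if A: "A \<in> sets (XJ ?J)" for A
    proof -
      have "emeasure \<theta> (pshift ?J ?J 1 -` A \<inter> spJ ?J) = emeasure chacon_measure (\<phi> -` (pshift ?J ?J 1 -` A \<inter> spJ ?J))"
        by (rule em[OF pre[OF A]])
      also have "\<dots> = emeasure chacon_measure (chacon_T 1 -` (\<phi> -` A))"
      proof (rule emeasure_eq_AE)
        show "AE x in chacon_measure. x \<in> \<phi> -` (pshift ?J ?J 1 -` A \<inter> spJ ?J) \<longleftrightarrow> x \<in> chacon_T 1 -` (\<phi> -` A)"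
          using \<phi>T by eventually_elim (simp del: One_nat_def add: \<phi>sp)
        show "\<phi> -` (pshift ?J ?J 1 -` A \<inter> spJ ?J) \<in> sets chacon_measure" using \<phi>s[OF pre[OF A]] by simp
        show "chacon_T 1 -` (\<phi> -` A) \<in> sets chacon_measure" using measurable_sets[OF T_measurable \<phi>s[OF A], of 1] by simp
      qed
      also have "\<dots> = emeasure \<theta> A" using emeasure_T[OF \<phi>s[OF A]] em[OF A] by simp
      finally show ?thesis .
    qed
    show "ergodic_under (pshift ?J ?J 1) \<theta>"
      unfolding ergodic_under_def
    proof (intro ballI impI)
      fix A assume A0: "A \<in> sets \<theta>" and inv: "pshift ?J ?J 1 -` A \<inter> space \<theta> = A"
      have sp: "space \<theta> = spJ ?J" using sets_eq_imp_space_eq[OF sth] by (simp add: space_PiM)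
      have A: "A \<in> sets (XJ ?J)" using A0 sth by simp
      have Ac: "spJ ?J - A \<in> sets (XJ ?J)" using A spJ_sets by auto
      have "AE x in chacon_measure. chacon_T 1 x \<in> \<phi> -` A \<longleftrightarrow> x \<in> \<phi> -` A"
        using \<phi>T
      proof eventually_elim
        case (elim x)
        have "\<phi> x \<in> A \<longleftrightarrow> pshift ?J ?J 1 (\<phi> x) \<in> A" using inv \<phi>sp[of x] unfolding sp by blast
        then show ?case using elim by simp
      qed
      from chacon_measure_ergodic_T1[OF \<phi>s[OF A] this]
      have "emeasure \<theta> A = 0 \<or> emeasure \<theta> (spJ ?J - A) = 0"
      proof -
        have "\<phi> -` (spJ ?J - A) = - (\<phi> -` A)" using \<phi>sp by auto
        then show "emeasure chacon_measure (\<phi> -` A) = 0 \<or> emeasure chacon_measure (- (\<phi> -` A)) = 0 \<Longrightarrow> ?thesis"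
          using em[OF A] em[OF Ac] by simp
      qed
      then show "A \<in> null_sets \<theta> \<or> space \<theta> - A \<in> null_sets \<theta>"
        using A Ac sth by (auto simp: null_sets_def sp)
    qed
    fix i and A :: "chacon set" assume i: "i \<in> ?J" and A: "A \<in> sets borel"
    have "{x \<in> spJ ?J. x i \<in> A} \<in> sets (XJ ?J)" using pred_coord[OF i A] by (simp add: pred_def space_PiM)
    moreover have "\<phi> -` {x \<in> spJ ?J. x i \<in> A} = (if i = 1 then A else S -` A)"
      using i \<phi>sp by (auto simp: \<phi>_def)
    ultimately show "emeasure \<theta> {x \<in> spJ ?J. x i \<in> A} = 0 \<longleftrightarrow> emeasure chacon_measure A = 0"
      using em Sn[OF A] by simp
  qed (simp_all add: sth)
  from joining_graph_product[OF this] obtain P k c where g: "graph_product ?J \<theta> P k c" by blast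
  then have P: "partition_on ?J P" and c: "0 < c" by (auto simp: graph_product_def)
  have gA: "emeasure \<theta> {x \<in> spJ ?J. \<forall>K\<in>P. restrict x K \<in> A K} = c * (\<Prod>K\<in>P. emeasure chacon_measure (graph_map K k -` A K))"
    if "\<forall>K\<in>P. A K \<in> sets (XJ K)" for A
    using g that unfolding graph_product_def by blast
  have fP: "finite P" using finite_elements[OF _ P] by simp
  show ?thesis
  proof (cases "?J \<in> P")
    case True
    \<comment> \<open>On the single block the points are the pairs of shifts of one z by
      \<open>k 1\<close> and \<open>k 2\<close>, so this difference takes the first coordinate to
      the second.\<close>
    let ?l = "k 2 - k 1"
    let ?D = "{x \<in> spJ ?J. x 2 \<noteq> chacon_T ?l (x 1)}"
    have c1: "(\<lambda>x. x 1) \<in> measurable (XJ ?J) borel" "(\<lambda>x. x 2) \<in> measurable (XJ ?J) borel"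
      using measurable_component_singleton[of _ ?J "\<lambda>_. borel :: chacon measure"] by auto
    have "Measurable.pred (XJ ?J) (\<lambda>x. x 2 = chacon_T ?l (x 1))"
      by (intro pred_chacon_eq c1 measurable_compose[OF c1(1) T_measurable])
    then have "{x \<in> space (XJ ?J). \<not> x 2 = chacon_T ?l (x 1)} \<in> sets (XJ ?J)" by measurable
    then have D: "?D \<in> sets (XJ ?J)" by (simp add: space_PiM)
    define A where "A K = (if K = ?J then ?D else spJ K)" for K
    have AJ: "A ?J = ?D" unfolding A_def by (rule if_P[OF refl])
    have re: "restrict x ?J = x" if "x \<in> spJ ?J" for x :: "nat \<Rightarrow> chacon" using that by (rule PiE_restrict)
    have "{x \<in> spJ ?J. \<forall>K\<in>P. restrict x K \<in> A K} = ?D"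
    proof (intro equalityI subsetI)
      fix x assume x: "x \<in> {x \<in> spJ ?J. \<forall>K\<in>P. restrict x K \<in> A K}"
      then have "restrict x ?J \<in> A ?J" "x \<in> spJ ?J" using True by blast+
      then show "x \<in> ?D" unfolding AJ by (simp only: re)
    next
      fix x assume x: "x \<in> ?D"
      then have xs: "x \<in> spJ ?J" by blast
      have "restrict x K \<in> A K" for K
      proof (cases "K = ?J")
        case True
        show ?thesis unfolding True AJ re[OF xs] by (rule x)
      next
        case False
        then show ?thesis by (simp add: A_def)
      qed
      then show "x \<in> {x \<in> spJ ?J. \<forall>K\<in>P. restrict x K \<in> A K}" using xs by blast
    qed
    moreover have "\<forall>K\<in>P. A K \<in> sets (XJ K)" using D spJ_sets by (simp add: A_def)
    moreover have "(\<Prod>K\<in>P. emeasure chacon_measure (graph_map K k -` A K)) = 0"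
    proof (rule prod_zero[OF fP])
      have "graph_map ?J k -` ?D = {}" by (auto simp: graph_map_def T_add)
      then have "emeasure chacon_measure (graph_map ?J k -` A ?J) = 0" by (simp only: AJ emeasure_empty)
      then show "\<exists>K\<in>P. emeasure chacon_measure (graph_map K k -` A K) = 0" by (rule bexI[OF _ True])
    qed
    ultimately have "emeasure \<theta> ?D = 0" using gA[of A] by simp
    then have "emeasure chacon_measure (\<phi> -` ?D) = 0" using em[OF D] by simp
    then have "AE x in chacon_measure. x \<notin> \<phi> -` ?D" using AE_eq_null[of "\<phi> -` ?D" chacon_measure] \<phi>s[OF D] by simp
    then have "AE x in chacon_measure. S x = chacon_T ?l x"
      by eventually_elim (auto simp: \<phi>_def)
    then show ?thesis ..
  next
    case False
    have blocks: "K = {1} \<or> K = {2}" if "K \<in> P" for K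
    proof -
      have "K \<subseteq> ?J" "K \<noteq> {}" "K \<noteq> ?J" using P that False by (auto simp: partition_on_def)
      then show ?thesis by blast
    qed
    have U: "\<Union>P = ?J" using P by (simp only: partition_on_def)
    have "{i} \<in> P" if i: "i \<in> ?J" for i
    proof -
      obtain K where K: "K \<in> P" "i \<in> K" using i unfolding U[symmetric] by (rule UnionE)
      then have "K = {i}" using blocks[OF K(1)] by (elim disjE) simp_all
      then show ?thesis using K(1) by simp
    qed
    then have PP: "P = {{1}, {2}}"
    proof (intro equalityI subsetI)
      fix K assume "K \<in> P"
      then show "K \<in> {{1}, {2}}" using blocks[of K] by simp
    qed auto
    have prod: "emeasure chacon_measure (A \<inter> S -` B) = c * (emeasure chacon_measure A * emeasure chacon_measure B)"
      if A: "A \<in> sets borel" and B: "B \<in> sets borel" for A B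
    proof -
      define C where "C K = {y \<in> spJ K. \<forall>i\<in>K. y i \<in> (if i = 1 then A else B)}" for K
      have C: "C {i} \<in> sets (XJ {i})" for i
        using pred_coord[of i "{i}" "if i = 1 then A else B"] A B by (simp add: C_def pred_def space_PiM)
      have "emeasure \<theta> {x \<in> spJ ?J. \<forall>K\<in>P. restrict x K \<in> C K} = c * (\<Prod>K\<in>P. emeasure chacon_measure (graph_map K k -` C K))"
        by (rule gA) (simp add: PP C)
      also have "(\<Prod>K\<in>P. emeasure chacon_measure (graph_map K k -` C K)) =
          emeasure chacon_measure (chacon_T (k 1) -` A) * emeasure chacon_measure (chacon_T (k 2) -` B)"
        by (simp add: PP C_def graph_map_def vimage_def)
      also have "\<dots> = emeasure chacon_measure A * emeasure chacon_measure B" by (simp add: emeasure_T A B)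
      also have "{x \<in> spJ ?J. \<forall>K\<in>P. restrict x K \<in> C K} = {x \<in> spJ ?J. x 1 \<in> A \<and> x 2 \<in> B}"
        by (auto simp: PP C_def)
      finally have *: "emeasure \<theta> {x \<in> spJ ?J. x 1 \<in> A \<and> x 2 \<in> B} = c * (emeasure chacon_measure A * emeasure chacon_measure B)" .
      have "{x \<in> spJ ?J. x 1 \<in> A \<and> x 2 \<in> B} \<in> sets (XJ ?J)"
      proof -
        have "{x \<in> space (XJ ?J). x 1 \<in> A \<and> x 2 \<in> B} \<in> sets (XJ ?J)"
          using pred_coord[of 1 ?J A] pred_coord[of 2 ?J B] A B by measurable
        then show ?thesis by (simp add: space_PiM)
      qed
      from em[OF this] have "emeasure \<theta> {x \<in> spJ ?J. x 1 \<in> A \<and> x 2 \<in> B} = emeasure chacon_measure (A \<inter> S -` B)"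
        using \<phi>sp by (simp add: \<phi>_def vimage_def Int_def)
      then show ?thesis using * by simp
    qed
    \<comment> \<open>At level 1 the positions are -3 to 3, and X_0 occupies -1, 0 and 2. The
      cylinder at 3 is thus a set of positive measure disjoint from X_0.\<close>
    have f3: "3 \<in> chacon_F 1" by (simp add: mem_chacon_F)
    have disj: "lev 0 \<inter> cyl 1 3 = {}"
      using pos_in_F[of _ 0] inc_cases[of _ 0] by (fastforce simp: cyl_def inc_def chacon_F_0)
    \<comment> \<open>The preimages under S of two disjoint sets are disjoint, so the product
      formula forces one factor to vanish, although S is nonsingular and both sets have positive
      measure.\<close>
    have "c * (emeasure chacon_measure (S -` lev 0) * emeasure chacon_measure (cyl 1 3)) = 0"
      using prod[OF SA[OF lev_measurable] cyl_measurable, of 0 1 3] disj by (simp flip: vimage_Int)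
    then have "emeasure chacon_measure (S -` lev 0) = 0"
      using c emeasure_cyl[OF f3] by auto
    then show ?thesis using Sn[OF lev_measurable, of 0] by (simp add: emeasure_lev_0)
  qed
qed

theorem theorem5p2: "radon_MSJ chacon_measure chacon_T"
  unfolding radon_MSJ_def radon_MSJ_fold_def
proof (intro allI impI conjI ballI)
  fix d :: nat and n assume "1 < d"
  show "chacon_T n \<in> centralizer chacon_measure (chacon_T 1)" by (rule T_centralizer)
next
  fix S assume "S \<in> centralizer chacon_measure (chacon_T 1)"
  then show "\<exists>n. AE x in chacon_measure. S x = chacon_T n x" by (rule centralizer_is_power)
next
  fix d \<theta> assume d: "1 < d" and th: "\<theta> \<in> ergodic_radon_self_joinings d chacon_measure (chacon_T 1)"
  have d1: "d \<ge> 1" using d by simp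
  interpret joining "{1..d}" \<theta> by (rule joiningI[OF d1 th])
  obtain P k c where "graph_product {1..d} \<theta> P k c"
    using joining_graph_product joining_axioms by blast
  then show "product_of_graph_joinings d chacon_measure (chacon_T 1) \<theta>"
    by (rule graph_product_imp_product_of_graph_joinings[OF d1 sets_th])
qed

end
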